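(* Let $n\ge1$, let $X$ be (a neighborhood of the origin of) the $A_n$-singularity $\{\zeta_1\zeta_2=\zeta_3^{n+1}\}\subset\mathbb{C}^3$, let $p\ge2$, and let $\varphi\in\mathrm{Dom}\,\bar\partial_w^{(p)}\subset L^p_{0,r}(X)$. Then $\varphi$ satisfies the condition $( * )$.
   Context: $X_{reg}=X\setminus\{0\}$ carries the metric induced from $\mathbb{C}^3$, with volume form $dV_X$; a $(0,r)$-form is in $L^p_{0,r}(X)$ if its restriction to $X_{reg}$ is in $L^p$ with respect to this metric. $\varphi\in L^p_{0,r}(X)$ is in $\mathrm{Dom}\,\bar\partial_w^{(p)}$ iff $\bar\partial\varphi$, in the sense of currents on $X$, is in $L^p_{0,r+1}(X)$. With $f=\zeta_1\zeta_2-\zeta_3^{n+1}$, the structure form $\omega_X$ is the unique meromorphic $(2,0)$-form on $X$ such that $df\wedge\omega_X=2\pi i\, d\zeta_1\wedge d\zeta_2\wedge d\zeta_3$ (Poincar\'e residue of $d\zeta_1\wedge d\zeta_2\wedge d\zeta_3/f$); it is holomorphic on $X\setminus\{0\}$. Condition $( * )$. Let $\chi_k$ denote sequences of smooth cut-off functions on $X$, each $\chi_k$ equal to $1$ in a neighborhood of $0$, with supports approaching $\{0\}$ as $k\to\infty$. A $(0,1)$-form $\varphi\in\mathrm{Dom}\,\bar\partial_w^{(p)}$ satisfies $( * )$ if $\lim_{k\to\infty}\int_X\omega_X\wedge\bar\partial\chi_k\wedge\varphi=0$ for some such sequence (the condition is independent of the choice of sequence). A function ($r=0$) $\varphi\in\mathrm{Dom}\,\bar\partial_w^{(p)}$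 satisfies $( * )$ if $\int_X\omega_X\wedge\bar\partial\chi_k\wedge\varphi\wedge\alpha\to0$ for any smooth $\bar\partial$-closed $(0,1)$-form $\alpha$ and any such sequence. For $r\ge2$ the condition is void. *)

theory Defs
  imports "HOL-Analysis.Analysis" "HOL-Combinatorics.Permutations"
begin

section \<open>Complex-valued differential forms on complex vector spaces\<close>

text \<open>
  A covector of degree \<open>k\<close> is a function on lists of \<open>k\<close> vectors; its values on lists of other
  lengths carry no information.  A differential form assigns a covector to every point.
\<close>

type_synonym 'n covector = "(complex ^ 'n) list \<Rightarrow> complex"
type_synonym 'n form = "complex ^ 'n \<Rightarrow> 'n covector"

text \<open>
  \<open>is_covector V a b \<eta>\<close>: \<open>\<eta>\<close> is an alternating real-multilinear form of bidegree \<open>(a, b)\<close> on the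
  complex subspace \<open>V\<close>.  The alternating \<open>k\<close>-forms split into types \<open>(a, b)\<close> with \<open>a + b = k\<close>, and
  a simultaneous scaling of all arguments by \<open>c\<close> acts on type \<open>(a, b)\<close> by the character
  \<open>c ^ a * cnj c ^ b\<close>; these characters are pairwise distinct, so the last clause
  says exactly that only the component of type \<open>(a, b)\<close> is present.
\<close>

definition is_covector :: "(complex ^ 'n::finite) set \<Rightarrow> nat \<Rightarrow> nat \<Rightarrow> 'n covector \<Rightarrow> bool" where
  "is_covector V a b \<eta> \<longleftrightarrow>
     (\<forall>vs. length vs = a + b \<and> set vs \<subseteq> V \<longrightarrow>
        (\<forall>i < a + b. \<forall>x \<in> V. \<forall>y \<in> V. \<forall>s t :: real.
           \<eta> (vs[i := s *\<^sub>R x + t *\<^sub>R y]) = s *\<^sub>R \<eta> (vs[i := x]) + t *\<^sub>R \<eta> (vs[i := y])) \<and>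
        (\<forall>i j. i < j \<and> j < a + b \<and> vs ! i = vs ! j \<longrightarrow> \<eta> vs = 0) \<and>
        (\<forall>c :: complex. \<eta> (map (\<lambda>v. c *s v) vs) = c ^ a * cnj c ^ b * \<eta> vs))"

text \<open>
  Normalised so that \<open>dz\<^sub>1 \<and> \<dots> \<and> dz\<^sub>k\<close> evaluates to a determinant; \<open>k\<close> is the degree of the left factor,
  and the degree of the right factor is read off from the number of arguments.
\<close>

definition wedge :: "nat \<Rightarrow> 'n::finite form \<Rightarrow> 'n form \<Rightarrow> 'n form" where
  "wedge k \<alpha> \<beta> z vs =
     (\<Sum>\<sigma> | \<sigma> permutes {..<length vs}.
        of_int (sign \<sigma>) * \<alpha> z (take k (permute_list \<sigma> vs)) * \<beta> z (drop k (permute_list \<sigma> vs)))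
     / (fact k * fact (length vs - k))"

definition dcoord :: "'n::finite \<Rightarrow> 'n form" where
  "dcoord i z vs = hd vs $ i"

definition differential :: "(complex ^ 'n::finite \<Rightarrow> complex) \<Rightarrow> 'n form" where
  "differential f z vs = frechet_derivative f (at z) (hd vs)"

definition function_form :: "(complex ^ 'n::finite \<Rightarrow> real) \<Rightarrow> 'n form" where
  "function_form u z vs = complex_of_real (u z)"

text \<open>
  \<open>dbar_dir g z v\<close> is \<open>\<Sum>\<^sub>j (\<partial>g / \<partial>cnj z\<^sub>j) * cnj v\<^sub>j\<close>, and \<open>dbar \<eta>\<close> is
  \<open>\<Sum>\<^sub>I \<partial>bar \<eta>\<^sub>I \<and> dz\<^sub>I\<close>, where \<open>dz\<^sub>I\<close> runs over the constant forms and \<open>\<eta>\<^sub>I\<close> are the coefficients of \<open>\<eta>\<close>.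
\<close>

definition dbar_dir :: "(complex ^ 'n::finite \<Rightarrow> complex) \<Rightarrow> complex ^ 'n \<Rightarrow> complex ^ 'n \<Rightarrow> complex" where
  "dbar_dir g z v =
     (frechet_derivative g (at z) v + \<i> * frechet_derivative g (at z) (\<i> *s v)) / 2"

definition dbar :: "'n::finite form \<Rightarrow> 'n form" where
  "dbar \<eta> z vs =
     (\<Sum>j < length vs. (- 1) ^ j *
        dbar_dir (\<lambda>x. \<eta> x (take j vs @ drop (Suc j) vs)) z (vs ! j))"

fun Ck_on :: "nat \<Rightarrow> ('a::real_normed_vector \<Rightarrow> 'b::real_normed_vector) \<Rightarrow> 'a set \<Rightarrow> bool" where
  "Ck_on 0 f S \<longleftrightarrow> continuous_on S f"
| "Ck_on (Suc k) f S \<longleftrightarrow>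
     (\<forall>x \<in> S. f differentiable (at x)) \<and>
     (\<forall>v. Ck_on k (\<lambda>x. frechet_derivative f (at x) v) S)"

definition smooth_on :: "('a::real_normed_vector \<Rightarrow> 'b::real_normed_vector) \<Rightarrow> 'a set \<Rightarrow> bool" where
  "smooth_on f S \<longleftrightarrow> (\<forall>k. Ck_on k f S)"

definition smooth_form :: "(complex ^ 'n::finite) set \<Rightarrow> nat \<Rightarrow> nat \<Rightarrow> 'n form \<Rightarrow> bool" where
  "smooth_form U a b \<eta> \<longleftrightarrow>
     (\<forall>z \<in> U. is_covector UNIV a b (\<eta> z)) \<and>
     (\<forall>vs. length vs = a + b \<longrightarrow> smooth_on (\<lambda>z. \<eta> z vs) U)"

section \<open>The singularity, its regular part and integration on it\<close>

definition An_poly :: "nat \<Rightarrow> complex ^ 3 \<Rightarrow> complex" where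
  "An_poly n z = z $ 1 * z $ 2 - z $ 3 ^ (n + 1)"

text \<open>
  Throughout, \<open>U\<close> is an open neighbourhood of the origin in \<open>\<complex>\<^sup>3\<close> and \<open>X\<close> is the part of
  the singularity inside \<open>U\<close>.
\<close>

definition An :: "nat \<Rightarrow> (complex ^ 3) set \<Rightarrow> (complex ^ 3) set" where
  "An n U = {z \<in> U. An_poly n z = 0}"

definition An_reg :: "nat \<Rightarrow> (complex ^ 3) set \<Rightarrow> (complex ^ 3) set" where
  "An_reg n U = An n U - {0}"

definition An_tangent :: "nat \<Rightarrow> complex ^ 3 \<Rightarrow> (complex ^ 3) set" where
  "An_tangent n z = {v. frechet_derivative (An_poly n) (at z) v = 0}"

text \<open>
  The two holomorphic graph charts, both with domain \<open>{w. fst w \<noteq> 0}\<close>: they parametrise the parts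
  of the surface where the first, respectively the second, coordinate is nonzero.
\<close>

definition An_chart1 :: "nat \<Rightarrow> complex \<times> complex \<Rightarrow> complex ^ 3" where
  "An_chart1 n w = vector [fst w, snd w ^ (n + 1) / fst w, snd w]"

definition An_chart2 :: "nat \<Rightarrow> complex \<times> complex \<Rightarrow> complex ^ 3" where
  "An_chart2 n w = vector [snd w ^ (n + 1) / fst w, fst w, snd w]"

text \<open>
  Integrals over the regular part are computed by splitting it into the image of the first chart
  and the remainder, which lies in the second chart.
\<close>

definition An_dom1 :: "nat \<Rightarrow> (complex ^ 3) set \<Rightarrow> (complex \<times> complex) set" where
  "An_dom1 n U = {w. fst w \<noteq> 0 \<and> An_chart1 n w \<in> U}"

definition An_dom2 :: "nat \<Rightarrow> (complex ^ 3) set \<Rightarrow> (complex \<times> complex) set" where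
  "An_dom2 n U = {w. fst w \<noteq> 0 \<and> An_chart2 n w \<in> U}"

definition An_rest2 :: "nat \<Rightarrow> (complex ^ 3) set \<Rightarrow> (complex \<times> complex) set" where
  "An_rest2 n U = {w \<in> An_dom2 n U. An_chart2 n w \<notin> An_chart1 n ` An_dom1 n U}"

lemma An_reg_charts:
  "An_chart1 n ` An_dom1 n U \<union> An_chart2 n ` An_rest2 n U = An_reg n U"
proof -
  have 1: "An_chart1 n ` An_dom1 n U = {z \<in> An_reg n U. z $ 1 \<noteq> 0}"
  proof (intro equalityI subsetI)
    fix z assume "z \<in> {z \<in> An_reg n U. z $ 1 \<noteq> 0}"
    then have z: "z \<in> U" "z $ 1 * z $ 2 = z $ 3 ^ (n + 1)" "z $ 1 \<noteq> 0"
      by (auto simp: An_reg_def An_def An_poly_def)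
    have "z = An_chart1 n (z $ 1, z $ 3)"
      using z by (simp add: An_chart1_def vec_eq_iff forall_3 field_simps)
    then show "z \<in> An_chart1 n ` An_dom1 n U"
      using z by (intro image_eqI[of _ _ "(z $ 1, z $ 3)"]) (auto simp: An_dom1_def)
  qed (auto simp: An_dom1_def An_reg_def An_def An_poly_def An_chart1_def vec_eq_iff forall_3)
  have 2: "An_chart2 n ` An_dom2 n U = {z \<in> An_reg n U. z $ 2 \<noteq> 0}"
  proof (intro equalityI subsetI)
    fix z assume "z \<in> {z \<in> An_reg n U. z $ 2 \<noteq> 0}"
    then have z: "z \<in> U" "z $ 1 * z $ 2 = z $ 3 ^ (n + 1)" "z $ 2 \<noteq> 0"
      by (auto simp: An_reg_def An_def An_poly_def)
    have "z = An_chart2 n (z $ 2, z $ 3)"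
      using z by (simp add: An_chart2_def vec_eq_iff forall_3 field_simps)
    then show "z \<in> An_chart2 n ` An_dom2 n U"
      using z by (intro image_eqI[of _ _ "(z $ 2, z $ 3)"]) (auto simp: An_dom2_def)
  qed (auto simp: An_dom2_def An_reg_def An_def An_poly_def An_chart2_def vec_eq_iff forall_3)
  have "An_chart2 n ` An_rest2 n U = An_chart2 n ` An_dom2 n U - An_chart1 n ` An_dom1 n U"
    by (auto simp: An_rest2_def)
  moreover have "z $ 1 \<noteq> 0 \<or> z $ 2 \<noteq> 0" if "z \<in> An_reg n U" for z
    using that by (auto simp: An_reg_def An_def An_poly_def vec_eq_iff forall_3)
  ultimately show ?thesis
    unfolding 1 2 by blast
qed

definition pullback ::
    "(complex \<times> complex \<Rightarrow> complex ^ 'n::finite) \<Rightarrow> 'n form \<Rightarrow>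
      complex \<times> complex \<Rightarrow> (complex \<times> complex) list \<Rightarrow> complex" where
  "pullback \<Phi> \<eta> w us = \<eta> (\<Phi> w) (map (frechet_derivative \<Phi> (at w)) us)"

text \<open>
  The coefficient of a 4-form with respect to Lebesgue measure on \<open>\<complex> \<times> \<complex>\<close>, for the complex
  orientation.
\<close>

definition top_coeff ::
    "(complex \<times> complex \<Rightarrow> complex ^ 'n::finite) \<Rightarrow> 'n form \<Rightarrow> complex \<times> complex \<Rightarrow> complex" where
  "top_coeff \<Phi> \<eta> w = pullback \<Phi> \<eta> w [(1, 0), (\<i>, 0), (0, 1), (0, \<i>)]"

definition An_integral :: "nat \<Rightarrow> (complex ^ 3) set \<Rightarrow> 3 form \<Rightarrow> complex" where
  "An_integral n U \<eta> =
     (LINT w:An_dom1 n U|lebesgue. top_coeff (An_chart1 n) \<eta> w) +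
     (LINT w:An_rest2 n U|lebesgue. top_coeff (An_chart2 n) \<eta> w)"

definition hermitian_inner :: "complex ^ 'n::finite \<Rightarrow> complex ^ 'n \<Rightarrow> complex" where
  "hermitian_inner u v = (\<Sum>i \<in> UNIV. u $ i * cnj (v $ i))"

text \<open>
  The Riemannian volume of the induced metric in holomorphic coordinates: the determinant of the
  Hermitian matrix \<open>h\<^sub>j\<^sub>k = \<langle>\<partial>\<^sub>j \<Phi>, \<partial>\<^sub>k \<Phi>\<rangle>\<close>, which is the square root of the real Gram
  determinant.
\<close>

definition vol_density ::
    "(complex \<times> complex \<Rightarrow> complex ^ 'n::finite) \<Rightarrow> complex \<times> complex \<Rightarrow> real" where
  "vol_density \<Phi> w =
     (let D1 = frechet_derivative \<Phi> (at w) (1, 0); D2 = frechet_derivative \<Phi> (at w) (0, 1)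
      in Re (hermitian_inner D1 D1 * hermitian_inner D2 D2
           - hermitian_inner D1 D2 * hermitian_inner D2 D1))"

definition An_nn_integral ::
    "nat \<Rightarrow> (complex ^ 3) set \<Rightarrow> (complex ^ 3 \<Rightarrow> ennreal) \<Rightarrow> ennreal" where
  "An_nn_integral n U g =
     (\<integral>\<^sup>+ w \<in> An_dom1 n U. g (An_chart1 n w) * ennreal (vol_density (An_chart1 n) w) \<partial>lebesgue) +
     (\<integral>\<^sup>+ w \<in> An_rest2 n U. g (An_chart2 n w) * ennreal (vol_density (An_chart2 n) w) \<partial>lebesgue)"

definition An_AE :: "nat \<Rightarrow> (complex ^ 3) set \<Rightarrow> (complex ^ 3 \<Rightarrow> bool) \<Rightarrow> bool" where
  "An_AE n U P \<longleftrightarrow>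
     (AE w in lebesgue. w \<in> An_dom1 n U \<longrightarrow> P (An_chart1 n w)) \<and>
     (AE w in lebesgue. w \<in> An_dom2 n U \<longrightarrow> P (An_chart2 n w))"

section \<open>The spaces of integrable forms and the weak d-bar operator\<close>

text \<open>
  The pointwise norm for the metric induced from \<open>\<complex>\<^sup>3\<close>, as the operator norm on the tangent space.
  It agrees with the Hermitian norm on \<open>(0, r)\<close>-covectors up to a constant depending only on \<open>r\<close>.
\<close>

definition An_norm :: "nat \<Rightarrow> nat \<Rightarrow> 3 form \<Rightarrow> complex ^ 3 \<Rightarrow> real" where
  "An_norm n r \<phi> z =
     (SUP vs \<in> {vs. length vs = r \<and> (\<forall>v \<in> set vs. v \<in> An_tangent n z \<and> norm v \<le> 1)}.
        norm (\<phi> z vs))"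

text \<open>
  A \<open>(0, r)\<close>-form on the regular part is given by its values on tangent vectors; nothing is assumed
  about \<open>\<phi>\<close> elsewhere.
\<close>

definition is_An_form :: "nat \<Rightarrow> (complex ^ 3) set \<Rightarrow> nat \<Rightarrow> 3 form \<Rightarrow> bool" where
  "is_An_form n U r \<phi> \<longleftrightarrow>
     (\<forall>z \<in> An_reg n U. is_covector (An_tangent n z) 0 r (\<phi> z)) \<and>
     (\<forall>us. length us = r \<longrightarrow>
        (\<lambda>w. pullback (An_chart1 n) \<phi> w us) \<in> borel_measurable (lebesgue_on (An_dom1 n U)) \<and>
        (\<lambda>w. pullback (An_chart2 n) \<phi> w us) \<in> borel_measurable (lebesgue_on (An_dom2 n U)))"

definition Lp_form :: "nat \<Rightarrow> (complex ^ 3) set \<Rightarrow> ennreal \<Rightarrow> nat \<Rightarrow> 3 form \<Rightarrow> bool" where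
  "Lp_form n U p r \<phi> \<longleftrightarrow>
     is_An_form n U r \<phi> \<and>
     (if p = \<infinity> then \<exists>C. An_AE n U (\<lambda>z. An_norm n r \<phi> z \<le> C)
      else An_nn_integral n U (\<lambda>z. ennreal (An_norm n r \<phi> z powr enn2real p)) < \<infinity>)"

text \<open>
  Test forms on \<open>X\<close> are restrictions of smooth ambient forms with compact support in \<open>U\<close>; their
  support may contain the singular point.
\<close>

definition test_form :: "(complex ^ 3) set \<Rightarrow> nat \<Rightarrow> nat \<Rightarrow> 3 form \<Rightarrow> bool" where
  "test_form U a b \<xi> \<longleftrightarrow>
     smooth_form U a b \<xi> \<and>
     (\<exists>K. compact K \<and> K \<subseteq> U \<and> (\<forall>z \<in> U - K. \<forall>vs. length vs = a + b \<longrightarrow> \<xi> z vs = 0))"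

text \<open>
  \<open>\<partial>bar \<phi> = \<psi>\<close> as currents on \<open>X\<close>.  By bidegree reasons only test forms of bidegree
  \<open>(2, 1 - r)\<close> matter; for \<open>r \<ge> 2\<close> there are none.
\<close>

definition weak_dbar ::
    "nat \<Rightarrow> (complex ^ 3) set \<Rightarrow> nat \<Rightarrow> 3 form \<Rightarrow> 3 form \<Rightarrow> bool" where
  "weak_dbar n U r \<phi> \<psi> \<longleftrightarrow>
     (\<forall>q \<xi>. r + 1 + q = 2 \<and> test_form U 2 q \<xi> \<longrightarrow>
        An_integral n U (wedge (r + 1) \<psi> \<xi>) =
        (- 1) ^ (r + 1) * An_integral n U (wedge r \<phi> (dbar \<xi>)))"

definition in_Dom_dbar_w :: "nat \<Rightarrow> (complex ^ 3) set \<Rightarrow> ennreal \<Rightarrow> nat \<Rightarrow> 3 form \<Rightarrow> bool" where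
  "in_Dom_dbar_w n U p r \<phi> \<longleftrightarrow>
     Lp_form n U p r \<phi> \<and> (\<exists>\<psi>. Lp_form n U p (r + 1) \<psi> \<and> weak_dbar n U r \<phi> \<psi>)"

section \<open>The structure form and the boundary condition\<close>

text \<open>
  The equation is one between forms on \<open>\<complex>\<^sup>3\<close> at the points of the regular part.  It determines the
  restriction of \<open>\<omega>\<close> to the tangent spaces of the regular part (and nothing else enters below);
  this restriction is automatically holomorphic there and meromorphic on \<open>X\<close>.
\<close>

definition is_structure_form :: "nat \<Rightarrow> (complex ^ 3) set \<Rightarrow> 3 form \<Rightarrow> bool" where
  "is_structure_form n U \<omega> \<longleftrightarrow>
     (\<forall>z \<in> An_reg n U.
        is_covector UNIV 2 0 (\<omega> z) \<and>
        (\<forall>vs. length vs = 3 \<longrightarrow>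
           wedge 1 (differential (An_poly n)) \<omega> z vs =
           2 * of_real pi * \<i> * wedge 1 (dcoord 1) (wedge 1 (dcoord 2) (dcoord 3)) z vs))"

definition cutoff_sequence ::
    "nat \<Rightarrow> (complex ^ 3) set \<Rightarrow> (nat \<Rightarrow> complex ^ 3 \<Rightarrow> real) \<Rightarrow> bool" where
  "cutoff_sequence n U \<kappa> \<longleftrightarrow>
     (\<forall>k. smooth_on (\<kappa> k) U \<and>
          (\<forall>z \<in> An n U. 0 \<le> \<kappa> k z \<and> \<kappa> k z \<le> 1) \<and>
          (\<exists>V. open V \<and> 0 \<in> V \<and> (\<forall>z \<in> V \<inter> An n U. \<kappa> k z = 1))) \<and>
     (\<forall>\<epsilon> > 0. \<forall>\<^sub>F k in sequentially. \<forall>z \<in> An n U. \<kappa> k z \<noteq> 0 \<longrightarrow> norm z < \<epsilon>)"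

definition dbar_closed_on_An :: "nat \<Rightarrow> (complex ^ 3) set \<Rightarrow> 3 form \<Rightarrow> bool" where
  "dbar_closed_on_An n U \<alpha> \<longleftrightarrow>
     (\<forall>z \<in> An_reg n U. \<forall>u \<in> An_tangent n z. \<forall>v \<in> An_tangent n z. dbar \<alpha> z [u, v] = 0)"

definition condition_star ::
    "nat \<Rightarrow> (complex ^ 3) set \<Rightarrow> 3 form \<Rightarrow> nat \<Rightarrow> 3 form \<Rightarrow> bool" where
  "condition_star n U \<omega> r \<phi> \<longleftrightarrow>
     (r = 0 \<longrightarrow>
        (\<forall>\<alpha> \<kappa>. smooth_form U 0 1 \<alpha> \<and> dbar_closed_on_An n U \<alpha> \<and> cutoff_sequence n U \<kappa> \<longrightarrow>
           (\<lambda>k. An_integral n U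
                  (wedge 2 \<omega> (wedge 1 (dbar (function_form (\<kappa> k))) (wedge 0 \<phi> \<alpha>))))
             \<longlonglongrightarrow> 0)) \<and>
     (r = 1 \<longrightarrow>
        (\<exists>\<kappa>. cutoff_sequence n U \<kappa> \<and>
           (\<lambda>k. An_integral n U (wedge 2 \<omega> (wedge 1 (dbar (function_form (\<kappa> k))) \<phi>)))
             \<longlonglongrightarrow> 0))"

end

theory Submission
  imports Defs
begin

text \<open>
  The integrals in the condition live on shrinking neighbourhoods of the singular point.  The coefficient of
  \<open>\<omega> \<and> \<partial>bar \<chi> \<and> \<phi>\<close> is bounded pointwise by the product of the norms of the three forms, so by
  Cauchy-Schwarz the integral is at most the \<open>L\<^sup>2\<close> norm of \<open>\<phi>\<close> on the support of \<open>\<partial>bar \<chi>\<close> times the \<open>L\<^sup>2\<close> norm of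
  \<open>\<partial>bar \<chi>\<close> for the measure \<open>\<bar>\<omega>\<bar>\<^sup>2 dV\<close>.  In the coordinates \<open>(\<zeta>\<^sub>1, \<zeta>\<^sub>3)\<close>, which cover the surface up to a null set,
  this measure is a multiple of \<open>\<bar>\<zeta>\<^sub>1\<bar>\<^sup>-\<^sup>2 d\<zeta>\<^sub>1 d\<zeta>\<^sub>3\<close>, and a ball of radius \<open>2\<^sup>-\<^sup>j\<close> has mass of order at most
  \<open>4\<^sup>-\<^sup>j (j + 1)\<close> (\<open>cone_region_mass\<close>).  As \<open>p \<ge> 2\<close> and the volume near the origin is finite, \<open>\<phi>\<close> is in \<open>L\<^sup>2\<close> there.

  A radial cut-off function at scale \<open>2\<^sup>-\<^sup>j\<close> has a gradient of size \<open>2\<^sup>j\<close>, supported in a dyadic shell.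
  The square of the integral is then at most a constant times \<open>(j + 1) a\<^sub>j\<close>, where \<open>a\<^sub>j\<close> is the square integral of \<open>\<phi>\<close>
  over the shell.  The logarithmic loss \<open>j + 1\<close> is harmless: the \<open>a\<^sub>j\<close> are summable while the harmonic
  series diverges, so \<open>(j + 1) a\<^sub>j\<close> is arbitrarily small for infinitely many \<open>j\<close>
  (\<open>cutoff_integral_small\<close>).  A suitable sequence of scales proves the case \<open>r = 1\<close>.

  In the case \<open>r = 0\<close> the cut-off functions \<open>\<chi>\<close> are given and their gradients are out of control.  Here the weak equation
  \<open>\<partial>bar \<phi> = \<psi>\<close> helps.  If \<open>\<chi>'\<close> is a radial cut-off function, then \<open>\<chi> - \<chi>'\<close> vanishes on the surface near the origin and
  \<open>(\<chi> - \<chi>') \<omega> \<and> \<alpha>\<close> is the restriction of a test form; as \<open>\<omega>\<close> is holomorphic on the regular part and \<open>\<alpha>\<close> is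
  closed, its \<open>\<partial>bar\<close> involves only the derivatives of \<open>\<chi> - \<chi>'\<close>.  So the integrals for \<open>\<chi>\<close> and \<open>\<chi>'\<close> differ by an integral of
  \<open>(\<chi> - \<chi>') \<psi> \<and> \<alpha> \<and> \<omega>\<close>, up to sign (\<open>cutoff_difference_formula\<close>), and this is small because \<open>\<psi>\<close> and \<open>\<omega>\<close> are square
  integrable near the origin.  The ambient extension of \<open>\<omega>\<close> that the test form needs is
  \<open>residue_form\<close>.
\<close>

section \<open>A calculus for smooth functions\<close>

lemma Ck_on_cong:
  assumes "open S" "\<And>x. x \<in> S \<Longrightarrow> f x = g x" "Ck_on k f S"
  shows "Ck_on k g S"
  using assms(2,3)
proof (induction k arbitrary: f g)
  case 0
  then show ?case using continuous_on_cong by (metis Ck_on.simps(1))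
next
  case (Suc k)
  have d: "(g has_derivative frechet_derivative f (at x)) (at x)" if "x \<in> S" for x
  proof (rule has_derivative_transform_within_open[OF _ assms(1) that])
    show "(f has_derivative frechet_derivative f (at x)) (at x)"
      using Suc.prems that frechet_derivative_works by (metis Ck_on.simps(2))
  qed (use Suc.prems in auto)
  have "Ck_on k (\<lambda>x. frechet_derivative g (at x) v) S" for v
  proof (rule Suc.IH)
    show "Ck_on k (\<lambda>x. frechet_derivative f (at x) v) S" using Suc.prems by simp
  qed (metis d frechet_derivative_at)
  with d show ?case by (auto simp: differentiable_def)
qed

text \<open>The derivative may be given by any formula that is valid on the open set \<open>S\<close>; the calculus rules
  below are then the rules for \<open>has_derivative\<close> combined with induction on \<open>k\<close>.\<close>

lemma Ck_on_SucI:
  assumes "open S" "\<And>x. x \<in> S \<Longrightarrow> (f has_derivative f' x) (at x)"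
    and "\<And>v. Ck_on k (\<lambda>x. f' x v) S"
  shows "Ck_on (Suc k) f S"
proof -
  have "Ck_on k (\<lambda>x. frechet_derivative f (at x) v) S" for v
    by (rule Ck_on_cong[OF assms(1) _ assms(3)[of v]]) (metis assms(2) frechet_derivative_at)
  with assms(2) show ?thesis by (auto simp: differentiable_def)
qed

lemma Ck_on_has_derivative:
  "Ck_on (Suc k) f S \<Longrightarrow> x \<in> S \<Longrightarrow> (f has_derivative frechet_derivative f (at x)) (at x)"
  using frechet_derivative_works by auto

lemma Ck_on_SucD: "Ck_on (Suc k) f S \<Longrightarrow> Ck_on k f S"
proof (induction k arbitrary: f)
  case 0
  then show ?case
    using differentiable_imp_continuous_on differentiable_on_def differentiable_at_withinI
    by (metis Ck_on.simps(1) Ck_on.simps(2))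
next
  case (Suc k)
  then show ?case by (metis Ck_on.simps(2))
qed

text \<open>Smoothness is local.  This makes products smooth in which one factor is singular at a point near which
  the other factor vanishes.\<close>

lemma Ck_on_Un:
  "open S \<Longrightarrow> open T \<Longrightarrow> Ck_on k f S \<Longrightarrow> Ck_on k f T \<Longrightarrow> Ck_on k f (S \<union> T)"
proof (induction k arbitrary: f)
  case 0
  then show ?case by (auto intro: continuous_on_open_Un)
qed auto

lemma Ck_on_subset: "Ck_on k f S \<Longrightarrow> T \<subseteq> S \<Longrightarrow> Ck_on k f T"
proof (induction k arbitrary: f)
  case 0
  then show ?case by (auto intro: continuous_on_subset)
qed auto

lemma Ck_on_const: "Ck_on k (\<lambda>x. c) S"
  by (induction k arbitrary: c) auto

lemma Ck_on_add:
  assumes "open S" "Ck_on k f S" "Ck_on k g S"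
  shows "Ck_on k (\<lambda>x. f x + g x) S"
  using assms(2,3)
proof (induction k arbitrary: f g)
  case 0
  then show ?case by (auto intro: continuous_on_add)
next
  case (Suc k)
  show ?case
    by (rule Ck_on_SucI[OF assms(1) has_derivative_add[OF Suc.prems[THEN Ck_on_has_derivative]]])
      (use Suc in auto)
qed

lemma Ck_on_linear_compose:
  assumes "open S" "bounded_linear L" "Ck_on k f S"
  shows "Ck_on k (\<lambda>x. L (f x)) S"
  using assms(3)
proof (induction k arbitrary: f)
  case 0
  then show ?case using assms(2) by (auto intro: bounded_linear.continuous_on)
next
  case (Suc k)
  show ?case
    by (rule Ck_on_SucI[OF assms(1)
          bounded_linear.has_derivative[OF assms(2) Suc.prems[THEN Ck_on_has_derivative]]])
      (use Suc in auto)
qed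

lemma Ck_on_linear:
  assumes "open S" "bounded_linear L" shows "Ck_on k L S"
proof (cases k)
  case 0
  then show ?thesis using assms(2) by (auto intro: linear_continuous_on)
next
  case (Suc m)
  then show ?thesis
    using Ck_on_SucI[OF assms(1) bounded_linear_imp_has_derivative[OF assms(2)] Ck_on_const] by simp
qed

lemma Ck_on_bilinear:
  assumes "open S" "bounded_bilinear B" "Ck_on k f S" "Ck_on k g S"
  shows "Ck_on k (\<lambda>x. B (f x) (g x)) S"
  using assms(3,4)
proof (induction k arbitrary: f g)
  case 0
  then show ?case using assms(2) by (auto intro: bounded_bilinear.continuous_on)
next
  case (Suc k)
  show ?case
  proof (rule Ck_on_SucI[OF assms(1)
        bounded_bilinear.FDERIV[OF assms(2) Suc.prems[THEN Ck_on_has_derivative]]])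
    show "Ck_on k (\<lambda>x. B (f x) (frechet_derivative g (at x) v) +
             B (frechet_derivative f (at x) v) (g x)) S" for v
      using Suc.prems by (intro Ck_on_add[OF assms(1)] Suc.IH) (auto dest: Ck_on_SucD simp del: Ck_on.simps, auto)
  qed
qed

text \<open>The outer function is given together with all its derivatives \<open>g j\<close>: the chain rule then
  stays inside the class of functions \<open>g j \<circ> u\<close>, so that the induction needs no formula for
  higher derivatives of a composition.\<close>

lemma Ck_on_compose:
  fixes g :: "nat \<Rightarrow> 'a::real_normed_field \<Rightarrow> 'a"
  assumes "open S" "Ck_on k u S" "\<And>x. x \<in> S \<Longrightarrow> u x \<in> T"
    and "\<And>j t. t \<in> T \<Longrightarrow> (g j has_field_derivative g (Suc j) t) (at t)"
  shows "Ck_on k (\<lambda>x. g i (u x)) S"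
  using assms(2)
proof (induction k arbitrary: i)
  case 0
  have "continuous_on T (g i)"
    using assms(4) by (meson DERIV_continuous_on has_field_derivative_at_within)
  with 0 assms(3) show ?case by (auto intro: continuous_on_compose2)
next
  case (Suc k)
  show ?case
  proof (rule Ck_on_SucI[OF assms(1)])
    show "((\<lambda>x. g i (u x)) has_derivative
        (\<lambda>v. g (Suc i) (u x) * frechet_derivative u (at x) v)) (at x)" if "x \<in> S" for x
      using has_derivative_compose[OF Ck_on_has_derivative[OF Suc.prems that]
          assms(4)[OF assms(3)[OF that], of i, unfolded has_field_derivative_def]] .
    show "Ck_on k (\<lambda>x. g (Suc i) (u x) * frechet_derivative u (at x) v) S" for v
      using Suc Ck_on_SucD by (intro Ck_on_bilinear[OF assms(1) bounded_bilinear_mult]) auto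
  qed
qed

lemma Ck_on_inverse:
  fixes u :: "'b::real_normed_vector \<Rightarrow> 'a::real_normed_field"
  assumes "open S" "Ck_on k u S" "\<And>x. x \<in> S \<Longrightarrow> u x \<noteq> 0"
  shows "Ck_on k (\<lambda>x. inverse (u x)) S"
proof -
  define g :: "nat \<Rightarrow> 'a \<Rightarrow> 'a" where "g j t = (- 1) ^ j * fact j * inverse t ^ Suc j" for j t
  have "Ck_on k (\<lambda>x. g 0 (u x)) S"
  proof (rule Ck_on_compose[OF assms(1,2), where T = "- {0}"])
    show "(g j has_field_derivative g (Suc j) t) (at t)" if "t \<in> - {0}" for j t
    proof -
      have "((\<lambda>t. (- 1) ^ j * fact j * inverse t ^ Suc j) has_field_derivative
          (- 1) ^ j * fact j * ((1 + of_nat j) * ((- (inverse t ^ Suc (Suc 0))) * inverse t ^ j))) (at t)"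
        using that by (intro DERIV_cmult[OF DERIV_power_Suc[OF DERIV_inverse]]) auto
      moreover have "(- 1) ^ j * fact j * ((1 + of_nat j) * ((- (inverse t ^ Suc (Suc 0))) * inverse t ^ j))
          = g (Suc j) t"
        by (simp add: g_def mult_ac)
      ultimately show ?thesis unfolding g_def[of j, abs_def] by metis
    qed
  qed (use assms(3) in auto)
  then show ?thesis by (simp add: g_def)
qed

lemma smooth_on_cong:
  "open S \<Longrightarrow> (\<And>x. x \<in> S \<Longrightarrow> f x = g x) \<Longrightarrow> smooth_on f S \<Longrightarrow> smooth_on g S"
  unfolding smooth_on_def using Ck_on_cong by blast

lemma smooth_on_subset: "smooth_on f S \<Longrightarrow> T \<subseteq> S \<Longrightarrow> smooth_on f T"
  unfolding smooth_on_def using Ck_on_subset by blast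

lemma smooth_on_Un: "open S \<Longrightarrow> open T \<Longrightarrow> smooth_on f S \<Longrightarrow> smooth_on f T \<Longrightarrow> smooth_on f (S \<union> T)"
  unfolding smooth_on_def using Ck_on_Un by blast

lemma smooth_on_const: "smooth_on (\<lambda>x. c) S"
  unfolding smooth_on_def using Ck_on_const by blast

lemma smooth_on_add:
  "open S \<Longrightarrow> smooth_on f S \<Longrightarrow> smooth_on g S \<Longrightarrow> smooth_on (\<lambda>x. f x + g x) S"
  unfolding smooth_on_def using Ck_on_add by blast

lemma smooth_on_linear: "open S \<Longrightarrow> bounded_linear L \<Longrightarrow> smooth_on L S"
  unfolding smooth_on_def using Ck_on_linear by blast

lemma smooth_on_linear_compose:
  "open S \<Longrightarrow> bounded_linear L \<Longrightarrow> smooth_on f S \<Longrightarrow> smooth_on (\<lambda>x. L (f x)) S"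
  unfolding smooth_on_def using Ck_on_linear_compose by blast

lemma smooth_on_bilinear:
  "open S \<Longrightarrow> bounded_bilinear B \<Longrightarrow> smooth_on f S \<Longrightarrow> smooth_on g S \<Longrightarrow> smooth_on (\<lambda>x. B (f x) (g x)) S"
  unfolding smooth_on_def using Ck_on_bilinear by blast

lemma smooth_on_mult:
  fixes f g :: "'b::real_normed_vector \<Rightarrow> 'a::real_normed_algebra"
  shows "open S \<Longrightarrow> smooth_on f S \<Longrightarrow> smooth_on g S \<Longrightarrow> smooth_on (\<lambda>x. f x * g x) S"
  by (rule smooth_on_bilinear[OF _ bounded_bilinear_mult])

lemma smooth_on_uminus: "open S \<Longrightarrow> smooth_on f S \<Longrightarrow> smooth_on (\<lambda>x. - f x) S"
  using smooth_on_linear_compose bounded_linear_minus[OF bounded_linear_ident] by fastforce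

lemma smooth_on_diff:
  "open S \<Longrightarrow> smooth_on f S \<Longrightarrow> smooth_on g S \<Longrightarrow> smooth_on (\<lambda>x. f x - g x) S"
  using smooth_on_add[OF _ _ smooth_on_uminus] by fastforce

lemma smooth_on_power:
  fixes f :: "'b::real_normed_vector \<Rightarrow> 'a::real_normed_algebra_1"
  shows "open S \<Longrightarrow> smooth_on f S \<Longrightarrow> smooth_on (\<lambda>x. f x ^ m) S"
  by (induction m) (auto intro: smooth_on_mult smooth_on_const)

lemma smooth_on_compose:
  fixes g :: "nat \<Rightarrow> 'a::real_normed_field \<Rightarrow> 'a"
  assumes "open S" "smooth_on u S" "\<And>x. x \<in> S \<Longrightarrow> u x \<in> T"
    and "\<And>j t. t \<in> T \<Longrightarrow> (g j has_field_derivative g (Suc j) t) (at t)"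
  shows "smooth_on (\<lambda>x. g i (u x)) S"
  unfolding smooth_on_def
proof
  show "Ck_on k (\<lambda>x. g i (u x)) S" for k
    by (rule Ck_on_compose[OF assms(1), where T = T]) (use assms in \<open>auto simp: smooth_on_def\<close>)
qed

lemma smooth_on_inverse:
  fixes u :: "'b::real_normed_vector \<Rightarrow> 'a::real_normed_field"
  assumes "open S" "smooth_on u S" "\<And>x. x \<in> S \<Longrightarrow> u x \<noteq> 0"
  shows "smooth_on (\<lambda>x. inverse (u x)) S"
  using Ck_on_inverse[OF assms(1), of _ u] assms(2,3) unfolding smooth_on_def by blast

lemma smooth_on_has_derivative:
  "smooth_on f S \<Longrightarrow> x \<in> S \<Longrightarrow> (f has_derivative frechet_derivative f (at x)) (at x)"
  unfolding smooth_on_def using Ck_on_has_derivative by blast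

lemma smooth_on_continuous: "smooth_on f S \<Longrightarrow> continuous_on S f"
  unfolding smooth_on_def by (metis Ck_on.simps(1))

lemma smooth_on_derivative_continuous:
  "smooth_on f S \<Longrightarrow> continuous_on S (\<lambda>x. frechet_derivative f (at x) v)"
  unfolding smooth_on_def by (metis Ck_on.simps)

section \<open>Smooth cut-off functions\<close>

lemma poly_times_exp_tendsto_0:
  fixes P :: "real poly"
  shows "((\<lambda>y. poly P y * exp (- y)) \<longlongrightarrow> 0) at_top"
proof -
  have "((\<lambda>y. \<Sum>i\<le>degree P. coeff P i * (y ^ i / exp y)) \<longlongrightarrow> (\<Sum>i\<le>degree P. coeff P i * 0)) at_top"
    by (intro tendsto_sum tendsto_mult tendsto_const tendsto_power_div_exp_0)
  moreover have "(\<Sum>i\<le>degree P. coeff P i * (y ^ i / exp y)) = poly P y * exp (- y)" for y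
    unfolding poly_altdef sum_distrib_right by (rule sum.cong) (auto simp: exp_minus field_simps)
  ultimately show ?thesis by simp
qed

text \<open>The derivatives of \<open>exp (- 1 / x)\<close> on the positive half line are polynomials in \<open>1 / x\<close>
  times the function itself; the recursion for these polynomials is the product rule.\<close>

primrec flat_poly :: "nat \<Rightarrow> real poly" where
  "flat_poly 0 = 1"
| "flat_poly (Suc j) = monom 1 2 * (flat_poly j - pderiv (flat_poly j))"

definition flat_exp :: "nat \<Rightarrow> real \<Rightarrow> real" where
  "flat_exp j x = (if x > 0 then poly (flat_poly j) (1 / x) * exp (- (1 / x)) else 0)"

lemma flat_exp_has_derivative:
  "(flat_exp j has_field_derivative flat_exp (Suc j) x) (at x)"
proof -
  consider "x > 0" | "x < 0" | "x = 0" by linarith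
  then show ?thesis
  proof cases
    case 1
    have "((\<lambda>x. poly (flat_poly j) (1 / x) * exp (- (1 / x))) has_field_derivative
        flat_exp (Suc j) x) (at x)"
    proof -
      have "((\<lambda>x. poly (flat_poly j) (1 / x)) has_field_derivative
          poly (pderiv (flat_poly j)) (1 / x) * (- (1 / x\<^sup>2))) (at x)"
        using 1 by (intro DERIV_chain2[OF poly_DERIV])
          (auto intro!: derivative_eq_intros simp: power2_eq_square)
      moreover have "((\<lambda>x. exp (- (1 / x))) has_field_derivative exp (- (1 / x)) * (1 / x\<^sup>2)) (at x)"
        using 1 by (auto intro!: derivative_eq_intros simp: power2_eq_square)
      ultimately have "((\<lambda>x. poly (flat_poly j) (1 / x) * exp (- (1 / x))) has_field_derivative
          poly (pderiv (flat_poly j)) (1 / x) * (- (1 / x\<^sup>2)) * exp (- (1 / x)) +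
          exp (- (1 / x)) * (1 / x\<^sup>2) * poly (flat_poly j) (1 / x)) (at x)"
        by (rule DERIV_mult)
      moreover have "poly (pderiv (flat_poly j)) (1 / x) * (- (1 / x\<^sup>2)) * exp (- (1 / x)) +
          exp (- (1 / x)) * (1 / x\<^sup>2) * poly (flat_poly j) (1 / x) = flat_exp (Suc j) x"
        using 1 by (simp add: flat_exp_def poly_monom power_one_over algebra_simps)
      ultimately show ?thesis by simp
    qed
    then show ?thesis
      by (rule has_field_derivative_transform_within[where d = x and S = UNIV]) (use 1 in \<open>auto simp: flat_exp_def dist_real_def\<close>)
  next
    case 2
    have "((\<lambda>x. 0) has_field_derivative flat_exp (Suc j) x) (at x)"
      using 2 by (simp add: flat_exp_def)
    then show ?thesis
      by (rule has_field_derivative_transform_within[where d = "- x" and S = UNIV]) (use 2 in \<open>auto simp: flat_exp_def dist_real_def\<close>)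
  next
    case 3
    have "((\<lambda>y. poly (pCons 0 (flat_poly j)) y * exp (- y)) \<longlongrightarrow> 0) at_top"
      by (rule poly_times_exp_tendsto_0)
    then have "((\<lambda>h. poly (pCons 0 (flat_poly j)) (inverse h) * exp (- inverse h)) \<longlongrightarrow> 0) (at_right 0)"
      by (rule filterlim_compose[OF _ filterlim_inverse_at_top_right])
    moreover have "\<forall>\<^sub>F h in at_right 0. poly (pCons 0 (flat_poly j)) (inverse h) * exp (- inverse h)
        = flat_exp j h / h"
      by (rule eventually_at_right_less[of 0, THEN eventually_mono])
        (auto simp: flat_exp_def inverse_eq_divide)
    ultimately have R: "((\<lambda>h. flat_exp j h / h) \<longlongrightarrow> 0) (at_right 0)"
      by (rule Lim_transform_eventually)
    have "\<forall>\<^sub>F h in at_left 0. 0 = flat_exp j h / h"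
      by (auto simp: flat_exp_def eventually_at_filter)
    then have L: "((\<lambda>h. flat_exp j h / h) \<longlongrightarrow> 0) (at_left 0)"
      by (rule Lim_transform_eventually[OF tendsto_const])
    show ?thesis
      using filterlim_split_at_real[OF L R] 3 by (simp add: DERIV_def flat_exp_def)
  qed
qed

text \<open>The transition zone \<open>1/3 \<le> \<mu>\<^sup>2 \<parallel>z\<parallel>\<^sup>2 \<le> 1\<close> is contained in the half-open shell
  \<open>1/2 < \<mu> \<parallel>z\<parallel> \<le> 1\<close>, so that the zones for \<open>\<mu> = 2 ^ j\<close> lie in pairwise disjoint shells.\<close>

definition radial_cutoff :: "real \<Rightarrow> complex ^ 'n::finite \<Rightarrow> real" where
  "radial_cutoff \<mu> z = (let t = \<mu>\<^sup>2 * (z \<bullet> z)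
     in flat_exp 0 (1 - t) * inverse (flat_exp 0 (1 - t) + flat_exp 0 (t - 1/3)))"

lemma flat_exp_0: "flat_exp 0 x = (if x > 0 then exp (- (1 / x)) else 0)"
  by (simp add: flat_exp_def)

lemma flat_exp_0_sum_pos: "flat_exp 0 (1 - t) + flat_exp 0 (t - 1/3) > 0"
proof -
  have "exp x + exp y > 0" for x y :: real by (meson add_pos_pos exp_gt_zero)
  then show ?thesis by (auto simp: flat_exp_0)
qed

lemma smooth_radial_cutoff: "smooth_on (radial_cutoff \<mu>) S"
proof -
  have z: "smooth_on (\<lambda>z :: complex ^ 'n. \<mu>\<^sup>2 * (z \<bullet> z)) UNIV"
    by (intro smooth_on_mult smooth_on_const smooth_on_bilinear[OF _ bounded_bilinear_inner]
        smooth_on_linear bounded_linear_ident) auto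
  have f: "smooth_on (\<lambda>z. flat_exp 0 (u z)) UNIV" if "smooth_on u UNIV" for u :: "complex ^ 'n \<Rightarrow> real"
    by (rule smooth_on_compose[where T = UNIV]) (use that flat_exp_has_derivative in auto)
  have "smooth_on (radial_cutoff \<mu> :: complex ^ 'n \<Rightarrow> real) UNIV"
    unfolding radial_cutoff_def Let_def using flat_exp_0_sum_pos
    by (intro smooth_on_mult smooth_on_inverse smooth_on_add f smooth_on_diff smooth_on_const z)
      (auto simp: less_imp_neq[THEN not_sym])
  then show ?thesis using smooth_on_subset by blast
qed

lemma radial_cutoff_bounds: "0 \<le> radial_cutoff \<mu> z" "radial_cutoff \<mu> z \<le> 1"
proof -
  have "flat_exp 0 x \<ge> 0" for x by (simp add: flat_exp_0)
  then show "0 \<le> radial_cutoff \<mu> z" "radial_cutoff \<mu> z \<le> 1"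
    using flat_exp_0_sum_pos[of "\<mu>\<^sup>2 * (z \<bullet> z)"]
    by (auto simp: radial_cutoff_def Let_def field_simps)
qed

lemma radial_cutoff_eq_1: "\<mu>\<^sup>2 * (z \<bullet> z) \<le> 1/3 \<Longrightarrow> radial_cutoff \<mu> z = 1"
  by (auto simp: radial_cutoff_def Let_def flat_exp_0)

lemma radial_cutoff_eq_0: "1 \<le> \<mu>\<^sup>2 * (z \<bullet> z) \<Longrightarrow> radial_cutoff \<mu> z = 0"
  by (auto simp: radial_cutoff_def Let_def flat_exp_0)

lemma radial_cutoff_near: "\<mu> > 0 \<Longrightarrow> norm z \<le> 1 / (2 * \<mu>) \<Longrightarrow> radial_cutoff \<mu> z = 1"
proof (rule radial_cutoff_eq_1)
  assume a: "\<mu> > 0" "norm z \<le> 1 / (2 * \<mu>)"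
  then have "\<mu> * norm z \<le> 1/2" by (simp add: field_simps)
  then have "(\<mu> * norm z)\<^sup>2 \<le> (1/2)\<^sup>2" using a by (intro power_mono) auto
  moreover have "(\<mu> * norm z)\<^sup>2 = \<mu>\<^sup>2 * (z \<bullet> z)"
    by (simp add: power_mult_distrib power2_norm_eq_inner)
  ultimately show "\<mu>\<^sup>2 * (z \<bullet> z) \<le> 1/3"
    by (simp add: power_one_over)
qed

lemma radial_cutoff_far: "\<mu> > 0 \<Longrightarrow> 1 / \<mu> \<le> norm z \<Longrightarrow> radial_cutoff \<mu> z = 0"
proof (rule radial_cutoff_eq_0)
  assume a: "\<mu> > 0" "1 / \<mu> \<le> norm z"
  then have "1 \<le> \<mu> * norm z" by (simp add: field_simps)
  then have "1\<^sup>2 \<le> (\<mu> * norm z)\<^sup>2" by (intro power_mono) auto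
  then show "1 \<le> \<mu>\<^sup>2 * (z \<bullet> z)"
    by (simp add: power2_norm_eq_inner[symmetric] power_mult_distrib)
qed

lemma radial_cutoff_scale: "radial_cutoff \<mu> z = radial_cutoff 1 (\<mu> *\<^sub>R z)"
  by (simp add: radial_cutoff_def power2_eq_square mult.assoc)

section \<open>The Wirtinger derivative\<close>

lemma dbar_dir_eq:
  assumes "(g has_derivative g') (at z)"
  shows "dbar_dir g z v = (g' v + \<i> * g' (\<i> *s v)) / 2"
  using frechet_derivative_at[OF assms] by (simp add: dbar_dir_def)

lemma dbar_dir_mult:
  assumes "f differentiable (at z)" "g differentiable (at z)"
  shows "dbar_dir (\<lambda>x. f x * g x) z v = f z * dbar_dir g z v + dbar_dir f z v * g z"
proof -
  note d = assms[unfolded frechet_derivative_works]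
  show ?thesis
    unfolding dbar_dir_eq[OF has_derivative_mult[OF d]]
    by (simp add: dbar_dir_def field_simps)
qed

lemma dbar_dir_add:
  assumes "f differentiable (at z)" "g differentiable (at z)"
  shows "dbar_dir (\<lambda>x. f x + g x) z v = dbar_dir f z v + dbar_dir g z v"
proof -
  note d = assms[unfolded frechet_derivative_works]
  show ?thesis
    unfolding dbar_dir_eq[OF has_derivative_add[OF d]]
    by (simp add: dbar_dir_def field_simps)
qed

lemma dbar_dir_diff:
  assumes "f differentiable (at z)" "g differentiable (at z)"
  shows "dbar_dir (\<lambda>x. f x - g x) z v = dbar_dir f z v - dbar_dir g z v"
proof -
  note d = assms[unfolded frechet_derivative_works]
  show ?thesis
    unfolding dbar_dir_eq[OF has_derivative_diff[OF d]]
    by (simp add: dbar_dir_def field_simps)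
qed

lemma dbar_dir_cmult:
  assumes "f differentiable (at z)"
  shows "dbar_dir (\<lambda>x. c * f x) z v = c * dbar_dir f z v"
proof -
  have "dbar_dir (\<lambda>x. c) z v = 0"
    using dbar_dir_eq[OF has_derivative_const, of c z v] by simp
  then show ?thesis
    using dbar_dir_mult[OF differentiable_const assms, of c v] by simp
qed

lemma dbar_dir_antilinear:
  fixes f :: "complex ^ 'n::finite \<Rightarrow> complex"
  assumes "f differentiable (at z)"
  shows "dbar_dir f z (c *s u + v) = cnj c * dbar_dir f z u + dbar_dir f z v"
proof -
  define L where "L = frechet_derivative f (at z)"
  interpret L: linear L
    using assms linear_frechet_derivative unfolding L_def by blast
  have c: "c *s u = Re c *\<^sub>R u + Im c *\<^sub>R (\<i> *s u)"
    by (simp add: vec_eq_iff complex_eq_iff)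
  have ic: "\<i> *s (c *s u + v) = Re c *\<^sub>R (\<i> *s u) - Im c *\<^sub>R u + \<i> *s v"
    by (simp add: vec_eq_iff complex_eq_iff)
  have cc: "cnj c = complex_of_real (Re c) - \<i> * complex_of_real (Im c)"
    by (simp add: complex_eq_iff)
  show ?thesis
    unfolding dbar_dir_def L_def[symmetric] ic unfolding c cc
    by (simp only: L.add L.scale L.diff)
      (simp add: scaleR_conv_of_real field_simps)
qed

section \<open>Wedge products of low degree\<close>

lemma alternating_sum_2:
  fixes F :: "'a list \<Rightarrow> complex"
  shows "(\<Sum>\<sigma> | \<sigma> permutes {..<2::nat}. of_int (sign \<sigma>) * F (permute_list \<sigma> [a, b])) =
    F [a, b] - F [b, a]"
proof -
  have f: "finite {1::nat}" "0 \<notin> {1::nat}" and s: "{..<2::nat} = {0, 1}"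
    by auto
  show ?thesis
    unfolding s sum_over_permutations_insert[OF f] permutes_sing
    by (simp add: sign_swap_id permutation_swap_id sign_compose sign_id transpose_def
        permute_list_def upt_rec)
qed

lemma alternating_sum_3:
  fixes F :: "'a list \<Rightarrow> complex"
  shows "(\<Sum>\<sigma> | \<sigma> permutes {..<3::nat}. of_int (sign \<sigma>) * F (permute_list \<sigma> [a, b, c])) =
    F [a, b, c] - F [a, c, b] - F [b, a, c] + F [b, c, a] + F [c, a, b] - F [c, b, a]"
proof -
  have f: "finite {2::nat}" "1 \<notin> {2::nat}" "finite {1::nat, 2}" "0 \<notin> {1::nat, 2}"
    and s: "{..<3::nat} = {0, 1, 2}"
    by auto
  show ?thesis
    unfolding s sum_over_permutations_insert[OF f(3,4)] sum_over_permutations_insert[OF f(1,2)]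
      permutes_sing
    by (simp add: sign_swap_id permutation_swap_id sign_compose sign_id transpose_def
        permute_list_def upt_rec permutation_compose numeral_2_eq_2)
qed

lemma alternating_sum_4:
  fixes F :: "'a list \<Rightarrow> complex"
  shows "(\<Sum>\<sigma> | \<sigma> permutes {..<4::nat}. of_int (sign \<sigma>) * F (permute_list \<sigma> [a, b, c, d])) =
    F [a, b, c, d] - F [a, b, d, c] - F [a, c, b, d] + F [a, c, d, b] + F [a, d, b, c]
     - F [a, d, c, b] - F [b, a, c, d] + F [b, a, d, c] + F [b, c, a, d] - F [b, c, d, a]
     - F [b, d, a, c] + F [b, d, c, a] + F [c, a, b, d] - F [c, a, d, b] - F [c, b, a, d]
     + F [c, b, d, a] + F [c, d, a, b] - F [c, d, b, a] - F [d, a, b, c] + F [d, a, c, b]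
     + F [d, b, a, c] - F [d, b, c, a] - F [d, c, a, b] + F [d, c, b, a]"
proof -
  have f: "finite {3::nat}" "2 \<notin> {3::nat}" "finite {2::nat, 3}" "1 \<notin> {2::nat, 3}"
    "finite {1::nat, 2, 3}" "0 \<notin> {1::nat, 2, 3}" and s: "{..<4::nat} = {0, 1, 2, 3}"
    by auto
  show ?thesis
    unfolding s sum_over_permutations_insert[OF f(5,6)] sum_over_permutations_insert[OF f(3,4)]
      sum_over_permutations_insert[OF f(1,2)] permutes_sing
    by (simp add: sign_swap_id permutation_swap_id sign_compose sign_id transpose_def
        permute_list_def upt_rec permutation_compose numeral_2_eq_2 numeral_3_eq_3)
qed

lemma wedge_0_1: "wedge 0 \<phi> \<alpha> z [v] = \<phi> z [] * \<alpha> z [v]"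
proof -
  have "{..<Suc 0} = {0}" by auto
  then show ?thesis by (simp add: wedge_def sign_id permute_list_def)
qed

lemma wedge_1_1: "wedge 1 \<alpha> \<beta> z [u, v] = \<alpha> z [u] * \<beta> z [v] - \<alpha> z [v] * \<beta> z [u]"
  using alternating_sum_2[of "\<lambda>vs. \<alpha> z (take 1 vs) * \<beta> z (drop 1 vs)" u v]
  by (simp add: wedge_def mult.assoc numeral_2_eq_2)

text \<open>In each of the following products the terms of the sum over all permutations agree up to the sign in
  groups whose size is the normalising factor of \<open>wedge\<close>, and one term of each group remains.\<close>

lemma wedge_1_2:
  assumes "\<beta> z [v, u] = - \<beta> z [u, v]" "\<beta> z [w, u] = - \<beta> z [u, w]" "\<beta> z [w, v] = - \<beta> z [v, w]"
  shows "wedge 1 \<alpha> \<beta> z [u, v, w] =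
    \<alpha> z [u] * \<beta> z [v, w] - \<alpha> z [v] * \<beta> z [u, w] + \<alpha> z [w] * \<beta> z [u, v]"
  using alternating_sum_3[of "\<lambda>vs. \<alpha> z (take 1 vs) * \<beta> z (drop 1 vs)" u v w] assms
  by (simp add: wedge_def mult.assoc numeral_3_eq_3 field_simps)

lemma wedge_2_2:
  assumes "\<And>x y. x \<in> {a, b, c, d} \<Longrightarrow> y \<in> {a, b, c, d} \<Longrightarrow> \<alpha> z [y, x] = - \<alpha> z [x, y]"
    and "\<And>x y. x \<in> {a, b, c, d} \<Longrightarrow> y \<in> {a, b, c, d} \<Longrightarrow> \<beta> z [y, x] = - \<beta> z [x, y]"
  shows "wedge 2 \<alpha> \<beta> z [a, b, c, d] =
    \<alpha> z [a, b] * \<beta> z [c, d] - \<alpha> z [a, c] * \<beta> z [b, d] + \<alpha> z [a, d] * \<beta> z [b, c]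
    + \<alpha> z [b, c] * \<beta> z [a, d] - \<alpha> z [b, d] * \<beta> z [a, c] + \<alpha> z [c, d] * \<beta> z [a, b]"
proof -
  have s: "\<alpha> z [b, a] = - \<alpha> z [a, b]" "\<alpha> z [c, a] = - \<alpha> z [a, c]" "\<alpha> z [d, a] = - \<alpha> z [a, d]"
     "\<alpha> z [c, b] = - \<alpha> z [b, c]" "\<alpha> z [d, b] = - \<alpha> z [b, d]" "\<alpha> z [d, c] = - \<alpha> z [c, d]"
     "\<beta> z [b, a] = - \<beta> z [a, b]" "\<beta> z [c, a] = - \<beta> z [a, c]" "\<beta> z [d, a] = - \<beta> z [a, d]"
     "\<beta> z [c, b] = - \<beta> z [b, c]" "\<beta> z [d, b] = - \<beta> z [b, d]" "\<beta> z [d, c] = - \<beta> z [c, d]"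
    by (rule assms; simp)+
  have l: "length [a, b, c, d] = 4" by simp
  have "wedge 2 \<alpha> \<beta> z [a, b, c, d] =
    (\<Sum>\<sigma> | \<sigma> permutes {..<4::nat}. of_int (sign \<sigma>) *
       (\<lambda>vs. \<alpha> z (take 2 vs) * \<beta> z (drop 2 vs)) (permute_list \<sigma> [a, b, c, d])) / 4"
    unfolding wedge_def l by (simp add: mult.assoc)
  then have "4 * wedge 2 \<alpha> \<beta> z [a, b, c, d] = 4 * (\<alpha> z [a, b] * \<beta> z [c, d] - \<alpha> z [a, c] * \<beta> z [b, d]
    + \<alpha> z [a, d] * \<beta> z [b, c] + \<alpha> z [b, c] * \<beta> z [a, d] - \<alpha> z [b, d] * \<beta> z [a, c]
    + \<alpha> z [c, d] * \<beta> z [a, b])"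
    unfolding alternating_sum_4[of "\<lambda>vs. \<alpha> z (take 2 vs) * \<beta> z (drop 2 vs)"]
    by (simp add: s algebra_simps)
  then show ?thesis by (simp only: mult_cancel_left) simp
qed

lemma wedge_1_3:
  assumes "\<And>x y w. {x, y, w} \<subseteq> {a, b, c, d} \<Longrightarrow> \<beta> z [y, x, w] = - \<beta> z [x, y, w]"
    and "\<And>x y w. {x, y, w} \<subseteq> {a, b, c, d} \<Longrightarrow> \<beta> z [x, w, y] = - \<beta> z [x, y, w]"
  shows "wedge 1 \<alpha> \<beta> z [a, b, c, d] =
    \<alpha> z [a] * \<beta> z [b, c, d] - \<alpha> z [b] * \<beta> z [a, c, d]
    + \<alpha> z [c] * \<beta> z [a, b, d] - \<alpha> z [d] * \<beta> z [a, b, c]"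
proof -
  have s: "\<beta> z [x, w, y] = - \<beta> z [x, y, w]" "\<beta> z [y, x, w] = - \<beta> z [x, y, w]"
     "\<beta> z [y, w, x] = \<beta> z [x, y, w]" "\<beta> z [w, x, y] = \<beta> z [x, y, w]"
     "\<beta> z [w, y, x] = - \<beta> z [x, y, w]"
    if "{x, y, w} \<subseteq> {a, b, c, d}" for x y w
  proof -
    show "\<beta> z [x, w, y] = - \<beta> z [x, y, w]" by (rule assms(2)[OF that])
    show "\<beta> z [y, x, w] = - \<beta> z [x, y, w]" by (rule assms(1)[OF that])
    show 1: "\<beta> z [y, w, x] = \<beta> z [x, y, w]"
      using assms(1)[of x y w] assms(2)[of y x w] that by auto
    show "\<beta> z [w, x, y] = \<beta> z [x, y, w]"
      using assms(1)[of x w y] assms(2)[of x y w] that by auto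
    show "\<beta> z [w, y, x] = - \<beta> z [x, y, w]"
      using assms(1)[of y w x] 1 that by auto
  qed
  have l: "length [a, b, c, d] = 4" by simp
  have "wedge 1 \<alpha> \<beta> z [a, b, c, d] =
    (\<Sum>\<sigma> | \<sigma> permutes {..<4::nat}. of_int (sign \<sigma>) *
       (\<lambda>vs. \<alpha> z (take 1 vs) * \<beta> z (drop 1 vs)) (permute_list \<sigma> [a, b, c, d])) / 6"
    unfolding wedge_def l by (simp add: mult.assoc numeral_3_eq_3)
  then have "6 * wedge 1 \<alpha> \<beta> z [a, b, c, d] = 6 * (\<alpha> z [a] * \<beta> z [b, c, d] - \<alpha> z [b] * \<beta> z [a, c, d]
    + \<alpha> z [c] * \<beta> z [a, b, d] - \<alpha> z [d] * \<beta> z [a, b, c])"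
    unfolding alternating_sum_4[of "\<lambda>vs. \<alpha> z (take 1 vs) * \<beta> z (drop 1 vs)"] using s[of b c d] s[of a c d] s[of a b d] s[of a b c]
    by (simp add: algebra_simps)
  then show ?thesis by (simp only: mult_cancel_left) simp
qed

lemma wedge_0_4:
  assumes "\<And>w x y v. {w, x, y, v} \<subseteq> {a, b, c, d} \<Longrightarrow> \<eta> z [x, w, y, v] = - \<eta> z [w, x, y, v]"
    and "\<And>w x y v. {w, x, y, v} \<subseteq> {a, b, c, d} \<Longrightarrow> \<eta> z [w, y, x, v] = - \<eta> z [w, x, y, v]"
    and "\<And>w x y v. {w, x, y, v} \<subseteq> {a, b, c, d} \<Longrightarrow> \<eta> z [w, x, v, y] = - \<eta> z [w, x, y, v]"
  shows "wedge 0 \<phi> \<eta> z [a, b, c, d] = \<phi> z [] * \<eta> z [a, b, c, d]"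
proof -
  note s1 = assms(1) and s2 = assms(2) and s3 = assms(3)
  let ?f = "\<lambda>w x y v. \<eta> z [w, x, y, v]" and ?E = "\<eta> z [a, b, c, d]"
  \<comment> \<open>every arrangement is reached from \<open>[a, b, c, d]\<close> by adjacent transpositions\<close>
  have p:
    "?f b a c d = - ?E" "?f a c b d = - ?E" "?f a b d c = - ?E" "?f b c a d = ?E"
    "?f b a d c = ?E" "?f c a b d = ?E" "?f a c d b = ?E" "?f a d b c = ?E"
    "?f c b a d = - ?E" "?f b c d a = - ?E" "?f b d a c = - ?E" "?f c a d b = - ?E"
    "?f a d c b = - ?E" "?f d a b c = - ?E" "?f c b d a = ?E" "?f b d c a = ?E"
    "?f d b a c = ?E" "?f c d a b = ?E" "?f d a c b = ?E" "?f c d b a = - ?E"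
    "?f d b c a = - ?E" "?f d c a b = - ?E" "?f d c b a = ?E"
    using
      s1[of a b c d] s2[of a b c d] s3[of a b c d] s2[of b a c d]
      s3[of b a c d] s1[of a c b d] s3[of a c b d] s2[of a b d c]
      s1[of b c a d] s3[of b c a d] s2[of b a d c] s3[of c a b d]
      s2[of a c d b] s1[of a d b c] s3[of c b a d] s2[of b c d a]
      s1[of b d a c] s2[of c a d b] s1[of a d c b] s2[of c b d a]
      s1[of b d c a] s1[of c d a b] s1[of c d b a]
    by simp_all
  have l: "length [a, b, c, d] = 4" by simp
  have "wedge 0 \<phi> \<eta> z [a, b, c, d] =
    (\<Sum>\<sigma> | \<sigma> permutes {..<4::nat}. of_int (sign \<sigma>) *
       (\<lambda>vs. \<phi> z [] * \<eta> z vs) (permute_list \<sigma> [a, b, c, d])) / 24"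
    unfolding wedge_def l by (simp add: mult.assoc fact_numeral)
  then show ?thesis
    unfolding alternating_sum_4[of "\<lambda>vs. \<phi> z [] * \<eta> z vs"] p by simp
qed

section \<open>Linear algebra on the tangent planes\<close>

definition An_grad :: "nat \<Rightarrow> complex ^ 3 \<Rightarrow> complex ^ 3" where
  "An_grad n z = vector [z $ 2, z $ 1, - (of_nat (Suc n) * z $ 3 ^ n)]"

definition bilinear_dot :: "complex ^ 3 \<Rightarrow> complex ^ 3 \<Rightarrow> complex" where
  "bilinear_dot u v = u $ 1 * v $ 1 + u $ 2 * v $ 2 + u $ 3 * v $ 3"

definition cnj_vec :: "complex ^ 3 \<Rightarrow> complex ^ 3" where
  "cnj_vec v = vector [cnj (v $ 1), cnj (v $ 2), cnj (v $ 3)]"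

definition triple_product :: "complex ^ 3 \<Rightarrow> complex ^ 3 \<Rightarrow> complex ^ 3 \<Rightarrow> complex" where
  "triple_product t u v =
     t $ 1 * (u $ 2 * v $ 3 - u $ 3 * v $ 2) - t $ 2 * (u $ 1 * v $ 3 - u $ 3 * v $ 1)
     + t $ 3 * (u $ 1 * v $ 2 - u $ 2 * v $ 1)"

text \<open>The contraction of \<open>2 \<pi> \<i> d\<zeta>\<^sub>1 \<and> d\<zeta>\<^sub>2 \<and> d\<zeta>\<^sub>3\<close> with the vector field \<open>cnj (grad f) / \<parallel>grad f\<parallel>\<^sup>2\<close>, on which
  \<open>df\<close> takes the value one: an ambient form that is smooth away from the origin and restricts to the structure form
  on the surface.\<close>

definition residue_form :: "nat \<Rightarrow> complex ^ 3 \<Rightarrow> complex ^ 3 \<Rightarrow> complex ^ 3 \<Rightarrow> complex" where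
  "residue_form n z u v = 2 * of_real pi * \<i> * triple_product (cnj_vec (An_grad n z)) u v
     * inverse (bilinear_dot (An_grad n z) (cnj_vec (An_grad n z)))"

lemma has_derivative_component: "((\<lambda>z. z $ i) has_derivative (\<lambda>v. v $ i)) (at (z :: 'a::real_normed_vector ^ 'n))"
  by (rule bounded_linear_imp_has_derivative[OF bounded_linear_vec_nth])

lemma An_poly_has_derivative:
  "(An_poly n has_derivative bilinear_dot (An_grad n z)) (at z)"
  unfolding An_poly_def
  by (rule derivative_eq_intros has_derivative_component refl)+
    (auto simp: fun_eq_iff bilinear_dot_def An_grad_def algebra_simps)

lemma An_tangent_iff: "v \<in> An_tangent n z \<longleftrightarrow> bilinear_dot (An_grad n z) v = 0"
  using frechet_derivative_at[OF An_poly_has_derivative, of n z] by (simp add: An_tangent_def)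

lemma An_tangent_scale: "v \<in> An_tangent n z \<Longrightarrow> c *s v \<in> An_tangent n z"
proof -
  have "bilinear_dot (An_grad n z) (c *s v) = c * bilinear_dot (An_grad n z) v"
    by (simp add: bilinear_dot_def algebra_simps)
  then show "v \<in> An_tangent n z \<Longrightarrow> c *s v \<in> An_tangent n z"
    by (simp add: An_tangent_iff)
qed

lemma An_tangent_add: "u \<in> An_tangent n z \<Longrightarrow> v \<in> An_tangent n z \<Longrightarrow> u + v \<in> An_tangent n z"
proof -
  have "bilinear_dot (An_grad n z) (u + v) = bilinear_dot (An_grad n z) u + bilinear_dot (An_grad n z) v"
    by (simp add: bilinear_dot_def algebra_simps)
  then show "u \<in> An_tangent n z \<Longrightarrow> v \<in> An_tangent n z \<Longrightarrow> u + v \<in> An_tangent n z"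
    by (simp add: An_tangent_iff)
qed

lemma bilinear_dot_cnj: "bilinear_dot v (cnj_vec v) =
    of_real ((cmod (v $ 1))\<^sup>2 + (cmod (v $ 2))\<^sup>2 + (cmod (v $ 3))\<^sup>2)"
  by (simp add: bilinear_dot_def cnj_vec_def complex_norm_square[symmetric])

text \<open>For \<open>n \<ge> 1\<close> the origin is the only critical point of \<open>f\<close>, on or off the surface.\<close>

lemma An_grad_nonzero:
  assumes "n \<ge> 1" "z \<noteq> 0"
  shows "bilinear_dot (An_grad n z) (cnj_vec (An_grad n z)) \<noteq> 0"
proof
  assume "bilinear_dot (An_grad n z) (cnj_vec (An_grad n z)) = 0"
  then have "(cmod (An_grad n z $ 1))\<^sup>2 + (cmod (An_grad n z $ 2))\<^sup>2 + (cmod (An_grad n z $ 3))\<^sup>2 = 0"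
    unfolding bilinear_dot_cnj of_real_eq_0_iff .
  then have "cmod (An_grad n z $ i) = 0" if "i \<in> {1,2,3}" for i
    using that zero_le_power2[of "cmod (An_grad n z $ 1)"] zero_le_power2[of "cmod (An_grad n z $ 2)"]
      zero_le_power2[of "cmod (An_grad n z $ 3)"]
    by (smt (verit) insertE singletonD power2_eq_square mult_eq_0_iff)
  from this[of 1] this[of 2] this[of 3] have "z $ 1 = 0" "z $ 2 = 0" "z $ 3 = 0"
    using assms(1) by (auto simp: An_grad_def simp del: of_nat_Suc)
  with assms(2) show False by (simp add: vec_eq_iff forall_3)
qed

lemma residue_form_antisym: "residue_form n z v u = - residue_form n z u v"
  by (simp add: residue_form_def triple_product_def algebra_simps)

lemma residue_form_self [simp]: "residue_form n z u u = 0"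
  by (simp add: residue_form_def triple_product_def)

lemma residue_form_scale [simp]:
  "residue_form n z (c *s u) v = c * residue_form n z u v"
  "residue_form n z u (c *s v) = c * residue_form n z u v"
  by (simp_all add: residue_form_def triple_product_def algebra_simps)

text \<open>Two tangent vectors have a cross product that is normal to the surface, hence a multiple of
  the gradient.\<close>

lemma triple_product_tangent:
  assumes "n \<ge> 1" "z \<noteq> 0" "u \<in> An_tangent n z" "v \<in> An_tangent n z"
  obtains l where "\<And>t. triple_product t u v = l * bilinear_dot (An_grad n z) t"
proof -
  define g where "g = An_grad n z"
  define c1 c2 c3 where "c1 = u $ 2 * v $ 3 - u $ 3 * v $ 2"
    and "c2 = u $ 3 * v $ 1 - u $ 1 * v $ 3" and "c3 = u $ 1 * v $ 2 - u $ 2 * v $ 1"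
  have gu: "g $ 1 * u $ 1 + g $ 2 * u $ 2 + g $ 3 * u $ 3 = 0"
    and gv: "g $ 1 * v $ 1 + g $ 2 * v $ 2 + g $ 3 * v $ 3 = 0"
    using assms(3,4) by (simp_all add: An_tangent_iff bilinear_dot_def g_def)
  have p: "c1 * g $ 2 = c2 * g $ 1" "c1 * g $ 3 = c3 * g $ 1" "c2 * g $ 3 = c3 * g $ 2"
    unfolding c1_def c2_def c3_def using gu gv by algebra+
  define M where "M = bilinear_dot g (cnj_vec g)"
  have M: "M \<noteq> 0" using An_grad_nonzero[OF assms(1,2)] by (simp add: M_def g_def)
  define l where "l = (c1 * cnj (g $ 1) + c2 * cnj (g $ 2) + c3 * cnj (g $ 3)) / M"
  have M': "M = g $ 1 * cnj (g $ 1) + g $ 2 * cnj (g $ 2) + g $ 3 * cnj (g $ 3)"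
    by (simp add: M_def bilinear_dot_def cnj_vec_def)
  have "(c1 * cnj (g $ 1) + c2 * cnj (g $ 2) + c3 * cnj (g $ 3)) * g $ 1 = c1 * M"
    "(c1 * cnj (g $ 1) + c2 * cnj (g $ 2) + c3 * cnj (g $ 3)) * g $ 2 = c2 * M"
    "(c1 * cnj (g $ 1) + c2 * cnj (g $ 2) + c3 * cnj (g $ 3)) * g $ 3 = c3 * M"
    unfolding M' using p by algebra+
  then have "l * g $ 1 = c1" "l * g $ 2 = c2" "l * g $ 3 = c3"
    using M by (simp_all add: l_def)
  then have "triple_product t u v = l * bilinear_dot g t" for t
    unfolding triple_product_def bilinear_dot_def c1_def c2_def c3_def by algebra
  then show ?thesis using that g_def by blast
qed

lemma covector_2_antisym:
  assumes "is_covector V 2 0 \<eta>" "u \<in> V" "v \<in> V" "u + v \<in> V"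
  shows "\<eta> [v, u] = - \<eta> [u, v]"
proof -
  have add: "\<eta> (vs[i := x + y]) = \<eta> (vs[i := x]) + \<eta> (vs[i := y])"
    if "length vs = 2" "set vs \<subseteq> V" "i < 2" "x \<in> V" "y \<in> V" for vs i x y
    using assms(1) that unfolding is_covector_def
    by (metis add.right_neutral scaleR_one)
  have alt: "\<eta> [x, x] = 0" if "x \<in> V" for x
  proof -
    have "\<forall>i j. i < j \<and> j < 2 + 0 \<and> [x, x] ! i = [x, x] ! j \<longrightarrow> \<eta> [x, x] = 0"
      using assms(1) that unfolding is_covector_def by simp
    from this[rule_format, of 0 1] show ?thesis by simp
  qed
  have "0 = \<eta> [u + v, u + v]" using alt assms(4) by simp
  also have "\<dots> = \<eta> [u, u + v] + \<eta> [v, u + v]"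
    using add[of "[u, u + v]" 0 u v] assms by simp
  also have "\<dots> = \<eta> [u, v] + \<eta> [v, u]"
    using add[of "[u, u]" 1 u v] add[of "[v, u]" 1 u v] assms alt by simp
  finally show ?thesis by (simp add: add_eq_0_iff)
qed

text \<open>Evaluated on \<open>cnj (grad f)\<close> and two tangent vectors, the equation \<open>df \<and> \<omega> = 2 \<pi> \<i> d\<zeta>\<^sub>1 \<and> d\<zeta>\<^sub>2 \<and> d\<zeta>\<^sub>3\<close> has a
  single nonzero term on the left, because \<open>df\<close> kills tangent vectors.\<close>

lemma structure_form_eq_residue_form:
  assumes "n \<ge> 1" "is_structure_form n U \<omega>" "z \<in> An_reg n U"
    and u: "u \<in> An_tangent n z" and v: "v \<in> An_tangent n z"
  shows "\<omega> z [u, v] = residue_form n z u v"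
proof -
  define t where "t = cnj_vec (An_grad n z)"
  have cov: "is_covector UNIV 2 0 (\<omega> z)"
    using assms(2,3) by (auto simp: is_structure_form_def)
  have df: "differential (An_poly n) z [x] = bilinear_dot (An_grad n z) x" for x
    using frechet_derivative_at[OF An_poly_has_derivative, of n z] by (simp add: differential_def)
  have "wedge 1 (differential (An_poly n)) \<omega> z [t, u, v] = bilinear_dot (An_grad n z) t * \<omega> z [u, v]"
    by (subst wedge_1_2) (use u v in \<open>auto simp: df An_tangent_iff intro!: covector_2_antisym[OF cov]\<close>)
  moreover have "wedge 1 (dcoord 1) (wedge 1 (dcoord 2) (dcoord 3)) z [t, u, v] = triple_product t u v"
    by (subst wedge_1_2) (simp_all only: wedge_1_1, simp_all add: dcoord_def triple_product_def algebra_simps)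
  ultimately have "bilinear_dot (An_grad n z) t * \<omega> z [u, v] = 2 * of_real pi * \<i> * triple_product t u v"
    using assms(2,3) by (auto simp: is_structure_form_def)
  moreover have "bilinear_dot (An_grad n z) t \<noteq> 0"
    using An_grad_nonzero[OF assms(1)] assms(3) by (auto simp: t_def An_reg_def)
  ultimately show ?thesis
    unfolding residue_form_def t_def[symmetric] by (simp add: field_simps)
qed

lemma dbar_dir_holomorphic:
  assumes "(g has_derivative g') (at z)" "\<And>v. g' (\<i> *s v) = \<i> * g' v"
  shows "dbar_dir g z v = 0"
  unfolding dbar_dir_eq[OF assms(1)] assms(2) by (simp add: algebra_simps)

lemma dbar_dir_inverse:
  assumes "g differentiable (at z)" "g z \<noteq> 0"
  shows "dbar_dir (\<lambda>x. inverse (g x)) z v = - inverse (g z) * dbar_dir g z v * inverse (g z)"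
  unfolding dbar_dir_eq[OF Deriv.has_derivative_inverse[OF assms(2) assms(1)[unfolded frechet_derivative_works]]]
  by (simp add: dbar_dir_def add_divide_distrib diff_divide_distrib algebra_simps)

lemma An_grad_component_holomorphic:
  "(\<lambda>x. An_grad n x $ i) differentiable (at z)" "dbar_dir (\<lambda>x. An_grad n x $ i) z v = 0"
proof -
  have "\<exists>g'. ((\<lambda>x. An_grad n x $ i) has_derivative g') (at z) \<and> (\<forall>v. g' (\<i> *s v) = \<i> * g' v)"
  proof -
    consider "i = 1" | "i = 2" | "i = 3" using exhaust_3 by blast
    then show ?thesis
    proof cases
      case 3
      have "((\<lambda>x. - (of_nat (Suc n) * x $ 3 ^ n)) has_derivative
          (\<lambda>v. - (of_nat (Suc n) * (of_nat n * v $ 3 * z $ 3 ^ (n - 1))))) (at z)"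
        by (intro has_derivative_minus has_derivative_mult_right has_derivative_power
            has_derivative_component)
      with 3 show ?thesis
        by (intro exI[of _ "\<lambda>v. - (of_nat (Suc n) * (of_nat n * v $ 3 * z $ 3 ^ (n - 1)))"])
          (simp add: An_grad_def)
    qed (auto simp: An_grad_def intro!: has_derivative_component exI)
  qed
  then show "(\<lambda>x. An_grad n x $ i) differentiable (at z)" "dbar_dir (\<lambda>x. An_grad n x $ i) z v = 0"
    using dbar_dir_holomorphic differentiable_def by blast+
qed

lemma differentiable_cnj:
  "f differentiable (at z) \<Longrightarrow> (\<lambda>x. cnj (f x)) differentiable (at z)"
  using bounded_linear.has_derivative[OF bounded_linear_cnj] unfolding differentiable_def by blast

text \<open>On the surface the ambient form \<open>residue_form\<close> restricts to a holomorphic form.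
  At tangent vectors its numerator is a multiple of \<open>x \<mapsto> \<langle>grad f z, grad f x\<rangle>\<close> and its denominator is
  \<open>\<langle>grad f x, grad f x\<rangle>\<close>; both have the same value and, as the gradient is holomorphic, the same
  antiholomorphic derivative at \<open>z\<close>.\<close>

lemma residue_form_dbar_closed:
  assumes "n \<ge> 1" "z \<noteq> 0" "u \<in> An_tangent n z" "v \<in> An_tangent n z"
  shows "dbar_dir (\<lambda>x. residue_form n x u v) z y = 0"
proof -
  obtain l where l: "\<And>t. triple_product t u v = l * bilinear_dot (An_grad n z) t"
    using triple_product_tangent[OF assms] by blast
  define N where "N x = bilinear_dot (An_grad n z) (cnj_vec (An_grad n x))" for x
  define M where "M x = bilinear_dot (An_grad n x) (cnj_vec (An_grad n x))" for x
  define g where "g i x = An_grad n x $ i" for i x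
  have N: "N x = g 1 z * cnj (g 1 x) + g 2 z * cnj (g 2 x) + g 3 z * cnj (g 3 x)" for x
    by (simp add: N_def bilinear_dot_def cnj_vec_def g_def)
  have M: "M x = g 1 x * cnj (g 1 x) + g 2 x * cnj (g 2 x) + g 3 x * cnj (g 3 x)" for x
    by (simp add: M_def bilinear_dot_def cnj_vec_def g_def)
  have gd: "g i differentiable (at z)" "(\<lambda>x. cnj (g i x)) differentiable (at z)" for i
    unfolding g_def by (intro An_grad_component_holomorphic differentiable_cnj)+
  have g0: "dbar_dir (g i) z y = 0" for i
    unfolding g_def by (rule An_grad_component_holomorphic)
  note di = differentiable_add differentiable_mult differentiable_const gd
  have dN: "dbar_dir N z y = g 1 z * dbar_dir (\<lambda>x. cnj (g 1 x)) z y
      + g 2 z * dbar_dir (\<lambda>x. cnj (g 2 x)) z y + g 3 z * dbar_dir (\<lambda>x. cnj (g 3 x)) z y"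
    unfolding N[abs_def] by (simp add: dbar_dir_add dbar_dir_cmult di)
  \<comment> \<open>the derivative of the first factors of \<open>M\<close> drops out as the gradient is holomorphic\<close>
  have dM: "dbar_dir M z y = dbar_dir N z y"
    unfolding dN unfolding M[abs_def] by (simp add: dbar_dir_add dbar_dir_mult di g0)
  have Nd: "N differentiable (at z)" unfolding N[abs_def] by (intro di)
  have Md: "M differentiable (at z)" unfolding M[abs_def] by (intro di)
  have M0: "M z \<noteq> 0" using An_grad_nonzero[OF assms(1,2)] by (simp add: M_def)
  have Id: "(\<lambda>x. inverse (M x)) differentiable (at z)"
    using Deriv.has_derivative_inverse[of M z] M0 Md unfolding differentiable_def by blast
  have NM: "N z = M z" by (simp add: N M)
  have "dbar_dir (\<lambda>x. N x * inverse (M x)) z y = 0"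
    unfolding dbar_dir_mult[OF Nd Id] dbar_dir_inverse[OF Md M0] dM NM using M0 by simp
  moreover have "(\<lambda>x. residue_form n x u v) =
      (\<lambda>x. (2 * of_real pi * \<i> * l) * (N x * inverse (M x)))"
    by (simp add: residue_form_def l N_def M_def mult_ac)
  ultimately show ?thesis
    using dbar_dir_cmult[OF differentiable_mult[OF Nd Id], of "2 * of_real pi * \<i> * l" y] by simp
qed

lemma smooth_residue_form:
  assumes "n \<ge> 1" shows "smooth_on (\<lambda>z. residue_form n z u v) (- {0})"
proof -
  have o: "open (- {0 :: complex ^ 3})" by auto
  have c: "smooth_on (\<lambda>z. z $ i) (- {0 :: complex ^ 3})" for i
    by (rule smooth_on_linear[OF o bounded_linear_vec_nth])
  have "smooth_on (\<lambda>z. An_grad n z $ i) (- {0})" for i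
  proof -
    consider "i = 1" | "i = 2" | "i = 3" using exhaust_3 by blast
    then show ?thesis
      by cases (simp_all add: An_grad_def c smooth_on_uminus smooth_on_mult smooth_on_const smooth_on_power o del: of_nat_Suc)
  qed
  then have g: "smooth_on (\<lambda>z. An_grad n z $ i) (- {0})" "smooth_on (\<lambda>z. cnj (An_grad n z $ i)) (- {0})" for i
    using smooth_on_linear_compose[OF o bounded_linear_cnj] by auto
  have "smooth_on (\<lambda>z. triple_product (cnj_vec (An_grad n z)) u v) (- {0})"
    unfolding triple_product_def cnj_vec_def vector_3
    by (intro smooth_on_add smooth_on_diff smooth_on_mult smooth_on_const g o)
  moreover have "smooth_on (\<lambda>z. inverse (bilinear_dot (An_grad n z) (cnj_vec (An_grad n z)))) (- {0})"
  proof (rule smooth_on_inverse[OF o])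
    show "smooth_on (\<lambda>z. bilinear_dot (An_grad n z) (cnj_vec (An_grad n z))) (- {0})"
      unfolding bilinear_dot_def cnj_vec_def vector_3
      by (intro smooth_on_add smooth_on_mult g o)
  qed (use An_grad_nonzero[OF assms] in auto)
  ultimately show ?thesis
    unfolding residue_form_def by (intro smooth_on_mult smooth_on_const o)
qed

section \<open>The test forms built from the structure form\<close>

lemma covector_1_linear:
  assumes "is_covector V 0 1 \<eta>" "x \<in> V" "y \<in> V"
  shows "\<eta> [s *\<^sub>R x + t *\<^sub>R y] = s *\<^sub>R \<eta> [x] + t *\<^sub>R \<eta> [y]"
proof -
  have "\<forall>i < 1. \<forall>x \<in> V. \<forall>y \<in> V. \<forall>s t :: real.
           \<eta> ([x][i := s *\<^sub>R x + t *\<^sub>R y]) = s *\<^sub>R \<eta> ([x][i := x]) + t *\<^sub>R \<eta> ([x][i := y])"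
    if "x \<in> V" for x
    using assms(1) that unfolding is_covector_def by (metis add_0 empty_set empty_subsetI insert_subset
        length_Cons list.simps(15) list.size(3) One_nat_def)
  from this[of x] assms(2,3) show ?thesis by auto
qed

lemma covector_1_scale:
  assumes "is_covector V 0 1 \<eta>" "x \<in> V"
  shows "\<eta> [c *s x] = cnj c * \<eta> [x]"
proof -
  have "\<forall>c. \<eta> (map (\<lambda>v. c *s v) [x]) = c ^ 0 * cnj c ^ 1 * \<eta> [x]"
    using assms unfolding is_covector_def
    by (metis add_0 empty_set empty_subsetI insert_subset
        length_Cons list.simps(15) list.size(3) One_nat_def)
  then show ?thesis by simp
qed

lemma covector_1_antilinear:
  assumes "is_covector V 0 1 \<eta>" "x \<in> V" "c *s x \<in> V" "y \<in> V"
  shows "\<eta> [c *s x + y] = cnj c * \<eta> [x] + \<eta> [y]"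
  using covector_1_linear[OF assms(1,3,4), of 1 1] covector_1_scale[OF assms(1,2)] by simp

text \<open>The form \<open>g \<omega> \<and> \<alpha>\<close> with \<open>residue_form\<close> in the place of \<open>\<omega>\<close>, expanded into its three terms.\<close>

definition residue_wedge :: "nat \<Rightarrow> (complex ^ 3 \<Rightarrow> complex) \<Rightarrow> 3 form \<Rightarrow> 3 form" where
  "residue_wedge n g \<alpha> z vs = g z *
     (residue_form n z (vs ! 0) (vs ! 1) * \<alpha> z [vs ! 2] - residue_form n z (vs ! 0) (vs ! 2) * \<alpha> z [vs ! 1]
      + residue_form n z (vs ! 1) (vs ! 2) * \<alpha> z [vs ! 0])"

lemma residue_wedge_3 [simp]:
  "residue_wedge n g \<alpha> z [a, b, c] = g z *
     (residue_form n z a b * \<alpha> z [c] - residue_form n z a c * \<alpha> z [b] + residue_form n z b c * \<alpha> z [a])"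
  by (simp add: residue_wedge_def numeral_2_eq_2)

lemma residue_form_real_linear:
  "residue_form n z (s *\<^sub>R x + t *\<^sub>R y) v = s *\<^sub>R residue_form n z x v + t *\<^sub>R residue_form n z y v"
  "residue_form n z v (s *\<^sub>R x + t *\<^sub>R y) = s *\<^sub>R residue_form n z v x + t *\<^sub>R residue_form n z v y"
  by (simp_all only: residue_form_def triple_product_def vector_add_component vector_scaleR_component,
      simp_all add: scaleR_conv_of_real algebra_simps)

lemma is_covector_residue_wedge:
  assumes "is_covector UNIV 0 1 (\<alpha> z)"
  shows "is_covector UNIV 2 1 (residue_wedge n g \<alpha> z)"
  unfolding is_covector_def
proof (intro allI impI conjI ballI)
  note lin = covector_1_linear[OF assms UNIV_I UNIV_I] covector_1_scale[OF assms UNIV_I]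
  fix vs :: "(complex ^ 3) list"
  assume "length vs = 2 + 1 \<and> set vs \<subseteq> UNIV"
  then obtain a b c where vs: "vs = [a, b, c]"
    by (auto simp: numeral_2_eq_2 numeral_3_eq_3 length_Suc_conv)
  {
    fix i x y and s t :: real
    assume "i < (2::nat) + 1"
    then consider "i = 0" | "i = 1" | "i = 2" by linarith
    then show "residue_wedge n g \<alpha> z (vs[i := s *\<^sub>R x + t *\<^sub>R y]) =
        s *\<^sub>R residue_wedge n g \<alpha> z (vs[i := x]) + t *\<^sub>R residue_wedge n g \<alpha> z (vs[i := y])"
      by cases (simp_all add: vs lin residue_form_real_linear numeral_2_eq_2,
          simp_all add: scaleR_conv_of_real algebra_simps)
  next
    fix i j assume ij: "i < j \<and> j < (2::nat) + 1 \<and> vs ! i = vs ! j"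
    then have "i = 0 \<and> j = 1 \<or> i = 0 \<and> j = 2 \<or> i = 1 \<and> j = 2" by auto
    with ij have "a = b \<or> a = c \<or> b = c" by (auto simp: vs)
    then show "residue_wedge n g \<alpha> z vs = 0"
      using residue_form_antisym[of n z b a] residue_form_antisym[of n z b c] by (auto simp: vs)
  next
    fix k :: complex
    show "residue_wedge n g \<alpha> z (map (\<lambda>v. k *s v) vs) = k ^ 2 * cnj k ^ 1 * residue_wedge n g \<alpha> z vs"
      by (simp add: vs lin power2_eq_square algebra_simps)
  }
qed

text \<open>As \<open>g\<close> vanishes near the origin, the singularity of \<open>residue_form\<close> does no harm.\<close>

lemma test_form_residue_wedge:
  assumes "n \<ge> 1" "open U" "smooth_form U 0 1 \<alpha>" "smooth_on g U"
    and "s > 0" "\<And>z. norm z < s \<Longrightarrow> g z = 0"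
    and "compact K" "K \<subseteq> U" "\<And>z. z \<notin> K \<Longrightarrow> g z = 0"
  shows "test_form U 2 1 (residue_wedge n g \<alpha>)"
proof -
  have "smooth_on (\<lambda>z. residue_wedge n g \<alpha> z vs) U" if len: "length vs = 2 + 1" for vs
  proof -
    obtain a b c where vs: "vs = [a, b, c]"
      using len by (auto simp: numeral_2_eq_2 numeral_3_eq_3 length_Suc_conv)
    have o: "open (U - {0})" using assms(2) by auto
    have al: "smooth_on (\<lambda>z. \<alpha> z [x]) (U - {0})" for x
      using assms(3) unfolding smooth_form_def by (auto intro: smooth_on_subset[of _ U])
    have re: "smooth_on (\<lambda>z. residue_form n z x y) (U - {0})" for x y
      by (rule smooth_on_subset[OF smooth_residue_form[OF assms(1)]]) auto
    have g: "smooth_on g (U - {0})"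
      using assms(4) by (rule smooth_on_subset) auto
    have 1: "smooth_on (\<lambda>z. residue_wedge n g \<alpha> z vs) (U - {0})"
      unfolding vs residue_wedge_3 by (intro smooth_on_add smooth_on_mult smooth_on_diff al re g o)
    have 2: "smooth_on (\<lambda>z. residue_wedge n g \<alpha> z vs) (ball 0 s)"
      by (rule smooth_on_cong[OF _ _ smooth_on_const[of 0]]) (use assms(6) in \<open>auto simp: vs\<close>)
    have "U \<subseteq> (U - {0}) \<union> ball 0 s" using assms(5) by auto
    then show ?thesis
      by (rule smooth_on_subset[OF smooth_on_Un[OF o open_ball 1 2]])
  qed
  moreover have "is_covector UNIV 2 1 (residue_wedge n g \<alpha> z)" if "z \<in> U" for z
    using assms(3) that by (intro is_covector_residue_wedge) (auto simp: smooth_form_def)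
  ultimately show ?thesis
    unfolding test_form_def smooth_form_def using assms(7-9)
    by (auto intro!: exI[of _ K] simp: residue_wedge_def)
qed

text \<open>On a frame \<open>u, \<i> u, v, \<i> v\<close> the linearity of \<open>residue_form\<close> and the antilinearity of the
  (0,1)-forms reduce every term to the values on \<open>u\<close> and \<open>v\<close>; the powers of \<open>\<i>\<close> cancel the signs and
  four equal contributions remain.\<close>

lemma wedge_residue_wedge:
  assumes "\<psi> z [\<i> *s u] = - \<i> * \<psi> z [u]" "\<psi> z [\<i> *s v] = - \<i> * \<psi> z [v]"
    and "\<alpha> z [\<i> *s u] = - \<i> * \<alpha> z [u]" "\<alpha> z [\<i> *s v] = - \<i> * \<alpha> z [v]"
  shows "wedge 1 \<psi> (residue_wedge n g \<alpha>) z [u, \<i> *s u, v, \<i> *s v] =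
     4 * g z * residue_form n z u v * (\<psi> z [u] * \<alpha> z [v] - \<psi> z [v] * \<alpha> z [u])"
proof -
  have "residue_wedge n g \<alpha> z [y, x, w] = - residue_wedge n g \<alpha> z [x, y, w]"
    "residue_wedge n g \<alpha> z [x, w, y] = - residue_wedge n g \<alpha> z [x, y, w]" for x y w
    using residue_form_antisym[of n z y x] residue_form_antisym[of n z w y]
    by (simp_all add: algebra_simps)
  then show ?thesis
    by (subst wedge_1_3) (use residue_form_antisym[of n z v u] in \<open>auto simp: assms algebra_simps\<close>)
qed

lemma wedge_structure_form:
  assumes "n \<ge> 1" "is_structure_form n U \<omega>" "z \<in> An_reg n U"
    and "u \<in> An_tangent n z" "v \<in> An_tangent n z"
    and "\<psi> z [\<i> *s u] = - \<i> * \<psi> z [u]" "\<psi> z [\<i> *s v] = - \<i> * \<psi> z [v]"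
    and "\<beta> z [\<i> *s u] = - \<i> * \<beta> z [u]" "\<beta> z [\<i> *s v] = - \<i> * \<beta> z [v]"
  shows "wedge 2 \<omega> (wedge 1 \<psi> \<beta>) z [u, \<i> *s u, v, \<i> *s v] =
     4 * residue_form n z u v * (\<psi> z [u] * \<beta> z [v] - \<psi> z [v] * \<beta> z [u])"
proof -
  have w: "\<omega> z [x, y] = residue_form n z x y"
    if "x \<in> {u, \<i> *s u, v, \<i> *s v}" "y \<in> {u, \<i> *s u, v, \<i> *s v}" for x y
    using that assms(4,5) An_tangent_scale
    by (intro structure_form_eq_residue_form[OF assms(1-3)]) auto
  have B: "wedge 1 \<psi> \<beta> z [y, x] = - wedge 1 \<psi> \<beta> z [x, y]" for x y
    unfolding wedge_1_1 by simp
  have "wedge 2 \<omega> (wedge 1 \<psi> \<beta>) z [u, \<i> *s u, v, \<i> *s v] =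
    \<omega> z [u, \<i> *s u] * wedge 1 \<psi> \<beta> z [v, \<i> *s v] - \<omega> z [u, v] * wedge 1 \<psi> \<beta> z [\<i> *s u, \<i> *s v]
    + \<omega> z [u, \<i> *s v] * wedge 1 \<psi> \<beta> z [\<i> *s u, v] + \<omega> z [\<i> *s u, v] * wedge 1 \<psi> \<beta> z [u, \<i> *s v]
    - \<omega> z [\<i> *s u, \<i> *s v] * wedge 1 \<psi> \<beta> z [u, v] + \<omega> z [v, \<i> *s v] * wedge 1 \<psi> \<beta> z [u, \<i> *s u]"
    by (rule wedge_2_2) (simp_all only: w residue_form_antisym[symmetric] B[symmetric])
  also have "\<dots> = 4 * residue_form n z u v * (\<psi> z [u] * \<beta> z [v] - \<psi> z [v] * \<beta> z [u])"
    unfolding wedge_1_1 by (simp add: w assms(6-9) algebra_simps)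
  finally show ?thesis .
qed

lemma dbar_1: "dbar \<alpha> z [u, v] = dbar_dir (\<lambda>x. \<alpha> x [v]) z u - dbar_dir (\<lambda>x. \<alpha> x [u]) z v"
  by (simp add: dbar_def lessThan_Suc numeral_2_eq_2)

text \<open>At tangent vectors only \<open>g\<close> is differentiated: the derivatives of \<open>residue_form\<close> vanish by
  \<open>residue_form_dbar_closed\<close>, and those of \<open>\<alpha>\<close> pair up to values of \<open>dbar \<alpha>\<close>.\<close>

lemma dbar_residue_wedge:
  assumes "n \<ge> 1" "smooth_form U 0 1 \<alpha>" "dbar_closed_on_An n U \<alpha>" "smooth_on g U" "z \<in> An_reg n U"
    and T: "{a, b, c, d} \<subseteq> An_tangent n z"
  shows "dbar (residue_wedge n g \<alpha>) z [a, b, c, d] =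
    dbar_dir g z a * residue_wedge n (\<lambda>_. 1) \<alpha> z [b, c, d] - dbar_dir g z b * residue_wedge n (\<lambda>_. 1) \<alpha> z [a, c, d]
    + dbar_dir g z c * residue_wedge n (\<lambda>_. 1) \<alpha> z [a, b, d] - dbar_dir g z d * residue_wedge n (\<lambda>_. 1) \<alpha> z [a, b, c]"
proof -
  have z: "z \<in> U" "z \<noteq> 0" using assms(5) by (auto simp: An_reg_def An_def)
  define D where "D y x = dbar_dir (\<lambda>z. \<alpha> z [x]) z y" for x y
  have ad: "(\<lambda>x. \<alpha> x [v]) differentiable (at z)" for v
    using assms(2) smooth_on_has_derivative[OF _ z(1), of "\<lambda>x. \<alpha> x [v]"]
    unfolding smooth_form_def differentiable_def by auto
  have rd: "(\<lambda>x. residue_form n x u v) differentiable (at z)" for u v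
    using smooth_on_has_derivative[OF smooth_residue_form[OF assms(1), of u v], of z] z(2)
    unfolding differentiable_def by auto
  have gd: "g differentiable (at z)"
    using smooth_on_has_derivative[OF assms(4) z(1)] unfolding differentiable_def by auto
  have closed: "D u v = D v u" if "u \<in> {a, b, c, d}" "v \<in> {a, b, c, d}" for u v
  proof -
    have "dbar \<alpha> z [u, v] = 0"
      using assms(3,5) T that unfolding dbar_closed_on_An_def by blast
    then show ?thesis by (simp add: dbar_1 D_def)
  qed
  have r: "dbar_dir (\<lambda>x. residue_form n x u v * \<alpha> x [w]) z y = residue_form n z u v * D y w"
    if "u \<in> {a, b, c, d}" "v \<in> {a, b, c, d}" for u v w y
    using residue_form_dbar_closed[OF assms(1) z(2), of u v y] T that
    by (subst dbar_dir_mult[OF rd ad]) (auto simp: D_def)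
  have main: "dbar_dir (\<lambda>x. residue_wedge n g \<alpha> x [u, v, w]) z y =
      dbar_dir g z y * residue_wedge n (\<lambda>_. 1) \<alpha> z [u, v, w]
      + g z * (residue_form n z u v * D y w - residue_form n z u w * D y v + residue_form n z v w * D y u)"
    if "u \<in> {a, b, c, d}" "v \<in> {a, b, c, d}" "w \<in> {a, b, c, d}" for u v w y
  proof -
    have "dbar_dir (\<lambda>x. residue_form n x u v * \<alpha> x [w] - residue_form n x u w * \<alpha> x [v]
        + residue_form n x v w * \<alpha> x [u]) z y =
      residue_form n z u v * D y w - residue_form n z u w * D y v + residue_form n z v w * D y u"
      by (simp add: dbar_dir_add dbar_dir_diff differentiable_diff differentiable_mult ad rd
          r[OF that(1,2)] r[OF that(1,3)] r[OF that(2,3)])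
    then show ?thesis
      unfolding residue_wedge_3
      by (subst dbar_dir_mult[OF gd], intro differentiable_add differentiable_diff differentiable_mult ad rd)
        simp
  qed
  have "dbar (residue_wedge n g \<alpha>) z [a, b, c, d] =
      dbar_dir (\<lambda>x. residue_wedge n g \<alpha> x [b, c, d]) z a - dbar_dir (\<lambda>x. residue_wedge n g \<alpha> x [a, c, d]) z b
      + dbar_dir (\<lambda>x. residue_wedge n g \<alpha> x [a, b, d]) z c - dbar_dir (\<lambda>x. residue_wedge n g \<alpha> x [a, b, c]) z d"
    by (simp add: dbar_def lessThan_Suc numeral_2_eq_2 del: residue_wedge_3)
  also have "\<dots> = dbar_dir g z a * residue_wedge n (\<lambda>_. 1) \<alpha> z [b, c, d] - dbar_dir g z b * residue_wedge n (\<lambda>_. 1) \<alpha> z [a, c, d]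
    + dbar_dir g z c * residue_wedge n (\<lambda>_. 1) \<alpha> z [a, b, d] - dbar_dir g z d * residue_wedge n (\<lambda>_. 1) \<alpha> z [a, b, c]"
    using closed[of b a] closed[of c a] closed[of d a] closed[of c b] closed[of d b] closed[of d c]
    by (simp add: main del: residue_wedge_3) (simp add: algebra_simps del: residue_wedge_3)
  finally show ?thesis .
qed

lemma wedge_dbar_residue_wedge:
  assumes "n \<ge> 1" "smooth_form U 0 1 \<alpha>" "dbar_closed_on_An n U \<alpha>" "smooth_on g U" "z \<in> An_reg n U"
    and "u \<in> An_tangent n z" "v \<in> An_tangent n z"
  shows "wedge 0 \<phi> (dbar (residue_wedge n g \<alpha>)) z [u, \<i> *s u, v, \<i> *s v] =
    4 * residue_form n z u v * (dbar_dir g z u * \<alpha> z [v] - dbar_dir g z v * \<alpha> z [u]) * \<phi> z []"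
proof -
  let ?S = "{u, \<i> *s u, v, \<i> *s v}"
  have S: "?S \<subseteq> An_tangent n z" using assms(6,7) An_tangent_scale by auto
  note f = dbar_residue_wedge[OF assms(1-5)]
  \<comment> \<open>the preceding formula is visibly alternating, so the antisymmetrisation in \<open>wedge 0\<close> is trivial\<close>
  have anti: "dbar (residue_wedge n g \<alpha>) z [x, w, y, t] = - dbar (residue_wedge n g \<alpha>) z [w, x, y, t]"
    "dbar (residue_wedge n g \<alpha>) z [w, y, x, t] = - dbar (residue_wedge n g \<alpha>) z [w, x, y, t]"
    "dbar (residue_wedge n g \<alpha>) z [w, x, t, y] = - dbar (residue_wedge n g \<alpha>) z [w, x, y, t]"
    if "{w, x, y, t} \<subseteq> ?S" for w x y t
  proof -
    have "{w, x, y, t} \<subseteq> An_tangent n z" using that S by blast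
    then show "dbar (residue_wedge n g \<alpha>) z [x, w, y, t] = - dbar (residue_wedge n g \<alpha>) z [w, x, y, t]"
      "dbar (residue_wedge n g \<alpha>) z [w, y, x, t] = - dbar (residue_wedge n g \<alpha>) z [w, x, y, t]"
      "dbar (residue_wedge n g \<alpha>) z [w, x, t, y] = - dbar (residue_wedge n g \<alpha>) z [w, x, y, t]"
      using residue_form_antisym[of n z x w] residue_form_antisym[of n z y x] residue_form_antisym[of n z t y]
      by (simp_all add: f insert_commute algebra_simps)
  qed
  have z: "z \<in> U" using assms(5) by (auto simp: An_reg_def An_def)
  have "g differentiable (at z)"
    using smooth_on_has_derivative[OF assms(4) z(1)] unfolding differentiable_def by auto
  then have gi: "dbar_dir g z (\<i> *s x) = - \<i> * dbar_dir g z x" for x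
  proof -
    assume g: "g differentiable (at z)"
    have "dbar_dir g z 0 = 0"
      using linear_0[OF linear_frechet_derivative[OF g]] by (simp add: dbar_dir_def)
    then show ?thesis using dbar_dir_antilinear[OF g, of \<i> x 0] by simp
  qed
  have ai: "\<alpha> z [\<i> *s x] = - \<i> * \<alpha> z [x]" for x
    using assms(2) z covector_1_scale[of UNIV "\<alpha> z" x \<i>] by (auto simp: smooth_form_def)
  have "wedge 0 \<phi> (dbar (residue_wedge n g \<alpha>)) z [u, \<i> *s u, v, \<i> *s v]
     = \<phi> z [] * dbar (residue_wedge n g \<alpha>) z [u, \<i> *s u, v, \<i> *s v]"
    by (rule wedge_0_4) (rule anti; assumption)+
  then show ?thesis
    using residue_form_antisym[of n z v u] by (simp add: f[OF S] gi ai algebra_simps)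
qed

section \<open>Gram-Schmidt for two complex vectors\<close>

lemma hermitian_inner_self: "hermitian_inner u u = of_real ((norm u)\<^sup>2)"
proof -
  have "(norm u)\<^sup>2 = (\<Sum>i\<in>UNIV. (cmod (u $ i))\<^sup>2)"
    by (simp add: norm_vec_def L2_set_def sum_nonneg)
  then show ?thesis
    by (simp only: hermitian_inner_def of_real_sum complex_norm_square)
qed

lemma hermitian_inner_cnj: "hermitian_inner v u = cnj (hermitian_inner u v)"
  by (simp add: hermitian_inner_def mult.commute)

lemma norm_scaleC: "norm (c *s (u :: complex ^ 'n::finite)) = cmod c * norm u"
  by (simp add: norm_vec_def L2_set_def norm_mult power_mult_distrib
      sum_distrib_left[symmetric] real_sqrt_mult)

definition gs_coeff :: "complex ^ 'n::finite \<Rightarrow> complex ^ 'n \<Rightarrow> complex" where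
  "gs_coeff u v = hermitian_inner v u / of_real ((norm u)\<^sup>2)"

lemma gram_schmidt_norm:
  assumes "u \<noteq> 0"
  shows "(norm u * norm (v - gs_coeff u v *s u))\<^sup>2 =
    Re (hermitian_inner u u * hermitian_inner v v - hermitian_inner u v * hermitian_inner v u)"
proof -
  define c where "c = gs_coeff u v"
  define h where "h = hermitian_inner u v"
  have N: "complex_of_real ((norm u)\<^sup>2) \<noteq> 0" using assms by simp
  have c: "c * of_real ((norm u)\<^sup>2) = cnj h"
    unfolding c_def gs_coeff_def h_def using N by (simp add: hermitian_inner_cnj[of v u])
  have c': "cnj c * of_real ((norm u)\<^sup>2) = h"
    using arg_cong[OF c, of cnj] by simp
  have "hermitian_inner (v - c *s u) (v - c *s u) = hermitian_inner v v - c * hermitian_inner u v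
      - cnj c * hermitian_inner v u + c * cnj c * hermitian_inner u u"
    by (simp add: hermitian_inner_def sum_subtractf sum.distrib sum_distrib_left algebra_simps)
  also have "\<dots> = hermitian_inner v v - c * h - cnj c * cnj h + c * h"
    using c' by (simp add: h_def hermitian_inner_cnj[of v u] hermitian_inner_self[of u] mult.assoc)
  finally have H: "hermitian_inner (v - c *s u) (v - c *s u) = hermitian_inner v v - cnj c * cnj h"
    by simp
  have "of_real ((norm u)\<^sup>2) * hermitian_inner (v - c *s u) (v - c *s u) =
      of_real ((norm u)\<^sup>2) * hermitian_inner v v - (cnj c * of_real ((norm u)\<^sup>2)) * cnj h"
    unfolding H by (simp only: right_diff_distrib mult_ac)
  then have "complex_of_real ((norm u)\<^sup>2 * (norm (v - c *s u))\<^sup>2) =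
      hermitian_inner u u * hermitian_inner v v - hermitian_inner u v * hermitian_inner v u"
    unfolding c' hermitian_inner_self by (simp add: h_def hermitian_inner_cnj[of v u])
  then show ?thesis
    unfolding c_def[symmetric] by (metis Re_complex_of_real power_mult_distrib)
qed

text \<open>The norm of an antilinear form on the plane spanned by \<open>u\<close> and \<open>v\<close>, computed from its values
  \<open>a\<close> and \<open>b\<close> on these vectors as the larger of its values on the orthonormal frame
  obtained from \<open>u\<close> and \<open>v\<close>; unlike the supremum over the unit ball it is evidently measurable in
  all data.\<close>

definition frame_norm :: "complex ^ 'n::finite \<Rightarrow> complex ^ 'n \<Rightarrow> complex \<Rightarrow> complex \<Rightarrow> real" where
  "frame_norm u v a b = max (cmod a / norm u)
     (cmod (b - cnj (gs_coeff u v) * a) / norm (v - gs_coeff u v *s u))"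

lemma frame_norm_nonneg: "frame_norm u v a b \<ge> 0"
  by (simp add: frame_norm_def le_max_iff_disj)

lemma frame_norm_scale: "frame_norm u v (k * a) (k * b) = cmod k * frame_norm u v a b"
proof -
  have "k * b - cnj (gs_coeff u v) * (k * a) = k * (b - cnj (gs_coeff u v) * a)"
    by (simp add: algebra_simps)
  then show ?thesis
    unfolding frame_norm_def by (simp add: norm_mult max_mult_distrib_left)
qed

lemma frame_norm_le:
  assumes "\<And>c. A (c *s u + v) = cnj c * A u + A v" "M \<ge> 0"
    and "cmod (A u) \<le> M * norm u"
    and "\<And>c. cmod (A (c *s u + v)) \<le> M * norm (c *s u + v)"
  shows "frame_norm u v (A u) (A v) \<le> M"
proof -
  have "v - gs_coeff u v *s u = (- gs_coeff u v) *s u + v"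
    by (simp add: vec_eq_iff)
  moreover have "A v - cnj (gs_coeff u v) * A u = A ((- gs_coeff u v) *s u + v)"
    unfolding assms(1) by simp
  ultimately have "cmod (A v - cnj (gs_coeff u v) * A u) \<le> M * norm (v - gs_coeff u v *s u)"
    using assms(4)[of "- gs_coeff u v"] by metis
  moreover have "x / y \<le> M" if "x \<le> M * y" "y \<ge> 0" for x y
    using that assms(2) by (cases "y = 0") (auto simp: field_simps)
  ultimately show ?thesis
    unfolding frame_norm_def using assms(3) by simp
qed

text \<open>Replacing \<open>v\<close> by its component orthogonal to \<open>u\<close> does not change the determinant
  \<open>a1 * b2 - a2 * b1\<close>, and for an orthogonal pair the product of the lengths is the square root of the Gram
  determinant \<open>V\<close>.\<close>

lemma antilinear_pairing_bound:
  fixes u v :: "complex ^ 'n::finite"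
  assumes "Re (hermitian_inner u u * hermitian_inner v v - hermitian_inner u v * hermitian_inner v u) = V"
    and "V > 0" "u \<noteq> 0"
  shows "cmod (a1 * b2 - a2 * b1) \<le> 2 * sqrt V * frame_norm u v a1 a2 * frame_norm u v b1 b2"
proof -
  define c where "c = gs_coeff u v"
  define M where "M = norm (v - c *s u)"
  define P Q where "P = frame_norm u v a1 a2" and "Q = frame_norm u v b1 b2"
  have V: "(norm u * M)\<^sup>2 = V" using gram_schmidt_norm[OF assms(3), of v] assms(1) by (simp add: c_def M_def)
  have "M \<noteq> 0" using V assms(2) by auto
  then have M: "M > 0" by (simp add: M_def)
  have u: "norm u > 0" using assms(3) by simp
  have s: "norm u * M = sqrt V" using V M by (simp flip: V)
  have 1: "cmod a1 \<le> P * norm u" "cmod b1 \<le> Q * norm u"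
    "cmod (a2 - cnj c * a1) \<le> P * M" "cmod (b2 - cnj c * b1) \<le> Q * M"
    using M u unfolding P_def Q_def frame_norm_def c_def[symmetric] M_def[symmetric]
    by (simp_all add: max_mult_distrib_right le_max_iff_disj)
  have PQ: "P \<ge> 0" "Q \<ge> 0" by (simp_all add: P_def Q_def frame_norm_nonneg)
  have "a1 * b2 - a2 * b1 = a1 * (b2 - cnj c * b1) - (a2 - cnj c * a1) * b1"
    by (simp add: algebra_simps)
  also have "cmod \<dots> \<le> cmod a1 * cmod (b2 - cnj c * b1) + cmod (a2 - cnj c * a1) * cmod b1"
    by (metis norm_mult norm_triangle_ineq4)
  also have "\<dots> \<le> (P * norm u) * (Q * M) + (P * M) * (Q * norm u)"
    using 1 PQ M u by (intro add_mono mult_mono) auto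
  also have "\<dots> = 2 * (norm u * M) * P * Q" by (simp add: algebra_simps)
  finally show ?thesis unfolding s P_def Q_def .
qed

section \<open>The first chart\<close>

definition An_e1 :: "nat \<Rightarrow> complex \<times> complex \<Rightarrow> complex ^ 3" where
  "An_e1 n w = vector [1, - (snd w ^ (n + 1) / (fst w)\<^sup>2), 0]"

definition An_e2 :: "nat \<Rightarrow> complex \<times> complex \<Rightarrow> complex ^ 3" where
  "An_e2 n w = vector [0, of_nat (n + 1) * snd w ^ n / fst w, 1]"

abbreviation chart_norm :: "nat \<Rightarrow> complex \<times> complex \<Rightarrow> complex \<Rightarrow> complex \<Rightarrow> real" where
  "chart_norm n w \<equiv> frame_norm (An_e1 n w) (An_e2 n w)"

abbreviation on_e1 :: "nat \<Rightarrow> 3 form \<Rightarrow> complex \<times> complex \<Rightarrow> complex" where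
  "on_e1 n \<eta> w \<equiv> \<eta> (An_chart1 n w) [An_e1 n w]"

abbreviation on_e2 :: "nat \<Rightarrow> 3 form \<Rightarrow> complex \<times> complex \<Rightarrow> complex" where
  "on_e2 n \<eta> w \<equiv> \<eta> (An_chart1 n w) [An_e2 n w]"

abbreviation dbar_e1 :: "nat \<Rightarrow> (complex ^ 3 \<Rightarrow> real) \<Rightarrow> complex \<times> complex \<Rightarrow> complex" where
  "dbar_e1 n \<kappa> w \<equiv> dbar_dir (\<lambda>x. complex_of_real (\<kappa> x)) (An_chart1 n w) (An_e1 n w)"

abbreviation dbar_e2 :: "nat \<Rightarrow> (complex ^ 3 \<Rightarrow> real) \<Rightarrow> complex \<times> complex \<Rightarrow> complex" where
  "dbar_e2 n \<kappa> w \<equiv> dbar_dir (\<lambda>x. complex_of_real (\<kappa> x)) (An_chart1 n w) (An_e2 n w)"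

lemma bounded_linear_scaleC: "bounded_linear (\<lambda>c :: complex. c *s (v :: complex ^ 'n::finite))"
  unfolding linear_conv_bounded_linear[symmetric]
  by (rule linearI) (auto simp: vec_eq_iff algebra_simps)

lemma An_chart1_has_derivative:
  assumes "fst w \<noteq> 0"
  shows "(An_chart1 n has_derivative (\<lambda>u. fst u *s An_e1 n w + snd u *s An_e2 n w)) (at w)"
proof -
  have eq: "An_chart1 n = (\<lambda>w. fst w *s axis 1 1 + (snd w ^ (n + 1) / fst w) *s axis 2 1 + snd w *s axis 3 1)"
    by (rule ext) (simp add: An_chart1_def vec_eq_iff forall_3 axis_def)
  have f: "((\<lambda>w. snd w ^ (n + 1) / fst w) has_derivative
      (\<lambda>u. - (snd w ^ (n + 1) / (fst w)\<^sup>2) * fst u + of_nat (n + 1) * snd w ^ n / fst w * snd u)) (at w)"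
    by (rule derivative_eq_intros refl assms)+ (use assms in \<open>auto simp: fun_eq_iff field_simps power2_eq_square\<close>)
  show ?thesis
    unfolding eq
    by (rule has_derivative_eq_rhs, (rule has_derivative_add bounded_linear.has_derivative[OF bounded_linear_scaleC]
          has_derivative_fst has_derivative_snd has_derivative_ident f)+)
      (auto simp: fun_eq_iff An_e1_def An_e2_def vec_eq_iff forall_3 axis_def mult_ac)
qed

lemma frechet_derivative_An_chart1:
  "fst w \<noteq> 0 \<Longrightarrow> frechet_derivative (An_chart1 n) (at w) u = fst u *s An_e1 n w + snd u *s An_e2 n w"
  by (simp add: frechet_derivative_at[OF An_chart1_has_derivative, symmetric])

lemma top_coeff_An_chart1:
  "fst w \<noteq> 0 \<Longrightarrow> top_coeff (An_chart1 n) \<eta> w =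
     \<eta> (An_chart1 n w) [An_e1 n w, \<i> *s An_e1 n w, An_e2 n w, \<i> *s An_e2 n w]"
  by (simp add: top_coeff_def pullback_def frechet_derivative_An_chart1)

lemma pullback_An_chart1:
  "fst w \<noteq> 0 \<Longrightarrow> pullback (An_chart1 n) \<eta> w [(1, 0)] = \<eta> (An_chart1 n w) [An_e1 n w]"
  "fst w \<noteq> 0 \<Longrightarrow> pullback (An_chart1 n) \<eta> w [(0, 1)] = \<eta> (An_chart1 n w) [An_e2 n w]"
  by (simp_all add: pullback_def frechet_derivative_An_chart1)

lemma An_chart1_reg: "w \<in> An_dom1 n U \<Longrightarrow> An_chart1 n w \<in> An_reg n U"
  using An_reg_charts by blast

lemma An_frame_tangent:
  assumes "fst w \<noteq> 0"
  shows "An_e1 n w \<in> An_tangent n (An_chart1 n w)" "An_e2 n w \<in> An_tangent n (An_chart1 n w)"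
  using assms
  by (simp_all add: An_tangent_iff bilinear_dot_def An_grad_def An_e1_def An_e2_def An_chart1_def
      power2_eq_square)

lemma An_tangent_decomposition:
  assumes "fst w \<noteq> 0" "v \<in> An_tangent n (An_chart1 n w)"
  shows "v = v $ 1 *s An_e1 n w + v $ 3 *s An_e2 n w"
proof -
  have "fst w * v $ 2 = of_nat (n + 1) * snd w ^ n * v $ 3 - snd w ^ (n + 1) / fst w * v $ 1"
    using assms(2) by (simp add: An_tangent_iff bilinear_dot_def An_grad_def An_chart1_def algebra_simps)
  then have "v $ 2 = (of_nat (n + 1) * snd w ^ n * v $ 3 - snd w ^ (n + 1) / fst w * v $ 1) / fst w"
    using assms(1) by (metis nonzero_mult_div_cancel_left)
  also have "\<dots> = - (snd w ^ (n + 1) / (fst w)\<^sup>2) * v $ 1 + of_nat (n + 1) * snd w ^ n / fst w * v $ 3"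
    using assms(1) by (simp add: field_simps power2_eq_square)
  finally show ?thesis
    by (simp add: vec_eq_iff forall_3 An_e1_def An_e2_def mult.commute)
qed

lemma residue_form_An_chart1:
  assumes "n \<ge> 1" "fst w \<noteq> 0"
  shows "residue_form n (An_chart1 n w) (An_e1 n w) (An_e2 n w) = - (2 * of_real pi * \<i>) / fst w"
proof -
  define g where "g = An_grad n (An_chart1 n w)"
  have "An_chart1 n w \<noteq> 0"
    using assms(2) by (auto simp: An_chart1_def vec_eq_iff forall_3)
  then have nz: "bilinear_dot g (cnj_vec g) \<noteq> 0"
    unfolding g_def using An_grad_nonzero[OF assms(1)] by blast
  define a B Q where "a = fst w" and "B = snd w ^ (n + 1)" and "Q = of_nat (n + 1) * snd w ^ n"
  have a: "a \<noteq> 0" using assms(2) by (simp add: a_def)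
  have v: "An_e1 n w = vector [1, - (B / a\<^sup>2), 0]" "An_e2 n w = vector [0, Q / a, 1]"
    "g = vector [B / a, a, - Q]"
    by (simp_all add: An_e1_def An_e2_def g_def An_grad_def An_chart1_def a_def B_def Q_def)
  have t: "triple_product t (An_e1 n w) (An_e2 n w) = - bilinear_dot g t * inverse a" for t
    unfolding triple_product_def bilinear_dot_def v vector_3
    using a by (simp add: field_simps power2_eq_square)
  show ?thesis
    unfolding residue_form_def g_def[symmetric] t a_def[symmetric] using nz a
    by (simp add: divide_inverse)
qed

lemma vol_density_gram:
  assumes "fst w \<noteq> 0"
  shows "vol_density (An_chart1 n) w = Re (hermitian_inner (An_e1 n w) (An_e1 n w) * hermitian_inner (An_e2 n w) (An_e2 n w)
           - hermitian_inner (An_e1 n w) (An_e2 n w) * hermitian_inner (An_e2 n w) (An_e1 n w))"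
  using assms by (simp add: vol_density_def frechet_derivative_An_chart1 Let_def)

lemma vol_density_An_chart1:
  assumes "fst w \<noteq> 0"
  shows "vol_density (An_chart1 n) w =
    1 + (cmod (snd w ^ (n + 1) / (fst w)\<^sup>2))\<^sup>2 + (cmod (of_nat (n + 1) * snd w ^ n / fst w))\<^sup>2"
proof -
  define p where "p = snd w ^ (n + 1) / (fst w)\<^sup>2"
  define q where "q = of_nat (n + 1) * snd w ^ n / fst w"
  have e: "An_e1 n w = vector [1, - p, 0]" "An_e2 n w = vector [0, q, 1]"
    by (simp_all add: An_e1_def An_e2_def p_def q_def)
  have "hermitian_inner (An_e1 n w) (An_e1 n w) * hermitian_inner (An_e2 n w) (An_e2 n w)
      - hermitian_inner (An_e1 n w) (An_e2 n w) * hermitian_inner (An_e2 n w) (An_e1 n w)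
      = 1 + p * cnj p + q * cnj q"
    unfolding e hermitian_inner_def sum_3 vector_3 by (simp add: algebra_simps)
  also have "\<dots> = of_real (1 + (cmod p)\<^sup>2 + (cmod q)\<^sup>2)"
    by (simp only: of_real_add of_real_1 complex_norm_square)
  finally show ?thesis
    unfolding vol_density_gram[OF assms] p_def[symmetric] q_def[symmetric] by simp
qed

lemma vol_density_ge_1: "fst w \<noteq> 0 \<Longrightarrow> vol_density (An_chart1 n) w \<ge> 1"
  by (simp add: vol_density_An_chart1)

lemma norm_vec3: "(norm (z :: complex ^ 3))\<^sup>2 = (cmod (z $ 1))\<^sup>2 + (cmod (z $ 2))\<^sup>2 + (cmod (z $ 3))\<^sup>2"
  by (simp add: norm_vec_def L2_set_def sum_nonneg sum_3)

text \<open>The volume density is \<open>\<parallel>grad f\<parallel>\<^sup>2 / \<bar>\<zeta>\<^sub>1\<bar>\<^sup>2\<close>, so near the origin the volume is dominated by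
  the measure \<open>\<bar>\<zeta>\<^sub>1\<bar>\<^sup>-\<^sup>2 d\<zeta>\<^sub>1 d\<zeta>\<^sub>3\<close>, the squared norm of the structure form.\<close>

lemma vol_density_le:
  assumes "fst w \<noteq> 0" "norm (An_chart1 n w) \<le> 1"
  shows "vol_density (An_chart1 n) w \<le> (2 + (of_nat (n + 1))\<^sup>2) / (cmod (fst w))\<^sup>2"
proof -
  define z where "z = An_chart1 n w"
  have le: "cmod (z $ i) \<le> 1" for i
    using assms(2) Finite_Cartesian_Product.norm_nth_le[of z i] by (simp add: z_def)
  have z: "z $ 1 = fst w" "z $ 2 = snd w ^ (n + 1) / fst w" "z $ 3 = snd w"
    by (simp_all add: z_def An_chart1_def)
  have "vol_density (An_chart1 n) w * (cmod (fst w))\<^sup>2 =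
      (cmod (z $ 1))\<^sup>2 + (cmod (z $ 2))\<^sup>2 + (of_nat (n + 1))\<^sup>2 * (cmod (z $ 3) ^ n)\<^sup>2"
    unfolding vol_density_An_chart1[OF assms(1)] z using assms(1)
    by (simp add: norm_mult norm_divide norm_power field_simps power2_eq_square del: of_nat_Suc of_nat_add)
  also have "\<dots> \<le> 1 + 1 + (of_nat (n + 1))\<^sup>2 * 1"
    using le by (intro add_mono mult_left_mono power_le_one) auto
  finally show ?thesis using assms(1) by (simp add: field_simps)
qed

lemma continuous_on_An_chart1: "continuous_on {w. fst w \<noteq> 0} (An_chart1 n)"
  by (rule continuous_at_imp_continuous_on)
    (auto intro: has_derivative_continuous[OF An_chart1_has_derivative])

lemma open_An_dom1: "open U \<Longrightarrow> open (An_dom1 n U)"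
proof -
  assume U: "open U"
  have "open {w :: complex \<times> complex. fst w \<noteq> 0}"
    by (intro open_Collect_neq continuous_intros)
  from continuous_open_preimage[OF continuous_on_An_chart1 this U]
  show ?thesis by (simp add: An_dom1_def vimage_def Int_def)
qed

text \<open>The points outside the first chart have \<open>\<zeta>\<^sub>1 = 0\<close> and hence \<open>\<zeta>\<^sub>3 = 0\<close>: a complex line of measure
  zero in the second chart.\<close>

lemma An_rest2_null: "An_rest2 n U \<in> null_sets lebesgue"
proof -
  have "An_rest2 n U \<subseteq> {w. (0, 1) \<bullet> w = 0}"
  proof
    fix w assume w: "w \<in> An_rest2 n U"
    then have a: "fst w \<noteq> 0" "An_chart2 n w \<in> U" and ni: "An_chart2 n w \<notin> An_chart1 n ` An_dom1 n U"
      by (auto simp: An_rest2_def An_dom2_def)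
    have "snd w = 0"
    proof (rule ccontr)
      assume b: "snd w \<noteq> 0"
      have "An_chart2 n w = An_chart1 n (snd w ^ (n + 1) / fst w, snd w)"
        using a(1) b by (simp add: An_chart1_def An_chart2_def)
      moreover have "(snd w ^ (n + 1) / fst w, snd w) \<in> An_dom1 n U"
        using a b calculation by (simp add: An_dom1_def)
      ultimately show False using ni by blast
    qed
    then show "w \<in> {w. (0, 1) \<bullet> w = 0}" by (simp add: inner_prod_def)
  qed
  moreover have "negligible {w :: complex \<times> complex. (0, 1) \<bullet> w = 0}"
    by (rule negligible_hyperplane) (simp add: zero_prod_def)
  ultimately show ?thesis
    using negligible_subset negligible_iff_null_sets by blast
qed

lemma An_integral_chart1:
  "An_integral n U \<eta> = (LINT w:An_dom1 n U|lebesgue. top_coeff (An_chart1 n) \<eta> w)"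
proof -
  have "(LINT w:An_rest2 n U|lebesgue. top_coeff (An_chart2 n) \<eta> w) = 0"
    unfolding set_lebesgue_integral_def
    by (rule integral_eq_zero_AE) (use AE_not_in[OF An_rest2_null[of n U]] in \<open>auto elim!: eventually_mono\<close>)
  then show ?thesis by (simp add: An_integral_def)
qed

text \<open>The supremum that defines \<open>An_norm\<close> is finite because the coordinates of a tangent vector in the
  frame are two of its own components.\<close>

lemma An_norm_ge:
  assumes "fst w \<noteq> 0" "is_covector (An_tangent n (An_chart1 n w)) 0 1 (\<phi> (An_chart1 n w))"
    and v: "v \<in> An_tangent n (An_chart1 n w)"
  shows "cmod (\<phi> (An_chart1 n w) [v]) \<le> An_norm n 1 \<phi> (An_chart1 n w) * norm v"
proof -
  define z where "z = An_chart1 n w"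
  let ?S = "{vs. length vs = 1 \<and> (\<forall>v \<in> set vs. v \<in> An_tangent n z \<and> norm v \<le> 1)}"
  have cov: "is_covector (An_tangent n z) 0 1 (\<phi> z)" using assms(2) by (simp add: z_def)
  have e: "An_e1 n w \<in> An_tangent n z" "An_e2 n w \<in> An_tangent n z"
    using An_frame_tangent[OF assms(1)] by (simp_all add: z_def)
  have b: "cmod (\<phi> z [v]) \<le> cmod (\<phi> z [An_e1 n w]) + cmod (\<phi> z [An_e2 n w])"
    if "v \<in> An_tangent n z" "norm v \<le> 1" for v
  proof -
    have "\<phi> z [v] = \<phi> z [v $ 1 *s An_e1 n w + v $ 3 *s An_e2 n w]"
      using An_tangent_decomposition[OF assms(1), of v n] that(1) by (simp add: z_def)
    also have "\<dots> = cnj (v $ 1) * \<phi> z [An_e1 n w] + cnj (v $ 3) * \<phi> z [An_e2 n w]"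
      using covector_1_antilinear[OF cov e(1) An_tangent_scale[OF e(1)] An_tangent_scale[OF e(2)]]
        covector_1_scale[OF cov e(2)] by simp
    also have "cmod \<dots> \<le> cmod (v $ 1) * cmod (\<phi> z [An_e1 n w]) + cmod (v $ 3) * cmod (\<phi> z [An_e2 n w])"
      by (metis norm_mult norm_triangle_ineq complex_mod_cnj)
    also have "\<dots> \<le> 1 * cmod (\<phi> z [An_e1 n w]) + 1 * cmod (\<phi> z [An_e2 n w])"
      using that(2) Finite_Cartesian_Product.norm_nth_le[of v 1] Finite_Cartesian_Product.norm_nth_le[of v 3]
      by (intro add_mono mult_right_mono) auto
    finally show ?thesis by simp
  qed
  have bdd: "bdd_above ((\<lambda>vs. cmod (\<phi> z vs)) ` ?S)"
    by (rule bdd_aboveI[of _ "cmod (\<phi> z [An_e1 n w]) + cmod (\<phi> z [An_e2 n w])"])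
      (auto simp: length_Suc_conv b)
  have unit: "cmod (\<phi> z [v]) \<le> An_norm n 1 \<phi> z" if "v \<in> An_tangent n z" "norm v \<le> 1" for v
    unfolding An_norm_def using that by (intro cSUP_upper[OF _ bdd]) auto
  define c where "c = complex_of_real (inverse (norm v))"
  show ?thesis
  proof (cases "v = 0")
    case True
    then show ?thesis using covector_1_scale[OF cov, of 0 0] An_tangent_scale[OF e(1), of 0]
      by (simp add: z_def)
  next
    case False
    have "cmod (\<phi> z [c *s v]) \<le> An_norm n 1 \<phi> z"
      using False v by (intro unit An_tangent_scale) (auto simp: norm_scaleC c_def z_def norm_inverse)
    then have "norm v * cmod (\<phi> z [c *s v]) \<le> norm v * An_norm n 1 \<phi> z"
      by (intro mult_left_mono) auto
    moreover have "norm v * cmod (\<phi> z [c *s v]) = cmod (\<phi> z [v])"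
      using covector_1_scale[OF cov, of v c] v False
      by (simp add: z_def norm_mult c_def norm_inverse)
    ultimately show ?thesis by (simp add: z_def mult.commute)
  qed
qed

section \<open>Mass estimates for the structure form\<close>

text \<open>The part of the ball of radius \<open>d\<close> in the surface, seen in the coordinates \<open>(\<zeta>\<^sub>1, \<zeta>\<^sub>3)\<close>; the last
  condition bounds \<open>\<zeta>\<^sub>2 = \<zeta>\<^sub>3 ^ (n + 1) / \<zeta>\<^sub>1\<close>.\<close>

definition cone_region :: "nat \<Rightarrow> real \<Rightarrow> (complex \<times> complex) set" where
  "cone_region n d = {w. fst w \<noteq> 0 \<and> cmod (fst w) \<le> d \<and> cmod (snd w) \<le> d \<and>
     cmod (snd w) ^ (n + 1) \<le> d * cmod (fst w)}"

lemma dyadic_annulus: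
  fixes x d :: real
  assumes "0 < x" "x \<le> d"
  obtains i where "d / 2 ^ (i + 1) < x" "x \<le> d / 2 ^ i"
proof -
  obtain m where "inverse 2 ^ m < x / d"
    using real_arch_pow_inv[of "x / d" "inverse 2"] assms by auto
  then have "d / 2 ^ m < x" using assms by (simp add: field_simps power_inverse)
  then have ex: "\<exists>i. d / 2 ^ (i + 1) < x"
    using assms by (intro exI[of _ m]) (smt (verit) divide_strict_left_mono power_add power_one_right
        zero_less_power frac_less2 one_le_power power_increasing zero_le_power divide_left_mono mult_pos_pos le_add1)
  define i where "i = (LEAST i. d / 2 ^ (i + 1) < x)"
  have "d / 2 ^ (i + 1) < x" unfolding i_def by (rule LeastI_ex[OF ex])
  moreover have "x \<le> d / 2 ^ i"
  proof (cases i)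
    case (Suc k)
    then have "\<not> d / 2 ^ (k + 1) < x" unfolding i_def by (metis lessI not_less_Least)
    then show ?thesis using Suc by simp
  qed (use assms in simp)
  ultimately show ?thesis using that by blast
qed

lemma emeasure_bidisc:
  assumes "r \<ge> 0" "s \<ge> 0"
  shows "emeasure lebesgue (cball (0 :: complex) r \<times> cball (0 :: complex) s) = ennreal (pi\<^sup>2 * r\<^sup>2 * s\<^sup>2)"
proof -
  have "emeasure lborel (cball (0 :: complex) r \<times> cball (0 :: complex) s) =
      emeasure lborel (cball (0 :: complex) r) * emeasure lborel (cball (0 :: complex) s)"
    unfolding lborel_prod[symmetric] by (rule lborel.emeasure_pair_measure_Times) auto
  also have "\<dots> = ennreal (pi * r\<^sup>2) * ennreal (pi * s\<^sup>2)"
    using assms by (simp add: emeasure_cball unit_ball_vol_2)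
  also have "\<dots> = ennreal (pi\<^sup>2 * r\<^sup>2 * s\<^sup>2)"
    by (simp add: ennreal_mult[symmetric] power2_eq_square mult_ac)
  finally show ?thesis
    by (simp add: borel_closed closed_Times)
qed

text \<open>Over the annulus \<open>\<bar>\<zeta>\<^sub>1\<bar> \<approx> 2\<^sup>-\<^sup>j\<^sup>-\<^sup>i\<close> the density \<open>\<bar>\<zeta>\<^sub>1\<bar>\<^sup>-\<^sup>2\<close> contributes a bounded factor times the area
  \<open>\<pi> (r i)\<^sup>2\<close> of the disc of admissible \<open>\<zeta>\<^sub>3\<close>.  For \<open>i < n * j\<close> the disc has at most the radius
  \<open>2\<^sup>-\<^sup>j\<close>, beyond that its radius decays geometrically: this is the source of the factor
  \<open>j + 1\<close>, a logarithm of the scale.\<close>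

lemma cone_region_mass:
  obtains C :: real where "C > 0"
    "\<And>j. (\<integral>\<^sup>+ w. indicator (cone_region n (1 / 2 ^ j)) w * ennreal (1 / (cmod (fst w))\<^sup>2) \<partial>lebesgue)
       \<le> ennreal (C * (real j + 1) / 4 ^ j)"
proof -
  \<comment> \<open>the ratio of successive radii beyond \<open>n * j\<close>: halving \<open>\<bar>\<zeta>\<^sub>1\<bar>\<close> halves the bound on \<open>\<bar>\<zeta>\<^sub>3\<bar> ^ (n + 1)\<close>\<close>
  define q where "q = (2 :: real) powr (- (1 / real (n + 1)))"
  have q: "0 < q" "q < 1" using powr_less_mono[of "- (1 / real (n + 1))" 0 2] by (simp_all add: q_def)
  have qn: "q ^ (n + 1) = 1 / 2"
  proof -
    have "q ^ (n + 1) = 2 powr (- (1 / real (n + 1)) * real (n + 1))"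
      using powr_realpow[OF q(1), of "n + 1"] unfolding q_def powr_powr by simp
    also have "\<dots> = 2 powr (- 1)" by simp
    finally show ?thesis by (simp add: powr_minus_divide)
  qed
  define C where "C = 4 * pi\<^sup>2 * (real n + 1 / (1 - q\<^sup>2))"
  have q2: "q\<^sup>2 < 1" using q by (simp add: power_less_one_iff)
  have C: "C > 0" unfolding C_def using q2 by (intro mult_pos_pos add_nonneg_pos) auto
  have four: "(2 ^ i)\<^sup>2 = (4 :: real) ^ i" for i
    by (simp add: power2_eq_square flip: power_mult_distrib)
  have bound: "(\<integral>\<^sup>+ w. indicator (cone_region n (1 / 2 ^ j)) w * ennreal (1 / (cmod (fst w))\<^sup>2) \<partial>lebesgue)
       \<le> ennreal (C * (real j + 1) / 4 ^ j)" for j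
  proof -
    define d where "d = (1 :: real) / 2 ^ j"
    have d: "d > 0" "d\<^sup>2 = 1 / 4 ^ j"
      by (simp_all add: d_def power_divide four)
    define r where "r i = (if i < n * j then d else d * q ^ (i - n * j))" for i
    have r: "r i \<ge> 0" for i using d q by (simp add: r_def)
    define B where "B i = cball (0 :: complex) (d / 2 ^ i) \<times> cball (0 :: complex) (r i)" for i
    have Bm: "B i \<in> sets lebesgue" for i
      unfolding B_def by (intro sets_completionI_sets) (simp add: borel_closed closed_Times)
    define k where "k i = 4 ^ (i + 1) / d\<^sup>2" for i :: nat
    have pw: "indicator (cone_region n d) w * ennreal (1 / (cmod (fst w))\<^sup>2)
        \<le> (\<Sum>i. ennreal (k i) * indicator (B i) w)" for w
    proof (cases "w \<in> cone_region n d")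
      case True
      define x where "x = cmod (fst w)"
      have w: "0 < x" "x \<le> d" "cmod (snd w) \<le> d" "cmod (snd w) ^ (n + 1) \<le> d * x"
        using True by (auto simp: cone_region_def x_def)
      obtain i where i: "d / 2 ^ (i + 1) < x" "x \<le> d / 2 ^ i"
        using dyadic_annulus[OF w(1,2)] by blast
      have "cmod (snd w) \<le> r i"
      proof (cases "i < n * j")
        case False
        define m where "m = i - n * j"
        have im: "i = n * j + m" using False by (simp add: m_def)
        have "cmod (snd w) ^ (n + 1) \<le> d * (d / 2 ^ i)"
          using w(4) i(2) d by (meson mult_left_mono order_trans less_imp_le)
        also have "\<dots> = d * d ^ (n + 1) * (1 / 2) ^ m"
          by (simp add: im d_def power_divide power_add power_mult mult.commute field_simps)
        also have "\<dots> \<le> d ^ (n + 1) * (1 / 2) ^ m"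
          using d by (intro mult_right_mono mult_left_le_one_le) (auto simp: d_def)
        also have "\<dots> = (d * q ^ m) ^ (n + 1)"
          by (simp only: power_mult_distrib power_mult[symmetric] mult.commute[of m] power_mult[of q "n+1" m] qn)
        finally have "cmod (snd w) ^ Suc n \<le> (d * q ^ m) ^ Suc n" by simp
        then show ?thesis
          using d q False by (auto simp: r_def m_def intro: power_le_imp_le_base)
      qed (use w in \<open>simp add: r_def\<close>)
      then have "w \<in> B i"
        using i(2) by (auto simp: B_def x_def mem_Times_iff)
      moreover have "1 / x\<^sup>2 \<le> k i"
      proof -
        have "(d / 2 ^ (i + 1))\<^sup>2 \<le> x\<^sup>2" using i(1) d by (intro power_mono) auto
        then have "d\<^sup>2 / 4 ^ (i + 1) \<le> x\<^sup>2"
          by (simp only: power_divide four)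
        then have "d\<^sup>2 \<le> x\<^sup>2 * 4 ^ (i + 1)" by (simp only: pos_divide_le_eq zero_less_power zero_less_numeral)
        then show ?thesis using d(1) w by (simp add: k_def field_simps)
      qed
      ultimately have "indicator (cone_region n d) w * ennreal (1 / (cmod (fst w))\<^sup>2)
          \<le> ennreal (k i) * indicator (B i) w"
        using True by (simp add: x_def ennreal_leI)
      also have "\<dots> \<le> (\<Sum>i. ennreal (k i) * indicator (B i) w)"
      proof -
        define f where "f i = ennreal (k i) * indicator (B i) w" for i
        have "sum f {i} \<le> suminf f" by (rule sum_le_suminf) auto
        then show ?thesis by (simp add: f_def[abs_def, symmetric]) (simp add: f_def)
      qed
      finally show ?thesis .
    qed simp
    define u where "u i = (if i < n * j then d\<^sup>2 else d\<^sup>2 * (q\<^sup>2) ^ (i - n * j))" for i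
    have ru: "(r i)\<^sup>2 = u i" for i
      by (simp add: r_def u_def power_mult_distrib flip: power_mult) (simp add: mult.commute)
    have tail: "(\<lambda>i. u (i + n * j)) sums (d\<^sup>2 * (1 / (1 - q\<^sup>2)))"
    proof -
      have "(\<lambda>m. d\<^sup>2 * (q\<^sup>2) ^ m) sums (d\<^sup>2 * (1 / (1 - q\<^sup>2)))"
        using q2 by (intro sums_mult geometric_sums) simp
      moreover have "(\<lambda>i. u (i + n * j)) = (\<lambda>m. d\<^sup>2 * (q\<^sup>2) ^ m)"
        by (simp add: u_def)
      ultimately show ?thesis by simp
    qed
    have usum: "u sums (d\<^sup>2 * (1 / (1 - q\<^sup>2)) + real (n * j) * d\<^sup>2)"
      using tail[unfolded sums_iff_shift] by (simp add: u_def mult.commute)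
    have "(\<integral>\<^sup>+ w. indicator (cone_region n d) w * ennreal (1 / (cmod (fst w))\<^sup>2) \<partial>lebesgue)
        \<le> (\<integral>\<^sup>+ w. (\<Sum>i. ennreal (k i) * indicator (B i) w) \<partial>lebesgue)"
      by (rule nn_integral_mono) (rule pw)
    also have "\<dots> = (\<Sum>i. \<integral>\<^sup>+ w. ennreal (k i) * indicator (B i) w \<partial>lebesgue)"
      by (intro nn_integral_suminf borel_measurable_times_ennreal borel_measurable_const
          borel_measurable_indicator Bm)
    also have "\<dots> = (\<Sum>i. ennreal (4 * pi\<^sup>2 * u i))"
    proof (rule suminf_cong)
      fix i
      have "(\<integral>\<^sup>+ w. ennreal (k i) * indicator (B i) w \<partial>lebesgue) = ennreal (k i) * emeasure lebesgue (B i)"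
        by (rule nn_integral_cmult_indicator[OF Bm])
      also have "\<dots> = ennreal (k i * (pi\<^sup>2 * (d / 2 ^ i)\<^sup>2 * (r i)\<^sup>2))"
        unfolding B_def using d r by (subst emeasure_bidisc) (auto simp: ennreal_mult k_def)
      also have "k i * (pi\<^sup>2 * (d / 2 ^ i)\<^sup>2 * (r i)\<^sup>2) = 4 * pi\<^sup>2 * u i"
      proof -
        show ?thesis using d(1) by (simp add: k_def ru power_divide four)
      qed
      finally show "(\<integral>\<^sup>+ w. ennreal (k i) * indicator (B i) w \<partial>lebesgue) = ennreal (4 * pi\<^sup>2 * u i)" .
    qed
    also have "\<dots> = ennreal (4 * pi\<^sup>2 * (d\<^sup>2 * (1 / (1 - q\<^sup>2)) + real (n * j) * d\<^sup>2))"
      by (rule suminf_ennreal_eq[OF _ sums_mult[OF usum]]) (simp add: u_def)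
    also have "\<dots> \<le> ennreal (C * (real j + 1) / 4 ^ j)"
    proof (rule ennreal_leI)
      have "4 * pi\<^sup>2 * (d\<^sup>2 * (1 / (1 - q\<^sup>2)) + real (n * j) * d\<^sup>2) =
          (4 * pi\<^sup>2 * (real n * real j + 1 / (1 - q\<^sup>2))) / 4 ^ j"
        by (simp add: d(2) add_divide_distrib algebra_simps)
      also have "\<dots> \<le> C * (real j + 1) / 4 ^ j"
      proof (rule divide_right_mono)
        have "real n * real j + 1 / (1 - q\<^sup>2) \<le> (real n + 1 / (1 - q\<^sup>2)) * (real j + 1)"
        proof -
          define E where "E = 1 / (1 - q\<^sup>2)"
          have "E \<ge> 0" using q2 by (simp add: E_def)
          then show ?thesis unfolding E_def[symmetric] by (simp add: algebra_simps)
        qed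
        then show "4 * pi\<^sup>2 * (real n * real j + 1 / (1 - q\<^sup>2)) \<le> C * (real j + 1)"
          unfolding C_def by (simp add: mult.assoc)
      qed simp
      finally show "4 * pi\<^sup>2 * (d\<^sup>2 * (1 / (1 - q\<^sup>2)) + real (n * j) * d\<^sup>2) \<le> C * (real j + 1) / 4 ^ j" .
    qed
    finally show ?thesis unfolding d_def .
  qed
  show ?thesis using that[OF C bound] .
qed

lemma An_chart1_cone_region:
  assumes "w \<in> An_dom1 n U" "norm (An_chart1 n w) \<le> d"
  shows "w \<in> cone_region n d"
proof -
  have a: "fst w \<noteq> 0" using assms(1) by (simp add: An_dom1_def)
  have le: "cmod (An_chart1 n w $ i) \<le> d" for i
    using assms(2) Finite_Cartesian_Product.norm_nth_le[of "An_chart1 n w" i] by linarith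
  have "cmod (snd w ^ (n + 1) / fst w) \<le> d" using le[of 2] by (simp add: An_chart1_def)
  then have "cmod (snd w) ^ (n + 1) \<le> d * cmod (fst w)"
    using a by (simp add: norm_divide norm_power norm_mult field_simps)
  then show ?thesis
    using a le[of 1] le[of 3] by (simp add: cone_region_def An_chart1_def)
qed

section \<open>Square integrable data in the chart\<close>

abbreviation chart_space :: "nat \<Rightarrow> (complex ^ 3) set \<Rightarrow> (complex \<times> complex) measure" where
  "chart_space n U \<equiv> lebesgue_on (An_dom1 n U)"

definition small_part :: "nat \<Rightarrow> (complex ^ 3) set \<Rightarrow> real \<Rightarrow> (complex \<times> complex) set" where
  "small_part n U d = {w \<in> An_dom1 n U. norm (An_chart1 n w) \<le> d}"

definition residue_mass :: "nat \<Rightarrow> (complex ^ 3) set \<Rightarrow> (complex \<times> complex) set \<Rightarrow> ennreal" where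
  "residue_mass n U S = (\<integral>\<^sup>+ w. indicator S w * ennreal (1 / (cmod (fst w))\<^sup>2) \<partial>chart_space n U)"

definition l2_mass ::
    "nat \<Rightarrow> (complex ^ 3) set \<Rightarrow> (complex \<times> complex) set \<Rightarrow> (complex \<times> complex \<Rightarrow> real) \<Rightarrow> ennreal" where
  "l2_mass n U S h = (\<integral>\<^sup>+ w. indicator S w * ennreal ((h w)\<^sup>2 * vol_density (An_chart1 n) w) \<partial>chart_space n U)"

abbreviation pair_mass ::
    "nat \<Rightarrow> (complex ^ 3) set \<Rightarrow> (complex \<times> complex) set \<Rightarrow> (complex \<times> complex \<Rightarrow> complex) \<Rightarrow>
      (complex \<times> complex \<Rightarrow> complex) \<Rightarrow> ennreal" where
  "pair_mass n U S b1 b2 \<equiv> l2_mass n U S (\<lambda>w. chart_norm n w (b1 w) (b2 w))"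

lemma An_dom1_lebesgue: "open U \<Longrightarrow> An_dom1 n U \<in> sets lebesgue"
  by (intro sets_completionI_sets) (simp add: open_An_dom1)

lemma fst_nonzero_An_dom1: "w \<in> An_dom1 n U \<Longrightarrow> fst w \<noteq> 0"
  by (simp add: An_dom1_def)

lemma chart_space_measurable:
  "open U \<Longrightarrow> continuous_on (An_dom1 n U) f \<Longrightarrow> f \<in> borel_measurable (chart_space n U)"
  by (rule continuous_imp_measurable_on_sets_lebesgue) (auto simp: An_dom1_lebesgue)

lemma continuous_on_An_chart1': "continuous_on (An_dom1 n U) (An_chart1 n)"
  by (rule continuous_on_subset[OF continuous_on_An_chart1]) (auto simp: An_dom1_def)

lemma An_integral_chart_space:
  "open U \<Longrightarrow> An_integral n U \<eta> = integral\<^sup>L (chart_space n U) (top_coeff (An_chart1 n) \<eta>)"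
  unfolding An_integral_chart1 set_lebesgue_integral_def
  by (rule integral_restrict_space[symmetric]) (simp add: An_dom1_lebesgue)

lemma norm_An_chart1_measurable:
  "open U \<Longrightarrow> (\<lambda>w. norm (An_chart1 n w)) \<in> borel_measurable (chart_space n U)"
  by (intro chart_space_measurable continuous_on_norm continuous_on_An_chart1')

lemma small_part_sets: "open U \<Longrightarrow> small_part n U d \<in> sets (chart_space n U)"
  using measurable_sets[OF norm_An_chart1_measurable, of U "{..d}" n]
  by (simp add: small_part_def vimage_def Int_def conj_commute)

lemma fst_measurable: "open U \<Longrightarrow> (\<lambda>w. cmod (fst w)) \<in> borel_measurable (chart_space n U)"
  by (intro chart_space_measurable continuous_intros)

lemma vol_density_measurable:
  assumes "open U"
  shows "vol_density (An_chart1 n) \<in> borel_measurable (chart_space n U)"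
proof -
  have "(\<lambda>w. 1 + (cmod (snd w ^ (n + 1) / (fst w)\<^sup>2))\<^sup>2 + (cmod (of_nat (n + 1) * snd w ^ n / fst w))\<^sup>2)
      \<in> borel_measurable (chart_space n U)"
    by (intro chart_space_measurable[OF assms] continuous_intros) (auto simp: An_dom1_def)
  then show ?thesis
    by (rule measurable_cong[THEN iffD1, rotated])
      (auto simp: vol_density_An_chart1 fst_nonzero_An_dom1)
qed

text \<open>The coordinate frame is \<open>e\<^sub>1 = (1, - p, 0)\<close> and \<open>e\<^sub>2 = (0, q, 1)\<close>; in terms of \<open>p\<close> and \<open>q\<close> the norm
  is measurable at sight.\<close>

lemma frame_norm_An_chart1:
  fixes n :: nat and w :: "complex \<times> complex"
  assumes "fst w \<noteq> 0"
  defines "p \<equiv> snd w ^ (n + 1) / (fst w)\<^sup>2" and "q \<equiv> of_nat (n + 1) * snd w ^ n / fst w"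
  shows "chart_norm n w a b =
    max (cmod a / sqrt (1 + (cmod p)\<^sup>2))
     (cmod (b + cnj q * p / of_real (1 + (cmod p)\<^sup>2) * a)
        / (sqrt (1 + (cmod p)\<^sup>2 + (cmod q)\<^sup>2) / sqrt (1 + (cmod p)\<^sup>2)))"
proof -
  define u v where "u = An_e1 n w" and "v = An_e2 n w"
  have e: "u = vector [1, - p, 0]" "v = vector [0, q, 1]"
    by (simp_all add: An_e1_def An_e2_def p_def q_def u_def v_def)
  have nu2: "(norm u)\<^sup>2 = 1 + (cmod p)\<^sup>2" by (simp add: norm_vec3 e)
  have nu: "norm u = sqrt (1 + (cmod p)\<^sup>2)" by (simp flip: nu2)
  have pos: "1 + (cmod p)\<^sup>2 > 0" by (simp add: add_pos_nonneg)
  then have u0: "norm u > 0" by (simp add: nu)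
  then have unz: "u \<noteq> 0" by auto
  have gs: "cnj (gs_coeff u v) = - (cnj q * p / of_real (1 + (cmod p)\<^sup>2))"
    unfolding gs_coeff_def nu2 unfolding hermitian_inner_def sum_3 e vector_3 by simp
  have "(norm u * norm (v - gs_coeff u v *s u))\<^sup>2 = 1 + (cmod p)\<^sup>2 + (cmod q)\<^sup>2"
    using gram_schmidt_norm[OF unz, of v] vol_density_gram[OF assms(1), of n]
      vol_density_An_chart1[OF assms(1), of n] by (simp add: u_def v_def p_def q_def)
  then have "norm u * norm (v - gs_coeff u v *s u) = sqrt (1 + (cmod p)\<^sup>2 + (cmod q)\<^sup>2)"
    by (metis norm_ge_zero mult_nonneg_nonneg real_sqrt_unique)
  then have "norm (v - gs_coeff u v *s u) = sqrt (1 + (cmod p)\<^sup>2 + (cmod q)\<^sup>2) / norm u"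
    using u0 by (simp add: field_simps)
  then show ?thesis
    unfolding frame_norm_def u_def[symmetric] v_def[symmetric] gs nu by simp
qed

lemma frame_norm_measurable:
  assumes "open U" and a: "a \<in> borel_measurable (chart_space n U)" and b: "b \<in> borel_measurable (chart_space n U)"
  shows "(\<lambda>w. chart_norm n w (a w) (b w)) \<in> borel_measurable (chart_space n U)"
proof -
  define p where "p w = snd w ^ (n + 1) / (fst w)\<^sup>2" for w :: "complex \<times> complex"
  define q where "q w = of_nat (n + 1) * snd w ^ n / fst w" for w :: "complex \<times> complex"
  have pq [measurable]: "p \<in> borel_measurable (chart_space n U)" "q \<in> borel_measurable (chart_space n U)"
    unfolding p_def[abs_def] q_def[abs_def]
    by (intro chart_space_measurable[OF assms(1)] continuous_intros; auto simp: An_dom1_def)+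
  note a [measurable] b [measurable]
  have cnj [measurable]: "(\<lambda>w. cnj (q w)) \<in> borel_measurable (chart_space n U)"
    by (rule borel_measurable_continuous_on[OF continuous_on_cnj[OF continuous_on_id] pq(2)])
  have "(\<lambda>w. max (cmod (a w) / sqrt (1 + (cmod (p w))\<^sup>2))
     (cmod (b w + cnj (q w) * p w / of_real (1 + (cmod (p w))\<^sup>2) * a w)
        / (sqrt (1 + (cmod (p w))\<^sup>2 + (cmod (q w))\<^sup>2) / sqrt (1 + (cmod (p w))\<^sup>2))))
     \<in> borel_measurable (chart_space n U)"
    by measurable
  then show ?thesis
    by (rule measurable_cong[THEN iffD1, rotated])
      (auto simp: frame_norm_An_chart1 fst_nonzero_An_dom1 p_def q_def)
qed

lemma residue_mass_mono: "S \<subseteq> T \<Longrightarrow> residue_mass n U S \<le> residue_mass n U T"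
  unfolding residue_mass_def by (intro nn_integral_mono mult_right_mono) (auto split: split_indicator)

lemma l2_mass_mono: "S \<subseteq> T \<Longrightarrow> l2_mass n U S h \<le> l2_mass n U T h"
  unfolding l2_mass_def by (intro nn_integral_mono mult_right_mono) (auto split: split_indicator)

lemma residue_mass_small_part:
  assumes "open U"
  obtains C :: real where "C > 0"
    "\<And>j. residue_mass n U (small_part n U (1 / 2 ^ j)) \<le> ennreal (C * (real j + 1) / 4 ^ j)"
proof -
  obtain C :: real where C: "C > 0"
    "\<And>j. (\<integral>\<^sup>+ w. indicator (cone_region n (1 / 2 ^ j)) w * ennreal (1 / (cmod (fst w))\<^sup>2) \<partial>lebesgue)
       \<le> ennreal (C * (real j + 1) / 4 ^ j)"
    using cone_region_mass[of n] by blast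
  have "residue_mass n U (small_part n U d) \<le>
      (\<integral>\<^sup>+ w. indicator (cone_region n d) w * ennreal (1 / (cmod (fst w))\<^sup>2) \<partial>lebesgue)" for d
  proof -
    have "residue_mass n U (small_part n U d) = (\<integral>\<^sup>+ w. (indicator (small_part n U d) w
        * ennreal (1 / (cmod (fst w))\<^sup>2)) * indicator (An_dom1 n U) w \<partial>lebesgue)"
      unfolding residue_mass_def
      by (rule nn_integral_restrict_space) (simp add: An_dom1_lebesgue[OF assms])
    also have "\<dots> \<le> (\<integral>\<^sup>+ w. indicator (cone_region n d) w * ennreal (1 / (cmod (fst w))\<^sup>2) \<partial>lebesgue)"
      by (rule nn_integral_mono) (auto simp: small_part_def An_chart1_cone_region split: split_indicator)
    finally show ?thesis .
  qed
  then show ?thesis using that[OF C(1)] C(2) order_trans by blast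
qed

lemma volume_small_part_finite:
  assumes "open U"
  shows "l2_mass n U (small_part n U 1) (\<lambda>_. 1) < \<infinity>"
proof -
  define K where "K = 2 + (real (n + 1))\<^sup>2"
  obtain C :: real where "residue_mass n U (small_part n U (1 / 2 ^ 0)) \<le> ennreal (C * (real 0 + 1) / 4 ^ 0)"
    using residue_mass_small_part[OF assms] by metis
  then have fin: "residue_mass n U (small_part n U 1) < \<infinity>"
    by (simp add: order_le_less_trans)
  have m: "(\<lambda>w. indicator (small_part n U 1) w * ennreal (1 / (cmod (fst w))\<^sup>2)) \<in> borel_measurable (chart_space n U)"
    using small_part_sets[OF assms, of n 1] fst_measurable[OF assms, of n] by measurable
  have "l2_mass n U (small_part n U 1) (\<lambda>_. 1) \<le>
      (\<integral>\<^sup>+ w. ennreal K * (indicator (small_part n U 1) w * ennreal (1 / (cmod (fst w))\<^sup>2)) \<partial>chart_space n U)"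
    unfolding l2_mass_def
  proof (rule nn_integral_mono)
    fix w
    show "indicator (small_part n U 1) w * ennreal (1\<^sup>2 * vol_density (An_chart1 n) w)
        \<le> ennreal K * (indicator (small_part n U 1) w * ennreal (1 / (cmod (fst w))\<^sup>2))"
    proof (cases "w \<in> small_part n U 1")
      case True
      then have "vol_density (An_chart1 n) w \<le> K * (1 / (cmod (fst w))\<^sup>2)"
        using vol_density_le[of w n] by (simp add: small_part_def An_dom1_def K_def)
      moreover have "K \<ge> 0" by (simp add: K_def)
      ultimately show ?thesis
        using True by (simp add: ennreal_leI ennreal_mult[symmetric])
    qed simp
  qed
  also have "\<dots> = ennreal K * residue_mass n U (small_part n U 1)"
    unfolding residue_mass_def by (rule nn_integral_cmult[OF m])
  also have "\<dots> < \<infinity>" using fin by (simp add: ennreal_mult_less_top)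
  finally show ?thesis .
qed

text \<open>As the volume near the origin is finite, \<open>L\<^sup>p\<close> is contained in \<open>L\<^sup>2\<close> there for \<open>p \<ge> 2\<close>.  A
  measurable minorant \<open>h\<close> takes the place of \<open>An_norm\<close>, a supremum over an uncountable set.\<close>

lemma Lp_form_l2_finite:
  assumes "open U" "p \<ge> 2" "Lp_form n U p r \<phi>"
    and h: "h \<in> borel_measurable (chart_space n U)"
    and hle: "\<And>w. w \<in> An_dom1 n U \<Longrightarrow> 0 \<le> h w \<and> h w \<le> An_norm n r \<phi> (An_chart1 n w)"
  shows "l2_mass n U (small_part n U 1) h < \<infinity>"
proof -
  let ?M = "chart_space n U"
  let ?S = "small_part n U 1"
  let ?V = "vol_density (An_chart1 n)"
  have V: "?V w \<ge> 0" if "w \<in> An_dom1 n U" for w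
    using vol_density_ge_1[of w n] fst_nonzero_An_dom1[OF that] by simp
  note [measurable] = h small_part_sets[OF assms(1), of n 1] vol_density_measurable[OF assms(1), of n]
  have vfin: "(\<integral>\<^sup>+ w. indicator ?S w * ennreal (?V w) \<partial>?M) < \<infinity>"
    using volume_small_part_finite[OF assms(1), of n] by (simp add: l2_mass_def)
  show ?thesis
  proof (cases "p = \<infinity>")
    case True
    then obtain C where "An_AE n U (\<lambda>z. An_norm n r \<phi> z \<le> C)"
      using assms(3) unfolding Lp_form_def by auto
    then have "AE w in lebesgue. w \<in> An_dom1 n U \<longrightarrow> An_norm n r \<phi> (An_chart1 n w) \<le> C"
      by (simp add: An_AE_def)
    then have "AE w in ?M. An_norm n r \<phi> (An_chart1 n w) \<le> C"
      by (subst AE_restrict_space_iff) (simp_all add: An_dom1_lebesgue[OF assms(1)])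
    then have "AE w in ?M. indicator ?S w * ennreal ((h w)\<^sup>2 * ?V w)
        \<le> ennreal (C\<^sup>2) * (indicator ?S w * ennreal (?V w))"
    proof (rule AE_mp, intro AE_I2 impI)
      fix w assume w: "w \<in> space ?M" and "An_norm n r \<phi> (An_chart1 n w) \<le> C"
      then have "0 \<le> h w" "h w \<le> C" using hle[of w] by auto
      then have "(h w)\<^sup>2 \<le> C\<^sup>2" by (simp add: power_mono)
      then have "(h w)\<^sup>2 * ?V w \<le> C\<^sup>2 * ?V w" using V w by (intro mult_right_mono) auto
      then show "indicator ?S w * ennreal ((h w)\<^sup>2 * ?V w) \<le> ennreal (C\<^sup>2) * (indicator ?S w * ennreal (?V w))"
        using V w by (auto simp: ennreal_mult[symmetric] ennreal_leI split: split_indicator)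
    qed
    then have "l2_mass n U ?S h \<le> (\<integral>\<^sup>+ w. ennreal (C\<^sup>2) * (indicator ?S w * ennreal (?V w)) \<partial>?M)"
      unfolding l2_mass_def by (rule nn_integral_mono_AE)
    also have "\<dots> = ennreal (C\<^sup>2) * (\<integral>\<^sup>+ w. indicator ?S w * ennreal (?V w) \<partial>?M)"
      by (rule nn_integral_cmult) measurable
    also have "\<dots> < \<infinity>" using vfin by (simp add: ennreal_mult_less_top)
    finally show ?thesis .
  next
    case False
    define t where "t = enn2real p"
    have pt: "p = ennreal t" using False by (simp add: t_def less_top)
    have t: "t \<ge> 2"
      using assms(2) unfolding pt by (metis ennreal_le_iff2 ennreal_numeral numeral_le_iff
          enn2real_nonneg t_def not_numeral_le_zero order_trans zero_le_numeral)
    have "An_nn_integral n U (\<lambda>z. ennreal (An_norm n r \<phi> z powr t)) < \<infinity>"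
      using assms(3) False unfolding Lp_form_def t_def by auto
    then have "(\<integral>\<^sup>+ w \<in> An_dom1 n U. ennreal (An_norm n r \<phi> (An_chart1 n w) powr t) * ennreal (?V w) \<partial>lebesgue) < \<infinity>"
      unfolding An_nn_integral_def by (simp add: less_top)
    then have pfin: "(\<integral>\<^sup>+ w. ennreal (An_norm n r \<phi> (An_chart1 n w) powr t) * ennreal (?V w) \<partial>?M) < \<infinity>"
      by (subst nn_integral_restrict_space) (simp_all add: An_dom1_lebesgue[OF assms(1)])
    have "l2_mass n U ?S h \<le> (\<integral>\<^sup>+ w. indicator ?S w * ennreal (?V w) + ennreal (h w powr t) * ennreal (?V w) \<partial>?M)"
      unfolding l2_mass_def
    proof (rule nn_integral_mono)
      fix w assume "w \<in> space ?M"
      then have w: "w \<in> An_dom1 n U" by simp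
      have "(h w)\<^sup>2 \<le> 1 + h w powr t"
      proof (cases "h w \<le> 1")
        case True
        then have "(h w)\<^sup>2 \<le> 1" using hle[OF w] by (simp add: power_le_one)
        then show ?thesis by (simp add: add_increasing2)
      next
        case False
        then have "(h w)\<^sup>2 = h w powr 2" by (simp add: powr_numeral)
        also have "\<dots> \<le> h w powr t" using False t by (intro powr_mono) auto
        finally show ?thesis by simp
      qed
      then have "(h w)\<^sup>2 * ?V w \<le> (1 + h w powr t) * ?V w"
        using V[OF w] by (rule mult_right_mono)
      then have "ennreal ((h w)\<^sup>2 * ?V w) \<le> ennreal (?V w) + ennreal (h w powr t) * ennreal (?V w)"
        using V[OF w] by (simp add: ennreal_mult[symmetric] ennreal_plus[symmetric] ring_distribs ennreal_leI del: ennreal_plus)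
      then show "indicator ?S w * ennreal ((h w)\<^sup>2 * ?V w) \<le> indicator ?S w * ennreal (?V w) + ennreal (h w powr t) * ennreal (?V w)"
        by (simp split: split_indicator)
    qed
    also have "\<dots> = (\<integral>\<^sup>+ w. indicator ?S w * ennreal (?V w) \<partial>?M) + (\<integral>\<^sup>+ w. ennreal (h w powr t) * ennreal (?V w) \<partial>?M)"
      by (rule nn_integral_add) measurable
    also have "\<dots> \<le> (\<integral>\<^sup>+ w. indicator ?S w * ennreal (?V w) \<partial>?M)
        + (\<integral>\<^sup>+ w. ennreal (An_norm n r \<phi> (An_chart1 n w) powr t) * ennreal (?V w) \<partial>?M)"
      using hle t by (intro add_left_mono nn_integral_mono mult_right_mono ennreal_leI powr_mono2) auto
    also have "\<dots> < \<infinity>" using vfin pfin by simp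
    finally show ?thesis .
  qed
qed

text \<open>The coefficient of \<open>\<omega> \<and> \<kappa> \<and> \<beta>\<close> in the chart, for (0,1)-forms with values \<open>k1, k2\<close> and \<open>b1, b2\<close>
  on the coordinate frame.\<close>

definition chart_pairing :: "complex \<times> complex \<Rightarrow> complex \<Rightarrow> complex \<Rightarrow> complex \<Rightarrow> complex \<Rightarrow> complex" where
  "chart_pairing w k1 k2 b1 b2 = 4 * (- (2 * of_real pi * \<i>) / fst w) * (k1 * b2 - k2 * b1)"

lemma chart_pairing_bound:
  assumes "fst w \<noteq> 0" "chart_norm n w k1 k2 \<le> M"
  shows "cmod (chart_pairing w k1 k2 b1 b2) \<le>
    16 * pi * M * (1 / cmod (fst w) * (sqrt (vol_density (An_chart1 n) w) * chart_norm n w b1 b2))"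
proof -
  have "An_e1 n w \<noteq> 0" by (simp add: An_e1_def vec_eq_iff forall_3)
  moreover have "vol_density (An_chart1 n) w > 0"
    using vol_density_ge_1[OF assms(1), of n] by simp
  ultimately have "cmod (k1 * b2 - k2 * b1) \<le> 2 * sqrt (vol_density (An_chart1 n) w)
      * chart_norm n w k1 k2 * chart_norm n w b1 b2"
    by (intro antilinear_pairing_bound vol_density_gram[OF assms(1), symmetric])
  also have "\<dots> \<le> 2 * sqrt (vol_density (An_chart1 n) w) * M * chart_norm n w b1 b2"
    using assms(2) \<open>vol_density (An_chart1 n) w > 0\<close>
    by (intro mult_right_mono mult_left_mono frame_norm_nonneg) auto
  finally have "4 * (2 * pi / cmod (fst w)) * cmod (k1 * b2 - k2 * b1) \<le> 4 * (2 * pi / cmod (fst w)) *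
      (2 * sqrt (vol_density (An_chart1 n) w) * M * chart_norm n w b1 b2)"
    by (rule mult_left_mono) simp
  moreover have "cmod (chart_pairing w k1 k2 b1 b2) = 4 * (2 * pi / cmod (fst w)) * cmod (k1 * b2 - k2 * b1)"
    unfolding chart_pairing_def by (simp add: norm_mult norm_divide)
  ultimately show ?thesis by (simp add: mult_ac)
qed

text \<open>The two factors are \<open>1 / \<bar>\<zeta>\<^sub>1\<bar>\<close>, which measures the structure form, and \<open>h\<close> times the square root of the
  volume density.\<close>

lemma cauchy_schwarz_chart:
  assumes "open U" "S \<in> sets (chart_space n U)" "h \<in> borel_measurable (chart_space n U)" "c \<ge> 0"
    and h0: "\<And>w. h w \<ge> 0"
    and G: "\<And>w. w \<in> An_dom1 n U \<Longrightarrow>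
      cmod (G w) \<le> c * indicator S w * (1 / cmod (fst w) * (sqrt (vol_density (An_chart1 n) w) * h w))"
  shows "(\<integral>\<^sup>+ w. ennreal (cmod (G w)) \<partial>chart_space n U)\<^sup>2 \<le> ennreal (c\<^sup>2) * residue_mass n U S * l2_mass n U S h"
proof -
  let ?M = "chart_space n U"
  let ?V = "vol_density (An_chart1 n)"
  define f where "f w = indicator S w * ennreal (1 / cmod (fst w))" for w
  define g where "g w = indicator S w * ennreal (sqrt (?V w) * h w)" for w
  note [measurable] = assms(2,3) vol_density_measurable[OF assms(1), of n] fst_measurable[OF assms(1), of n]
  have V: "?V w \<ge> 0" if "w \<in> An_dom1 n U" for w
    using vol_density_ge_1[of w n] fst_nonzero_An_dom1[OF that] by simp
  have fm [measurable]: "f \<in> borel_measurable ?M" unfolding f_def[abs_def] by measurable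
  have gm [measurable]: "g \<in> borel_measurable ?M" unfolding g_def[abs_def] by measurable
  have "(\<integral>\<^sup>+ w. ennreal (cmod (G w)) \<partial>?M) \<le> (\<integral>\<^sup>+ w. ennreal c * (f w * g w) \<partial>?M)"
  proof (rule nn_integral_mono)
    fix w assume "w \<in> space ?M"
    then have w: "w \<in> An_dom1 n U" by simp
    have "ennreal c * (f w * g w) = ennreal (c * indicator S w * (1 / cmod (fst w) * (sqrt (?V w) * h w)))"
      unfolding f_def g_def using V[OF w] h0[of w] assms(4)
      by (auto simp: ennreal_mult[symmetric] split: split_indicator)
    then show "ennreal (cmod (G w)) \<le> ennreal c * (f w * g w)"
      using G[OF w] by (simp add: ennreal_leI)
  qed
  also have "\<dots> = ennreal c * (\<integral>\<^sup>+ w. f w * g w \<partial>?M)" by (rule nn_integral_cmult) measurable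
  finally have "(\<integral>\<^sup>+ w. ennreal (cmod (G w)) \<partial>?M)\<^sup>2 \<le> (ennreal c * (\<integral>\<^sup>+ w. f w * g w \<partial>?M))\<^sup>2"
    by (simp add: power_mono)
  also have "\<dots> = ennreal (c\<^sup>2) * (\<integral>\<^sup>+ w. f w * g w \<partial>?M)\<^sup>2"
    using assms(4) by (simp add: power_mult_distrib ennreal_power)
  also have "\<dots> \<le> ennreal (c\<^sup>2) * ((\<integral>\<^sup>+ w. (f w)\<^sup>2 \<partial>?M) * (\<integral>\<^sup>+ w. (g w)\<^sup>2 \<partial>?M))"
    by (intro mult_left_mono Cauchy_Schwarz_nn_integral) auto
  also have "(\<integral>\<^sup>+ w. (f w)\<^sup>2 \<partial>?M) = residue_mass n U S"
    unfolding residue_mass_def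
    by (rule nn_integral_cong) (auto simp: f_def ennreal_power power_divide split: split_indicator)
  also have "(\<integral>\<^sup>+ w. (g w)\<^sup>2 \<partial>?M) = l2_mass n U S h"
    unfolding l2_mass_def
    by (rule nn_integral_cong)
      (use V h0 in \<open>auto simp: g_def ennreal_power power_mult_distrib mult.commute split: split_indicator\<close>)
  finally show ?thesis by (simp add: mult.assoc)
qed

lemma norm_integral_le_nn_integral:
  fixes f :: "'a \<Rightarrow> complex"
  shows "ennreal (norm (integral\<^sup>L M f)) \<le> (\<integral>\<^sup>+ x. ennreal (norm (f x)) \<partial>M)"
  by (cases "integrable M f") (auto simp: integral_norm_bound_ennreal not_integrable_integral_eq)

section \<open>Antilinear fields along the surface\<close>

definition antilinear :: "(complex ^ 'n::finite \<Rightarrow> complex) \<Rightarrow> bool" where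
  "antilinear A \<longleftrightarrow> (\<forall>c u v. A (c *s u + v) = cnj c * A u + A v)"

lemma antilinear_zero: "antilinear A \<Longrightarrow> A 0 = 0"
proof -
  assume "antilinear A"
  then have "A (1 *s 0 + 0) = cnj 1 * A 0 + A 0" unfolding antilinear_def by blast
  then show ?thesis by simp
qed

lemma antilinear_scale: "antilinear A \<Longrightarrow> A (c *s v) = cnj c * A v"
proof -
  assume a: "antilinear A"
  then have "A (c *s v + 0) = cnj c * A v + A 0" unfolding antilinear_def by blast
  then show ?thesis using antilinear_zero[OF a] by simp
qed

lemma antilinear_expand:
  fixes v :: "complex ^ 3"
  assumes "antilinear A"
  shows "A v = cnj (v $ 1) * A (axis 1 1) + cnj (v $ 2) * A (axis 2 1) + cnj (v $ 3) * A (axis 3 1)"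
proof -
  have "v = v $ 1 *s axis 1 1 + (v $ 2 *s axis 2 1 + (v $ 3 *s axis 3 1 + 0))"
    by (simp add: vec_eq_iff forall_3 axis_def)
  then have "A v = A (v $ 1 *s axis 1 1 + (v $ 2 *s axis 2 1 + (v $ 3 *s axis 3 1 + 0)))"
    by simp
  also have "\<dots> = cnj (v $ 1) * A (axis 1 1) + (cnj (v $ 2) * A (axis 2 1) + (cnj (v $ 3) * A (axis 3 1) + A 0))"
  proof -
    have "A (c *s x + y) = cnj c * A x + A y" for c x y
      using assms unfolding antilinear_def by blast
    then show ?thesis by (simp only:)
  qed
  finally show ?thesis using antilinear_zero[OF assms] by simp
qed

lemma antilinear_field_bounded:
  fixes F :: "complex ^ 3 \<Rightarrow> complex ^ 3 \<Rightarrow> complex"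
  assumes "\<And>z. z \<in> K \<Longrightarrow> antilinear (F z)" "\<And>v. continuous_on K (\<lambda>z. F z v)" "compact K"
  obtains C where "C \<ge> 0" "\<And>z v. z \<in> K \<Longrightarrow> cmod (F z v) \<le> C * norm v"
proof -
  have "\<exists>B. \<forall>z\<in>K. cmod (F z v) \<le> B" for v
  proof -
    have "bounded ((\<lambda>z. F z v) ` K)"
      by (rule compact_imp_bounded[OF compact_continuous_image[OF assms(2,3)]])
    then show ?thesis by (auto simp: bounded_iff)
  qed
  then obtain B where B: "\<And>v z. z \<in> K \<Longrightarrow> cmod (F z v) \<le> B v" by metis
  define C where "C = \<bar>B (axis 1 1)\<bar> + \<bar>B (axis 2 1)\<bar> + \<bar>B (axis 3 1)\<bar>"
  have "cmod (F z v) \<le> C * norm v" if z: "z \<in> K" for z v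
  proof -
    have "cmod (F z v) \<le> cmod (v $ 1) * cmod (F z (axis 1 1)) + cmod (v $ 2) * cmod (F z (axis 2 1))
        + cmod (v $ 3) * cmod (F z (axis 3 1))"
      unfolding antilinear_expand[OF assms(1)[OF z], of v]
      by (intro norm_triangle_le add_mono) (simp_all add: norm_mult)
    also have "\<dots> \<le> norm v * \<bar>B (axis 1 1)\<bar> + norm v * \<bar>B (axis 2 1)\<bar> + norm v * \<bar>B (axis 3 1)\<bar>"
      using B[OF z] by (intro add_mono mult_mono Finite_Cartesian_Product.norm_nth_le) (auto intro: order_trans[OF _ abs_ge_self])
    finally show ?thesis by (simp add: C_def algebra_simps)
  qed
  moreover have "C \<ge> 0" by (simp add: C_def)
  ultimately show ?thesis using that by blast
qed

lemma antilinear_field_measurable: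
  fixes F :: "complex ^ 3 \<Rightarrow> complex ^ 3 \<Rightarrow> complex"
  assumes U: "open U" and "\<And>z. z \<in> U \<Longrightarrow> antilinear (F z)" "\<And>v. continuous_on U (\<lambda>z. F z v)"
  shows "(\<lambda>w. F (An_chart1 n w) (An_e1 n w)) \<in> borel_measurable (chart_space n U)"
    and "(\<lambda>w. F (An_chart1 n w) (An_e2 n w)) \<in> borel_measurable (chart_space n U)"
proof -
  let ?D = "An_dom1 n U"
  have F: "continuous_on ?D (\<lambda>w. F (An_chart1 n w) v)" for v
    by (rule continuous_on_compose2[OF assms(3) continuous_on_An_chart1']) (auto simp: An_dom1_def)
  have e: "continuous_on ?D (\<lambda>w. An_e1 n w $ i)" "continuous_on ?D (\<lambda>w. An_e2 n w $ i)" for i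
  proof -
    consider "i = 1" | "i = 2" | "i = 3" using exhaust_3 by blast
    then have "continuous_on ?D (\<lambda>w. An_e1 n w $ i) \<and> continuous_on ?D (\<lambda>w. An_e2 n w $ i)"
      by cases (auto simp: An_e1_def An_e2_def An_dom1_def intro!: continuous_intros)
    then show "continuous_on ?D (\<lambda>w. An_e1 n w $ i)" "continuous_on ?D (\<lambda>w. An_e2 n w $ i)" by auto
  qed
  have *: "(\<lambda>w. F (An_chart1 n w) (e w)) \<in> borel_measurable (chart_space n U)"
    if "\<And>i. continuous_on ?D (\<lambda>w. e w $ i)" for e
  proof (rule chart_space_measurable[OF U])
    have "continuous_on ?D (\<lambda>w. cnj (e w $ 1) * F (An_chart1 n w) (axis 1 1)
        + cnj (e w $ 2) * F (An_chart1 n w) (axis 2 1) + cnj (e w $ 3) * F (An_chart1 n w) (axis 3 1))"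
      by (intro continuous_intros F that)
    then show "continuous_on ?D (\<lambda>w. F (An_chart1 n w) (e w))"
      by (rule continuous_on_cong[THEN iffD1, rotated 2])
        (use antilinear_expand assms(2) in \<open>auto simp: An_dom1_def\<close>)
  qed
  show "(\<lambda>w. F (An_chart1 n w) (An_e1 n w)) \<in> borel_measurable (chart_space n U)"
    "(\<lambda>w. F (An_chart1 n w) (An_e2 n w)) \<in> borel_measurable (chart_space n U)"
    by (intro * e)+
qed

lemma frame_norm_antilinear_le:
  assumes "antilinear A" "M \<ge> 0" "\<And>v. cmod (A v) \<le> M * norm v"
  shows "frame_norm u v (A u) (A v) \<le> M"
proof (rule frame_norm_le)
  show "A (c *s u + v) = cnj c * A u + A v" for c
    using assms(1) unfolding antilinear_def by blast
qed (use assms in auto)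

lemma antilinear_dbar_dir: "f differentiable (at z) \<Longrightarrow> antilinear (dbar_dir f z)"
  unfolding antilinear_def using dbar_dir_antilinear by blast

lemma smooth_on_differentiable: "smooth_on f U \<Longrightarrow> z \<in> U \<Longrightarrow> f differentiable (at z)"
  using smooth_on_has_derivative unfolding differentiable_def by blast

lemma continuous_on_dbar_dir: "smooth_on f U \<Longrightarrow> continuous_on U (\<lambda>z. dbar_dir f z v)"
  unfolding dbar_dir_def by (intro continuous_intros smooth_on_derivative_continuous) auto

lemma smooth_on_of_real: "open U \<Longrightarrow> smooth_on f U \<Longrightarrow> smooth_on (\<lambda>z. complex_of_real (f z)) U"
  by (rule smooth_on_linear_compose[OF _ bounded_linear_of_real])

text \<open>By the chain rule, \<open>dbar_dir\<close> on the frame sees only the restriction of a function to the surface.  Cut-off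
  functions are controlled there only.\<close>

lemma dbar_dir_frame_cong:
  assumes "smooth_on f U" "smooth_on g U" "open S" "S \<subseteq> An_dom1 n U" "w \<in> S"
    and eq: "\<And>w. w \<in> S \<Longrightarrow> f (An_chart1 n w) = g (An_chart1 n w)"
  shows "dbar_dir f (An_chart1 n w) (An_e1 n w) = dbar_dir g (An_chart1 n w) (An_e1 n w)"
    and "dbar_dir f (An_chart1 n w) (An_e2 n w) = dbar_dir g (An_chart1 n w) (An_e2 n w)"
proof -
  define z where "z = An_chart1 n w"
  have w: "fst w \<noteq> 0" "z \<in> U" using assms(4,5) by (auto simp: An_dom1_def z_def)
  let ?L = "\<lambda>u. fst u *s An_e1 n w + snd u *s An_e2 n w"
  have d: "((\<lambda>w. h (An_chart1 n w)) has_derivative (\<lambda>u. frechet_derivative h (at z) (?L u))) (at w)"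
    if "smooth_on h U" for h :: "complex ^ 3 \<Rightarrow> complex"
    using has_derivative_compose[OF An_chart1_has_derivative[OF w(1)], of h "frechet_derivative h (at z)"]
      smooth_on_has_derivative[OF that w(2)] unfolding z_def by simp
  have "((\<lambda>w. g (An_chart1 n w)) has_derivative (\<lambda>u. frechet_derivative f (at z) (?L u))) (at w)"
    by (rule has_derivative_transform_within_open[OF d[OF assms(1)] assms(3,5)]) (use eq in auto)
  then have "(\<lambda>u. frechet_derivative f (at z) (?L u)) = (\<lambda>u. frechet_derivative g (at z) (?L u))"
    using has_derivative_unique d[OF assms(2)] by blast
  then have E: "frechet_derivative f (at z) (?L u) = frechet_derivative g (at z) (?L u)" for u
    by (rule fun_cong)
  show "dbar_dir f (An_chart1 n w) (An_e1 n w) = dbar_dir g (An_chart1 n w) (An_e1 n w)"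
    using E[of "(1, 0)"] E[of "(\<i>, 0)"] by (simp add: dbar_dir_def z_def)
  show "dbar_dir f (An_chart1 n w) (An_e2 n w) = dbar_dir g (An_chart1 n w) (An_e2 n w)"
    using E[of "(0, 1)"] E[of "(0, \<i>)"] by (simp add: dbar_dir_def z_def)
qed

lemma dbar_dir_const: "dbar_dir (\<lambda>_. c) z v = 0"
  using dbar_dir_eq[OF has_derivative_const, of c z v] by simp

lemma dbar_function_form: "dbar (function_form \<kappa>) z [v] = dbar_dir (\<lambda>x. complex_of_real (\<kappa> x)) z v"
  by (simp add: dbar_def function_form_def)

lemma top_coeff_structure_form:
  assumes "n \<ge> 1" "is_structure_form n U \<omega>" "smooth_on \<kappa> U" "open U" "w \<in> An_dom1 n U"
    and "\<beta> (An_chart1 n w) [\<i> *s An_e1 n w] = - \<i> * on_e1 n \<beta> w"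
    and "\<beta> (An_chart1 n w) [\<i> *s An_e2 n w] = - \<i> * on_e2 n \<beta> w"
  shows "top_coeff (An_chart1 n) (wedge 2 \<omega> (wedge 1 (dbar (function_form \<kappa>)) \<beta>)) w =
    chart_pairing w (dbar_e1 n \<kappa> w)
      (dbar_e2 n \<kappa> w)
      (on_e1 n \<beta> w) (on_e2 n \<beta> w)"
proof -
  have w: "fst w \<noteq> 0" "An_chart1 n w \<in> U" using assms(5) by (auto simp: An_dom1_def)
  have "antilinear (dbar_dir (\<lambda>x. complex_of_real (\<kappa> x)) (An_chart1 n w))"
    by (rule antilinear_dbar_dir[OF smooth_on_differentiable[OF smooth_on_of_real[OF assms(4,3)] w(2)]])
  then show ?thesis
    unfolding top_coeff_An_chart1[OF w(1)]
    by (subst wedge_structure_form[OF assms(1,2) An_chart1_reg[OF assms(5)] An_frame_tangent[OF w(1)]])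
      (simp_all add: assms(6,7) dbar_function_form antilinear_scale chart_pairing_def
        residue_form_An_chart1[OF assms(1) w(1)])
qed

section \<open>Integrals against radial cut-off functions\<close>

abbreviation complex_cutoff :: "real \<Rightarrow> complex ^ 'n::finite \<Rightarrow> complex" where
  "complex_cutoff \<mu> \<equiv> (\<lambda>z. complex_of_real (radial_cutoff \<mu> z))"

lemma smooth_complex_cutoff: "open S \<Longrightarrow> smooth_on (complex_cutoff \<mu>) S"
  by (rule smooth_on_of_real[OF _ smooth_radial_cutoff])

lemma dbar_dir_cong_const:
  assumes "open S" "z \<in> S" "\<And>x. x \<in> S \<Longrightarrow> f x = c"
  shows "dbar_dir f z v = 0"
proof -
  have "(f has_derivative (\<lambda>_. 0)) (at z)"
    by (rule has_derivative_transform_within_open[OF has_derivative_const[of c] assms(1,2)])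
      (use assms(3) in auto)
  from dbar_dir_eq[OF this, of v] show ?thesis by simp
qed

lemma complex_cutoff_dbar_scale:
  assumes "\<mu> > 0"
  shows "dbar_dir (complex_cutoff \<mu>) z v = of_real \<mu> * dbar_dir (complex_cutoff 1) (\<mu> *\<^sub>R z) v"
proof -
  define L where "L = frechet_derivative (complex_cutoff 1) (at (\<mu> *\<^sub>R z))"
  have L: "(complex_cutoff 1 has_derivative L) (at (\<mu> *\<^sub>R z))"
    unfolding L_def by (rule smooth_on_has_derivative[OF smooth_complex_cutoff[OF open_UNIV]]) simp
  then interpret L: linear L using has_derivative_linear by blast
  have "((\<lambda>z. \<mu> *\<^sub>R z) has_derivative (\<lambda>v. \<mu> *\<^sub>R v)) (at z)"
    by (intro derivative_intros)
  from has_derivative_compose[OF this L]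
  have "((\<lambda>z. complex_cutoff 1 (\<mu> *\<^sub>R z)) has_derivative (\<lambda>v. L (\<mu> *\<^sub>R v))) (at z)" .
  then have "(complex_cutoff \<mu> has_derivative (\<lambda>v. L (\<mu> *\<^sub>R v))) (at z)"
    by (simp add: radial_cutoff_scale[of \<mu>])
  from dbar_dir_eq[OF this] show ?thesis
    unfolding dbar_dir_eq[OF L] L.scale by (simp add: scaleR_conv_of_real algebra_simps add_divide_distrib)
qed

text \<open>By scaling it suffices to bound the gradient for \<open>\<mu> = 1\<close>, where it is continuous with bounded
  support.\<close>

lemma complex_cutoff_dbar_bound:
  obtains C where "C > 0"
    "\<And>\<mu> z v. \<mu> > 0 \<Longrightarrow> cmod (dbar_dir (complex_cutoff \<mu>) z v) \<le> C * \<mu> * norm (v :: complex ^ 3)"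
    "\<And>\<mu> z v. \<mu> > 0 \<Longrightarrow> \<not> (1 / (2 * \<mu>) < norm z \<and> norm z \<le> 1 / \<mu>) \<Longrightarrow>
       dbar_dir (complex_cutoff \<mu>) z (v :: complex ^ 3) = 0"
proof -
  have sm: "smooth_on (complex_cutoff 1 :: complex ^ 3 \<Rightarrow> complex) UNIV" by (rule smooth_complex_cutoff) simp
  obtain C where C: "C \<ge> 0" "\<And>z v. z \<in> cball 0 1 \<Longrightarrow> cmod (dbar_dir (complex_cutoff 1) z v) \<le> C * norm (v :: complex ^ 3)"
  proof (rule antilinear_field_bounded[of "cball 0 1" "dbar_dir (complex_cutoff 1)"])
    show "continuous_on (cball 0 1) (\<lambda>z. dbar_dir (complex_cutoff 1) z (v :: complex ^ 3))" for v
      by (rule continuous_on_subset[OF continuous_on_dbar_dir[OF sm]]) simp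
    show "antilinear (dbar_dir (complex_cutoff 1) z)" for z :: "complex ^ 3"
      by (rule antilinear_dbar_dir[OF smooth_on_differentiable[OF sm]]) simp
  qed auto
  have zero: "dbar_dir (complex_cutoff 1) z v = 0" if "\<not> (1 / 2 < norm z \<and> norm z \<le> 1)" for z v :: "complex ^ 3"
  proof -
    consider "norm z \<le> 1 / 2" | "norm z > 1" using \<open>\<not> _\<close> by linarith
    then show ?thesis
    proof cases
      case 1
      then have "(norm z)\<^sup>2 \<le> (1 / 2)\<^sup>2" by (intro power_mono) auto
      then have "z \<in> {x. x \<bullet> x < 1 / 3}" by (simp add: power2_norm_eq_inner power_one_over)
      moreover have "open {x :: complex ^ 3. x \<bullet> x < 1 / 3}" by (intro open_Collect_less continuous_intros)
      ultimately show ?thesis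
        by (intro dbar_dir_cong_const[of _ z _ 1]) (auto intro!: radial_cutoff_eq_1)
    next
      case 2
      have "open {x :: complex ^ 3. 1 < norm x}" by (intro open_Collect_less continuous_intros)
      with 2 show ?thesis
        by (intro dbar_dir_cong_const[of "{x. 1 < norm x}" z _ 0]) (auto intro!: radial_cutoff_far)
    qed
  qed
  have b1: "cmod (dbar_dir (complex_cutoff 1) z v) \<le> (C + 1) * norm v" for z v :: "complex ^ 3"
  proof (cases "norm z \<le> 1")
    case True
    then have "cmod (dbar_dir (complex_cutoff 1) z v) \<le> C * norm v" using C(2) by simp
    then show ?thesis by (simp add: distrib_right add_increasing2)
  next
    case False
    then show ?thesis using zero[of z v] C(1) by simp
  qed
  show ?thesis
  proof (rule that[of "C + 1"])
    show "cmod (dbar_dir (complex_cutoff \<mu>) z v) \<le> (C + 1) * \<mu> * norm v" if "\<mu> > 0" for \<mu> and z v :: "complex ^ 3"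
      unfolding complex_cutoff_dbar_scale[OF that]
      using mult_left_mono[OF b1[of "\<mu> *\<^sub>R z" v], of \<mu>] that by (simp add: norm_mult mult_ac)
    show "dbar_dir (complex_cutoff \<mu>) z v = 0" if "\<mu> > 0" "\<not> (1 / (2 * \<mu>) < norm z \<and> norm z \<le> 1 / \<mu>)"
      for \<mu> and z v :: "complex ^ 3"
      unfolding complex_cutoff_dbar_scale[OF that(1)] using that
      by (subst zero) (auto simp: field_simps)
  qed (use C in simp)
qed

lemma chart_pairing_mass_bound:
  assumes "open U" "S \<in> sets (chart_space n U)" "M \<ge> 0"
    and b: "b1 \<in> borel_measurable (chart_space n U)" "b2 \<in> borel_measurable (chart_space n U)"
    and kS: "\<And>w. w \<in> An_dom1 n U \<Longrightarrow> w \<in> S \<Longrightarrow> chart_norm n w (k1 w) (k2 w) \<le> M"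
    and k0: "\<And>w. w \<in> An_dom1 n U \<Longrightarrow> w \<notin> S \<Longrightarrow> k1 w = 0 \<and> k2 w = 0"
  shows "(\<integral>\<^sup>+ w. ennreal (cmod (chart_pairing w (k1 w) (k2 w) (b1 w) (b2 w))) \<partial>chart_space n U)\<^sup>2
    \<le> ennreal ((16 * pi * M)\<^sup>2) * residue_mass n U S
      * pair_mass n U S b1 b2"
proof (rule cauchy_schwarz_chart[OF assms(1,2) frame_norm_measurable[OF assms(1) b]])
  show "0 \<le> 16 * pi * M" using assms(3) by simp
  show "cmod (chart_pairing w (k1 w) (k2 w) (b1 w) (b2 w)) \<le> 16 * pi * M * indicator S w *
      (1 / cmod (fst w) * (sqrt (vol_density (An_chart1 n) w) * chart_norm n w (b1 w) (b2 w)))"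
    if "w \<in> An_dom1 n U" for w
    using chart_pairing_bound[OF fst_nonzero_An_dom1[OF that] kS[OF that]] k0[OF that]
    by (cases "w \<in> S") (auto simp: chart_pairing_def)
qed (simp add: frame_norm_nonneg)

lemma chart_pairing_measurable:
  assumes "open U" and [measurable]: "k1 \<in> borel_measurable (chart_space n U)" "k2 \<in> borel_measurable (chart_space n U)"
    "b1 \<in> borel_measurable (chart_space n U)" "b2 \<in> borel_measurable (chart_space n U)"
  shows "(\<lambda>w. chart_pairing w (k1 w) (k2 w) (b1 w) (b2 w)) \<in> borel_measurable (chart_space n U)"
proof -
  have [measurable]: "(\<lambda>w. - (2 * of_real pi * \<i>) / fst w) \<in> borel_measurable (chart_space n U)"
    by (intro chart_space_measurable[OF assms(1)] continuous_intros) (auto simp: An_dom1_def)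
  show ?thesis unfolding chart_pairing_def by measurable
qed

lemma chart_pairing_integrable:
  assumes "open U" "0 < d" "d \<le> 1" "M \<ge> 0"
    and k: "k1 \<in> borel_measurable (chart_space n U)" "k2 \<in> borel_measurable (chart_space n U)"
    and b: "b1 \<in> borel_measurable (chart_space n U)" "b2 \<in> borel_measurable (chart_space n U)"
    and fin: "pair_mass n U (small_part n U d) b1 b2 < \<infinity>"
    and kS: "\<And>w. w \<in> small_part n U d \<Longrightarrow> chart_norm n w (k1 w) (k2 w) \<le> M"
    and k0: "\<And>w. w \<in> An_dom1 n U \<Longrightarrow> w \<notin> small_part n U d \<Longrightarrow> k1 w = 0 \<and> k2 w = 0"
  shows "integrable (chart_space n U) (\<lambda>w. chart_pairing w (k1 w) (k2 w) (b1 w) (b2 w))"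
proof (rule integrableI_bounded[OF chart_pairing_measurable[OF assms(1) k b]])
  obtain C :: real where C: "\<And>j. residue_mass n U (small_part n U (1 / 2 ^ j)) \<le> ennreal (C * (real j + 1) / 4 ^ j)"
    using residue_mass_small_part[OF assms(1)] by blast
  have "small_part n U d \<subseteq> small_part n U (1 / 2 ^ 0)" using assms(3) by (auto simp: small_part_def)
  then have "residue_mass n U (small_part n U d) < \<infinity>"
    by (intro order_le_less_trans[OF order_trans[OF residue_mass_mono C[of 0]]]) auto
  then have "ennreal ((16 * pi * M)\<^sup>2) * residue_mass n U (small_part n U d)
      * pair_mass n U (small_part n U d) b1 b2 < \<infinity>"
    using fin by (simp add: ennreal_mult_less_top)
  moreover note chart_pairing_mass_bound[OF assms(1) small_part_sets[OF assms(1)] assms(4) b kS k0]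
  ultimately have "(\<integral>\<^sup>+ w. ennreal (cmod (chart_pairing w (k1 w) (k2 w) (b1 w) (b2 w))) \<partial>chart_space n U)\<^sup>2 < \<infinity>"
    by (rule order_le_less_trans[rotated])
  then show "(\<integral>\<^sup>+ w. ennreal (norm (chart_pairing w (k1 w) (k2 w) (b1 w) (b2 w))) \<partial>chart_space n U) < \<infinity>"
    by (auto simp: power_less_top_ennreal)
qed

definition cutoff_integral ::
    "nat \<Rightarrow> (complex ^ 3) set \<Rightarrow> (complex \<times> complex \<Rightarrow> complex) \<Rightarrow> (complex \<times> complex \<Rightarrow> complex) \<Rightarrow> real \<Rightarrow> complex" where
  "cutoff_integral n U b1 b2 \<mu> = (LINT w|chart_space n U.
     chart_pairing w (dbar_e1 n (radial_cutoff \<mu>) w)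
       (dbar_e2 n (radial_cutoff \<mu>) w) (b1 w) (b2 w))"

lemma not_eventually_harmonic:
  fixes a :: "nat \<Rightarrow> real"
  assumes "summable a" "\<epsilon> > 0"
  obtains j where "j \<ge> J" "(real j + 1) * a j < \<epsilon>"
proof -
  have "\<not> (\<forall>j \<ge> J. \<epsilon> \<le> (real j + 1) * a j)"
  proof
    assume h: "\<forall>j \<ge> J. \<epsilon> \<le> (real j + 1) * a j"
    have "summable (\<lambda>j. \<epsilon> * inverse (real (Suc j)))"
    proof (rule summable_comparison_test'[OF assms(1)])
      fix j assume "j \<ge> J"
      then have "\<epsilon> \<le> (real j + 1) * a j" using h by blast
      then have "\<epsilon> / (real j + 1) \<le> a j" by (simp add: pos_divide_le_eq mult.commute)
      then show "norm (\<epsilon> * inverse (real (Suc j))) \<le> a j"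
        using assms(2) by (simp add: divide_inverse add.commute)
    qed
    then have "summable (\<lambda>j. inverse (real (Suc j)))"
      using summable_mult_D assms(2) by fastforce
    then have "summable (\<lambda>j. inverse (real j))" by (subst (asm) summable_Suc_iff)
    then show False using not_summable_harmonic[where 'a = real] by simp
  qed
  then show ?thesis using that by force
qed

text \<open>With \<open>a j\<close> the square integral of \<open>b\<close> over the shell at scale \<open>2\<^sup>-\<^sup>j\<close>, where the gradient of
  the cut-off function is of size \<open>2\<^sup>j\<close> and the structure form has squared mass of order
  \<open>4\<^sup>-\<^sup>j (j + 1)\<close>, the squared integral is at most a constant times \<open>(j + 1) * a j\<close>. The shells are
  disjoint, so \<open>a\<close> is summable; as the harmonic series diverges, \<open>(j + 1) * a j\<close> cannot stay away
  from zero.\<close>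

lemma cutoff_integral_small:
  assumes "open U" "d > 0" "\<epsilon> > 0"
    and b: "b1 \<in> borel_measurable (chart_space n U)" "b2 \<in> borel_measurable (chart_space n U)"
    and fin: "pair_mass n U (small_part n U d) b1 b2 < \<infinity>"
  obtains j where "j \<ge> J" "cmod (cutoff_integral n U b1 b2 (2 ^ j)) < \<epsilon>"
proof -
  let ?M = "chart_space n U"
  define h where "h w = chart_norm n w (b1 w) (b2 w)" for w
  have hm: "h \<in> borel_measurable ?M" unfolding h_def[abs_def] by (rule frame_norm_measurable[OF assms(1) b])
  define shell where "shell j = small_part n U (1 / 2 ^ j) - small_part n U (1 / 2 ^ Suc j)" for j
  have sh: "shell j \<in> sets ?M" for j unfolding shell_def by (intro sets.Diff small_part_sets assms(1))
  obtain j0 where j0: "1 / 2 ^ j0 < d"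
    using real_arch_pow_inv[of d "1/2"] assms(2) by (auto simp: power_one_over)
  have sub: "shell j \<subseteq> small_part n U d" if "j \<ge> j0" for j
  proof -
    have "(1 :: real) / 2 ^ j \<le> 1 / 2 ^ j0" using that by (intro divide_left_mono power_increasing) auto
    then show ?thesis using j0 by (auto simp: shell_def small_part_def)
  qed
  have disj: "w \<notin> shell k" if "w \<in> shell j" "j < k" for w j k
  proof -
    have "(1 :: real) / 2 ^ k \<le> 1 / 2 ^ Suc j" using that(2) by (intro divide_left_mono power_increasing) auto
    then show ?thesis using that(1) by (auto simp: shell_def small_part_def)
  qed
  define a where "a j = l2_mass n U (shell j) h" for j
  have fin': "l2_mass n U (small_part n U d) h < \<infinity>" using fin by (simp add: h_def[abs_def])
  have afin: "a j < \<infinity>" if "j \<ge> j0" for j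
    using l2_mass_mono[OF sub[OF that], of n U h] fin' by (simp add: a_def order_le_less_trans)
  have "(\<Sum>m. a (m + j0)) \<le> l2_mass n U (small_part n U d) h"
  proof -
    let ?f = "\<lambda>w. ennreal ((h w)\<^sup>2 * vol_density (An_chart1 n) w)"
    note [measurable] = hm sh vol_density_measurable[OF assms(1), of n]
    have "(\<Sum>m. a (m + j0)) = (\<integral>\<^sup>+ w. (\<Sum>m. indicator (shell (m + j0)) w * ?f w) \<partial>?M)"
      unfolding a_def l2_mass_def by (rule nn_integral_suminf[symmetric]) measurable
    also have "\<dots> \<le> (\<integral>\<^sup>+ w. indicator (small_part n U d) w * ?f w \<partial>?M)"
    proof (rule nn_integral_mono)
      fix w
      have df: "disjoint_family (\<lambda>m. shell (m + j0))"
        unfolding disjoint_family_on_def using disj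
        by (metis (no_types, lifting) add_less_cancel_right disjoint_iff nat_neq_iff)
      have "(\<Sum>m. indicator (shell (m + j0)) w * ?f w) = (\<Sum>m. indicator (shell (m + j0)) w) * ?f w"
        by (rule ennreal_suminf_multc)
      also have "(\<Sum>m. indicator (shell (m + j0)) w :: ennreal) = indicator (\<Union>m. shell (m + j0)) w"
        by (rule suminf_indicator[OF df])
      also have "indicator (\<Union>m. shell (m + j0)) w * ?f w \<le> indicator (small_part n U d) w * ?f w"
      proof -
        have "(\<Union>m. shell (m + j0)) \<subseteq> small_part n U d" by (rule UN_least) (rule sub, simp)
        then show ?thesis by (intro mult_right_mono) (auto split: split_indicator)
      qed
      finally show "(\<Sum>m. indicator (shell (m + j0)) w * ?f w) \<le> indicator (small_part n U d) w * ?f w" .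
    qed
    finally show ?thesis by (simp add: l2_mass_def)
  qed
  then have sumfin: "(\<Sum>m. a (m + j0)) \<noteq> \<infinity>" using fin' by (auto simp: less_top)
  define A where "A j = enn2real (a j)" for j
  have aA: "a j = ennreal (A j)" if "j \<ge> j0" for j
    using afin[OF that] by (simp add: A_def less_top)
  have "summable (\<lambda>m. A (m + j0))"
  proof (rule summable_suminf_not_top)
    show "(\<Sum>m. ennreal (A (m + j0))) \<noteq> top" using sumfin by (simp flip: aA)
  qed (simp add: A_def)
  then have sA: "summable A" by simp
  obtain C1 where C1: "C1 > 0"
    "\<And>\<mu> z v. \<mu> > 0 \<Longrightarrow> cmod (dbar_dir (complex_cutoff \<mu>) z v) \<le> C1 * \<mu> * norm (v :: complex ^ 3)"
    "\<And>\<mu> z v. \<mu> > 0 \<Longrightarrow> \<not> (1 / (2 * \<mu>) < norm z \<and> norm z \<le> 1 / \<mu>) \<Longrightarrow>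
       dbar_dir (complex_cutoff \<mu>) z (v :: complex ^ 3) = 0"
    using complex_cutoff_dbar_bound by blast
  obtain C2 where C2: "C2 > 0"
    "\<And>j. residue_mass n U (small_part n U (1 / 2 ^ j)) \<le> ennreal (C2 * (real j + 1) / 4 ^ j)"
    using residue_mass_small_part[OF assms(1)] by blast
  define K where "K = (16 * pi * C1)\<^sup>2 * C2"
  have K: "K > 0" using C1(1) C2(1) by (simp add: K_def)
  have main: "(cmod (cutoff_integral n U b1 b2 (2 ^ j)))\<^sup>2 \<le> K * ((real j + 1) * A j)" if j: "j \<ge> j0" for j
  proof -
    let ?k1 = "\<lambda>w. dbar_e1 n (radial_cutoff (2 ^ j)) w"
    let ?k2 = "\<lambda>w. dbar_e2 n (radial_cutoff (2 ^ j)) w"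
    have al: "antilinear (dbar_dir (complex_cutoff (2 ^ j)) z)" for z :: "complex ^ 3"
      by (rule antilinear_dbar_dir[OF smooth_on_differentiable[OF smooth_complex_cutoff[OF open_UNIV]]]) simp
    have "(ennreal (cmod (cutoff_integral n U b1 b2 (2 ^ j))))\<^sup>2
        \<le> (\<integral>\<^sup>+ w. ennreal (cmod (chart_pairing w (?k1 w) (?k2 w) (b1 w) (b2 w))) \<partial>?M)\<^sup>2"
      unfolding cutoff_integral_def by (intro power_mono norm_integral_le_nn_integral) simp
    also have "\<dots> \<le> ennreal ((16 * pi * (C1 * 2 ^ j))\<^sup>2) * residue_mass n U (shell j)
        * pair_mass n U (shell j) b1 b2"
    proof (rule chart_pairing_mass_bound[OF assms(1) sh _ b])
      show "0 \<le> C1 * 2 ^ j" using C1 by simp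
      show "chart_norm n w (?k1 w) (?k2 w) \<le> C1 * 2 ^ j" for w
        by (rule frame_norm_antilinear_le[OF al]) (use C1 in auto)
      show "?k1 w = 0 \<and> ?k2 w = 0" if "w \<in> An_dom1 n U" "w \<notin> shell j" for w
        using C1(3)[of "2 ^ j" "An_chart1 n w"] that by (auto simp: shell_def small_part_def)
    qed
    also have "\<dots> \<le> ennreal ((16 * pi * (C1 * 2 ^ j))\<^sup>2) * ennreal (C2 * (real j + 1) / 4 ^ j) * ennreal (A j)"
    proof -
      have "residue_mass n U (shell j) \<le> ennreal (C2 * (real j + 1) / 4 ^ j)"
        by (rule order_trans[OF residue_mass_mono C2(2)]) (auto simp: shell_def)
      moreover have "pair_mass n U (shell j) b1 b2 = ennreal (A j)"
        using aA[OF j] by (simp add: a_def h_def[abs_def])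
      ultimately show ?thesis by (simp add: mult_left_mono mult_right_mono)
    qed
    also have "\<dots> = ennreal ((16 * pi * (C1 * 2 ^ j))\<^sup>2 * (C2 * (real j + 1) / 4 ^ j) * A j)"
      using C2(1) by (simp add: ennreal_mult[symmetric] A_def)
    also have "(16 * pi * (C1 * 2 ^ j))\<^sup>2 * (C2 * (real j + 1) / 4 ^ j) * A j = K * ((real j + 1) * A j)"
    proof -
      have "(2 ^ j)\<^sup>2 = (4 :: real) ^ j" by (simp add: power2_eq_square flip: power_mult_distrib)
      then show ?thesis by (simp add: K_def power_mult_distrib)
    qed
    finally show ?thesis
      using K by (simp add: ennreal_power A_def)
  qed
  obtain j where j: "j \<ge> max J j0" "(real j + 1) * A j < \<epsilon>\<^sup>2 / K"
    using not_eventually_harmonic[OF sA, of "\<epsilon>\<^sup>2 / K" "max J j0"] assms(3) K by auto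
  have "(cmod (cutoff_integral n U b1 b2 (2 ^ j)))\<^sup>2 < \<epsilon>\<^sup>2"
    using main[of j] j K by (simp add: field_simps)
  then have "cmod (cutoff_integral n U b1 b2 (2 ^ j)) < \<epsilon>"
    using assms(3) by (auto intro: power_less_imp_less_base)
  then show ?thesis using that j(1) by auto
qed

section \<open>The boundary condition\<close>

text \<open>What is used of a (0,1)-form in \<open>L\<^sup>p\<close>: its values on the frame are measurable, square integrable near the origin
  and antilinear.\<close>

lemma Lp_1_form_chart:
  assumes "open U" "p \<ge> 2" "Lp_form n U p 1 \<phi>"
  shows "(\<lambda>w. on_e1 n \<phi> w) \<in> borel_measurable (chart_space n U)"
    and "(\<lambda>w. on_e2 n \<phi> w) \<in> borel_measurable (chart_space n U)"
    and "pair_mass n U (small_part n U 1) (on_e1 n \<phi>) (on_e2 n \<phi>) < \<infinity>"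
    and "\<And>w. w \<in> An_dom1 n U \<Longrightarrow> \<phi> (An_chart1 n w) [\<i> *s An_e1 n w] = - \<i> * on_e1 n \<phi> w"
    and "\<And>w. w \<in> An_dom1 n U \<Longrightarrow> \<phi> (An_chart1 n w) [\<i> *s An_e2 n w] = - \<i> * on_e2 n \<phi> w"
proof -
  have A: "is_An_form n U 1 \<phi>" using assms(3) by (simp add: Lp_form_def)
  have pb: "(\<lambda>w. pullback (An_chart1 n) \<phi> w us) \<in> borel_measurable (chart_space n U)" if "length us = 1" for us
    using A that unfolding is_An_form_def by blast
  show m1: "(\<lambda>w. on_e1 n \<phi> w) \<in> borel_measurable (chart_space n U)"
    by (rule measurable_cong[THEN iffD1, OF _ pb[of "[(1, 0)]"]])
      (auto simp: pullback_An_chart1 fst_nonzero_An_dom1)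
  show m2: "(\<lambda>w. on_e2 n \<phi> w) \<in> borel_measurable (chart_space n U)"
    by (rule measurable_cong[THEN iffD1, OF _ pb[of "[(0, 1)]"]])
      (auto simp: pullback_An_chart1 fst_nonzero_An_dom1)
  have cov: "is_covector (An_tangent n (An_chart1 n w)) 0 1 (\<phi> (An_chart1 n w))" if "w \<in> An_dom1 n U" for w
    using A An_chart1_reg[OF that] unfolding is_An_form_def by blast
  note T = An_frame_tangent[OF fst_nonzero_An_dom1]
  show "\<phi> (An_chart1 n w) [\<i> *s An_e1 n w] = - \<i> * on_e1 n \<phi> w"
    "\<phi> (An_chart1 n w) [\<i> *s An_e2 n w] = - \<i> * on_e2 n \<phi> w" if "w \<in> An_dom1 n U" for w
    using covector_1_scale[OF cov[OF that] T(1)[OF that], of \<i>] covector_1_scale[OF cov[OF that] T(2)[OF that], of \<i>]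
    by simp_all
  show "pair_mass n U (small_part n U 1) (on_e1 n \<phi>) (on_e2 n \<phi>) < \<infinity>"
  proof (rule Lp_form_l2_finite[OF assms frame_norm_measurable[OF assms(1) m1 m2]], intro conjI frame_norm_nonneg)
    fix w assume w: "w \<in> An_dom1 n U"
    define z where "z = An_chart1 n w"
    have t: "An_e1 n w \<in> An_tangent n z" "An_e2 n w \<in> An_tangent n z" using T[OF w] by (simp_all add: z_def)
    have le: "cmod (\<phi> z [v]) \<le> An_norm n 1 \<phi> z * norm v" if "v \<in> An_tangent n z" for v
      using An_norm_ge[of w n \<phi> v] that cov[OF w] fst_nonzero_An_dom1[OF w] by (simp add: z_def)
    have "An_e1 n w \<noteq> 0" by (simp add: An_e1_def vec_eq_iff forall_3)
    moreover have "0 \<le> An_norm n 1 \<phi> z * norm (An_e1 n w)"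
      using le[OF t(1)] norm_ge_zero order_trans by blast
    ultimately have M: "0 \<le> An_norm n 1 \<phi> z" by (simp add: zero_le_mult_iff)
    show "chart_norm n w (on_e1 n \<phi> w) (on_e2 n \<phi> w)
        \<le> An_norm n 1 \<phi> (An_chart1 n w)"
      unfolding z_def[symmetric]
    proof (rule frame_norm_le[where A = "\<lambda>v. \<phi> z [v]"])
      have c: "is_covector (An_tangent n z) 0 1 (\<phi> z)" using cov[OF w] by (simp add: z_def)
      show "\<phi> z [c *s An_e1 n w + An_e2 n w] = cnj c * \<phi> z [An_e1 n w] + \<phi> z [An_e2 n w]" for c
        by (rule covector_1_antilinear[OF c t(1) An_tangent_scale[OF t(1)] t(2)])
      show "cmod (\<phi> z [c *s An_e1 n w + An_e2 n w]) \<le> An_norm n 1 \<phi> z * norm (c *s An_e1 n w + An_e2 n w)" for c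
        by (intro le An_tangent_add An_tangent_scale t)
    qed (use M le t in auto)
  qed
qed

lemma Lp_0_form_chart:
  assumes "open U" "p \<ge> 2" "Lp_form n U p 0 \<phi>"
  shows "(\<lambda>w. \<phi> (An_chart1 n w) []) \<in> borel_measurable (chart_space n U)"
    and "l2_mass n U (small_part n U 1) (\<lambda>w. cmod (\<phi> (An_chart1 n w) [])) < \<infinity>"
proof -
  have "is_An_form n U 0 \<phi>" using assms(3) by (simp add: Lp_form_def)
  then have "(\<lambda>w. pullback (An_chart1 n) \<phi> w []) \<in> borel_measurable (chart_space n U)"
    unfolding is_An_form_def by blast
  then show m: "(\<lambda>w. \<phi> (An_chart1 n w) []) \<in> borel_measurable (chart_space n U)"
    by (simp add: pullback_def)
  have "{vs. length vs = 0 \<and> (\<forall>v\<in>set vs. v \<in> An_tangent n z \<and> norm v \<le> 1)} = {[]}" for z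
    by auto
  then have "An_norm n 0 \<phi> z = cmod (\<phi> z [])" for z
    unfolding An_norm_def by simp
  then show "l2_mass n U (small_part n U 1) (\<lambda>w. cmod (\<phi> (An_chart1 n w) [])) < \<infinity>"
    using m by (intro Lp_form_l2_finite[OF assms]) auto
qed

lemma cutoff_sequence_radial:
  assumes "\<And>k. m k \<ge> k"
  shows "cutoff_sequence n U (\<lambda>k. radial_cutoff (2 ^ m k))"
  unfolding cutoff_sequence_def
proof (intro conjI allI ballI impI)
  fix k
  show "\<exists>V. open V \<and> 0 \<in> V \<and> (\<forall>z\<in>V \<inter> An n U. radial_cutoff (2 ^ m k) z = 1)"
    by (rule exI[of _ "ball 0 (1 / (2 * 2 ^ m k))"]) (auto intro!: radial_cutoff_near)
next
  fix \<epsilon> :: real assume "\<epsilon> > 0"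
  then obtain j where j: "1 / 2 ^ j < \<epsilon>"
    using real_arch_pow_inv[of \<epsilon> "1/2"] by (auto simp: power_one_over)
  show "\<forall>\<^sub>F k in sequentially. \<forall>z\<in>An n U. radial_cutoff (2 ^ m k) z \<noteq> 0 \<longrightarrow> norm z < \<epsilon>"
  proof (rule eventually_sequentiallyI[of j], intro ballI impI)
    fix k z assume k: "k \<ge> j" and nz: "radial_cutoff (2 ^ m k) z \<noteq> 0"
    have "(1 :: real) / 2 ^ m k \<le> 1 / 2 ^ j"
      using assms[of k] k by (intro divide_left_mono power_increasing) auto
    moreover have "norm z < 1 / 2 ^ m k" using radial_cutoff_far[of "2 ^ m k" z] nz by fastforce
    ultimately show "norm z < \<epsilon>" using j by simp
  qed
qed (auto intro: smooth_radial_cutoff radial_cutoff_bounds)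

lemma chart_pairing_cutoff_integrable:
  assumes "open U" "0 < d" "d \<le> 1" "cball 0 d \<subseteq> U" "smooth_on \<kappa> U"
    and supp: "\<And>z. z \<in> An n U \<Longrightarrow> \<kappa> z \<noteq> 0 \<Longrightarrow> norm z \<le> d"
    and b: "b1 \<in> borel_measurable (chart_space n U)" "b2 \<in> borel_measurable (chart_space n U)"
    and fin: "pair_mass n U (small_part n U d) b1 b2 < \<infinity>"
  shows "integrable (chart_space n U) (\<lambda>w. chart_pairing w
     (dbar_e1 n \<kappa> w)
     (dbar_e2 n \<kappa> w) (b1 w) (b2 w))"
proof -
  define F where "F = dbar_dir (\<lambda>x. complex_of_real (\<kappa> x))"
  have sm: "smooth_on (\<lambda>x. complex_of_real (\<kappa> x)) U" by (rule smooth_on_of_real[OF assms(1,5)])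
  have al: "antilinear (F z)" if "z \<in> U" for z
    unfolding F_def by (rule antilinear_dbar_dir[OF smooth_on_differentiable[OF sm that]])
  have ct: "continuous_on U (\<lambda>z. F z v)" for v
    unfolding F_def by (rule continuous_on_dbar_dir[OF sm])
  obtain M where M: "M \<ge> 0" "\<And>z v. z \<in> cball 0 d \<Longrightarrow> cmod (F z v) \<le> M * norm v"
    using antilinear_field_bounded[of "cball 0 d" F] al assms(4) continuous_on_subset[OF ct assms(4)] compact_cball
    by (metis subsetD)
  have meas: "(\<lambda>w. F (An_chart1 n w) (An_e1 n w)) \<in> borel_measurable (chart_space n U)"
    "(\<lambda>w. F (An_chart1 n w) (An_e2 n w)) \<in> borel_measurable (chart_space n U)"
    by (rule antilinear_field_measurable[OF assms(1) al ct]; assumption)+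
  have "integrable (chart_space n U) (\<lambda>w. chart_pairing w (F (An_chart1 n w) (An_e1 n w))
      (F (An_chart1 n w) (An_e2 n w)) (b1 w) (b2 w))"
  proof (rule chart_pairing_integrable[OF assms(1-3) M(1) meas b fin])
    fix w assume "w \<in> small_part n U d"
    then have w: "An_chart1 n w \<in> cball 0 d" by (simp add: small_part_def)
    show "chart_norm n w (F (An_chart1 n w) (An_e1 n w)) (F (An_chart1 n w) (An_e2 n w)) \<le> M"
      using w assms(4) by (intro frame_norm_antilinear_le al M) auto
  next
    fix w assume w: "w \<in> An_dom1 n U" "w \<notin> small_part n U d"
    define S where "S = {w \<in> An_dom1 n U. An_chart1 n w \<in> {z. d < norm z}}"
    have "open {z :: complex ^ 3. d < norm z}" by (intro open_Collect_less continuous_intros)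
    from continuous_open_preimage[OF continuous_on_An_chart1' open_An_dom1[OF assms(1)] this]
    have S: "open S" by (simp add: S_def vimage_def Int_def)
    have z: "complex_of_real (\<kappa> (An_chart1 n w)) = 0" if "w \<in> S" for w
      using that supp[of "An_chart1 n w"] An_chart1_reg[of w n U] by (auto simp: S_def An_reg_def)
    have wS: "w \<in> S" using w by (auto simp: S_def small_part_def)
    show "F (An_chart1 n w) (An_e1 n w) = 0 \<and> F (An_chart1 n w) (An_e2 n w) = 0"
      unfolding F_def
      using dbar_dir_frame_cong[OF sm smooth_on_const[of 0] S _ wS z] by (auto simp: S_def dbar_dir_const)
  qed
  then show ?thesis unfolding F_def .
qed

text \<open>For (0,1)-forms one sequence is enough: along a subsequence of the scales \<open>2\<^sup>-\<^sup>j\<close> the integrals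
  against radial cut-off functions tend to zero.\<close>

lemma condition_star_1:
  assumes "n \<ge> 1" "p \<ge> 2" "open U" "is_structure_form n U \<omega>" "Lp_form n U p 1 \<phi>"
  shows "\<exists>\<kappa>. cutoff_sequence n U \<kappa> \<and>
     (\<lambda>k. An_integral n U (wedge 2 \<omega> (wedge 1 (dbar (function_form (\<kappa> k))) \<phi>))) \<longlonglongrightarrow> 0"
proof -
  note L = Lp_1_form_chart[OF assms(3,2,5)]
  let ?b1 = "\<lambda>w. on_e1 n \<phi> w"
  let ?b2 = "\<lambda>w. on_e2 n \<phi> w"
  have "\<forall>k. \<exists>j. j \<ge> k \<and> cmod (cutoff_integral n U ?b1 ?b2 (2 ^ j)) < 1 / real (Suc k)"
  proof
    fix k
    obtain j where "j \<ge> k" "cmod (cutoff_integral n U ?b1 ?b2 (2 ^ j)) < 1 / real (Suc k)"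
      by (rule cutoff_integral_small[OF assms(3) zero_less_one _ L(1-3), of "1 / real (Suc k)" k]) simp_all
    then show "\<exists>j. j \<ge> k \<and> cmod (cutoff_integral n U ?b1 ?b2 (2 ^ j)) < 1 / real (Suc k)" by blast
  qed
  from choice[OF this] obtain m
    where m: "\<And>k. m k \<ge> k" "\<And>k. cmod (cutoff_integral n U ?b1 ?b2 (2 ^ m k)) < 1 / real (Suc k)"
    by blast
  have "An_integral n U (wedge 2 \<omega> (wedge 1 (dbar (function_form (radial_cutoff (2 ^ m k)))) \<phi>))
      = cutoff_integral n U ?b1 ?b2 (2 ^ m k)" for k
    unfolding An_integral_chart_space[OF assms(3)] cutoff_integral_def
  proof (rule Bochner_Integration.integral_cong[OF refl])
    fix w assume "w \<in> space (chart_space n U)"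
    then have w: "w \<in> An_dom1 n U" by simp
    show "top_coeff (An_chart1 n) (wedge 2 \<omega> (wedge 1 (dbar (function_form (radial_cutoff (2 ^ m k)))) \<phi>)) w =
      chart_pairing w (dbar_e1 n (radial_cutoff (2 ^ m k)) w)
        (dbar_e2 n (radial_cutoff (2 ^ m k)) w) (?b1 w) (?b2 w)"
      by (rule top_coeff_structure_form[where U = U]) (rule assms smooth_radial_cutoff w L)+
  qed
  then have "(\<lambda>k. An_integral n U (wedge 2 \<omega> (wedge 1 (dbar (function_form (radial_cutoff (2 ^ m k)))) \<phi>))) \<longlonglongrightarrow> 0"
    using LIMSEQ_norm_0[OF m(2)] by simp
  then show ?thesis using cutoff_sequence_radial[of m n U] m(1) by blast
qed

lemma chart_pairing_diff:
  "chart_pairing w (k1 - l1) (k2 - l2) b1 b2 = chart_pairing w k1 k2 b1 b2 - chart_pairing w l1 l2 b1 b2"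
proof -
  have "c * ((k1 - l1) * b2 - (k2 - l2) * b1) = c * (k1 * b2 - k2 * b1) - c * (l1 * b2 - l2 * b1)" for c
    by (simp add: algebra_simps)
  then show ?thesis unfolding chart_pairing_def by blast
qed

text \<open>The difference of two cut-off functions vanishes on the surface near the origin, so up to a
  factor that is one on the relevant part of the surface it defines a test form together with the
  structure form and \<open>\<alpha>\<close>.\<close>

lemma cutoff_difference_formula:
  assumes "n \<ge> 1" "open U" "weak_dbar n U 0 \<phi> \<psi>"
    and \<psi>: "\<And>w. w \<in> An_dom1 n U \<Longrightarrow> \<psi> (An_chart1 n w) [\<i> *s An_e1 n w] = - \<i> * on_e1 n \<psi> w"
       "\<And>w. w \<in> An_dom1 n U \<Longrightarrow> \<psi> (An_chart1 n w) [\<i> *s An_e2 n w] = - \<i> * on_e2 n \<psi> w"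
    and \<alpha>: "smooth_form U 0 1 \<alpha>" "dbar_closed_on_An n U \<alpha>"
    and \<kappa>: "smooth_on \<kappa> U" "smooth_on \<kappa>' U"
    and d: "0 < d" "cball 0 (2 * d) \<subseteq> U"
    and supp: "\<And>z. z \<in> An n U \<Longrightarrow> norm z > d \<Longrightarrow> \<kappa> z = \<kappa>' z"
    and s: "0 < s" "\<And>z. z \<in> An n U \<Longrightarrow> norm z < s \<Longrightarrow> \<kappa> z = \<kappa>' z"
  shows "(LINT w|chart_space n U. chart_pairing w
      (dbar_e1 n \<kappa> w
        - dbar_e1 n \<kappa>' w)
      (dbar_e2 n \<kappa> w
        - dbar_e2 n \<kappa>' w)
      (\<phi> (An_chart1 n w) [] * on_e1 n \<alpha> w) (\<phi> (An_chart1 n w) [] * on_e2 n \<alpha> w))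
    = (LINT w|chart_space n U. chart_pairing w
      (complex_of_real (\<kappa> (An_chart1 n w) - \<kappa>' (An_chart1 n w)) * on_e1 n \<alpha> w)
      (complex_of_real (\<kappa> (An_chart1 n w) - \<kappa>' (An_chart1 n w)) * on_e2 n \<alpha> w)
      (on_e1 n \<psi> w) (on_e2 n \<psi> w))"
proof -
  define cut :: "complex ^ 3 \<Rightarrow> real" where
    "cut z = radial_cutoff (1 / (2 * d)) z * (1 - radial_cutoff (1 / s) z)" for z
  define g where "g z = complex_of_real ((\<kappa> z - \<kappa>' z) * cut z)" for z
  define f where "f z = complex_of_real (\<kappa> z) - complex_of_real (\<kappa>' z)" for z
  have sm: "smooth_on (\<lambda>x. complex_of_real (\<kappa> x)) U" "smooth_on (\<lambda>x. complex_of_real (\<kappa>' x)) U"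
    using smooth_on_of_real[OF assms(2)] \<kappa> by auto
  have gs: "smooth_on g U"
    unfolding g_def[abs_def] cut_def
    by (intro smooth_on_of_real smooth_on_mult smooth_on_diff smooth_on_const smooth_radial_cutoff \<kappa> assms(2))
  have fs: "smooth_on f U" unfolding f_def[abs_def] by (intro smooth_on_diff sm assms(2))
  have X: "An_chart1 n w \<in> An n U" if "w \<in> An_dom1 n U" for w
    using An_chart1_reg[OF that] by (simp add: An_reg_def)
  \<comment> \<open>on the surface the factor \<open>cut\<close> differs from one only where \<open>\<kappa> = \<kappa>'\<close>\<close>
  have gf: "g z = f z" if z: "z \<in> An n U" for z
  proof -
    consider "norm z < s" | "norm z > d" | "s \<le> norm z" "norm z \<le> d" by linarith
    then show ?thesis
    proof cases
      case 3
      have "radial_cutoff (1 / (2 * d)) z = 1" using 3 d by (intro radial_cutoff_near) auto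
      moreover have "radial_cutoff (1 / s) z = 0" using 3 s by (intro radial_cutoff_far) auto
      ultimately show ?thesis by (simp add: g_def f_def cut_def)
    qed (use supp[OF z] s(2)[OF z] in \<open>auto simp: g_def f_def\<close>)
  qed
  have "test_form U 2 1 (residue_wedge n g \<alpha>)"
  proof (rule test_form_residue_wedge[OF assms(1,2) \<alpha>(1) gs])
    show "0 < s / 2" using s(1) by simp
    show "g z = 0" if "norm z < s / 2" for z
    proof -
      have "radial_cutoff (1 / s) z = 1" using that s(1) by (intro radial_cutoff_near) auto
      then show ?thesis by (simp add: g_def cut_def)
    qed
    show "compact (cball 0 (2 * d) :: (complex ^ 3) set)" "cball 0 (2 * d) \<subseteq> U" by (simp_all add: d(2))
    show "g z = 0" if "z \<notin> cball 0 (2 * d)" for z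
    proof -
      have "radial_cutoff (1 / (2 * d)) z = 0" using that d(1) by (intro radial_cutoff_far) auto
      then show ?thesis by (simp add: g_def cut_def)
    qed
  qed
  then have "An_integral n U (wedge 1 \<psi> (residue_wedge n g \<alpha>)) =
      - An_integral n U (wedge 0 \<phi> (dbar (residue_wedge n g \<alpha>)))"
    using assms(3)[unfolded weak_dbar_def, rule_format, of 1 "residue_wedge n g \<alpha>"] by simp
  then have eq: "integral\<^sup>L (chart_space n U) (top_coeff (An_chart1 n) (wedge 0 \<phi> (dbar (residue_wedge n g \<alpha>))))
     = integral\<^sup>L (chart_space n U) (\<lambda>w. - top_coeff (An_chart1 n) (wedge 1 \<psi> (residue_wedge n g \<alpha>)) w)"
    unfolding An_integral_chart_space[OF assms(2)] by simp
  have R: "residue_form n (An_chart1 n w) (An_e1 n w) (An_e2 n w) = - (2 * of_real pi * \<i>) / fst w"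
    if "w \<in> An_dom1 n U" for w
    by (rule residue_form_An_chart1[OF assms(1) fst_nonzero_An_dom1[OF that]])
  have l: "top_coeff (An_chart1 n) (wedge 0 \<phi> (dbar (residue_wedge n g \<alpha>))) w = chart_pairing w
      (dbar_e1 n \<kappa> w
        - dbar_e1 n \<kappa>' w)
      (dbar_e2 n \<kappa> w
        - dbar_e2 n \<kappa>' w)
      (\<phi> (An_chart1 n w) [] * on_e1 n \<alpha> w) (\<phi> (An_chart1 n w) [] * on_e2 n \<alpha> w)"
    if w: "w \<in> An_dom1 n U" for w
  proof -
    have zU: "An_chart1 n w \<in> U" using w by (simp add: An_dom1_def)
    have D: "dbar_dir f (An_chart1 n w) v = dbar_dir (\<lambda>x. complex_of_real (\<kappa> x)) (An_chart1 n w) v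
        - dbar_dir (\<lambda>x. complex_of_real (\<kappa>' x)) (An_chart1 n w) v" for v
      unfolding f_def[abs_def] by (rule dbar_dir_diff; rule smooth_on_differentiable[OF _ zU]; rule sm)
    have G: "dbar_dir g (An_chart1 n w) (An_e1 n w) = dbar_dir f (An_chart1 n w) (An_e1 n w)"
      "dbar_dir g (An_chart1 n w) (An_e2 n w) = dbar_dir f (An_chart1 n w) (An_e2 n w)"
      by (rule dbar_dir_frame_cong[OF gs fs open_An_dom1[OF assms(2)] order_refl w]; simp add: gf X)+
    have alg: "4 * r * (k1 * a2 - k2 * a1) * c = 4 * r * (k1 * (c * a2) - k2 * (c * a1))" for r k1 k2 a1 a2 c :: complex
      by (simp add: algebra_simps)
    show ?thesis
      unfolding top_coeff_An_chart1[OF fst_nonzero_An_dom1[OF w]]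
        wedge_dbar_residue_wedge[OF assms(1) \<alpha> gs An_chart1_reg[OF w] An_frame_tangent[OF fst_nonzero_An_dom1[OF w]]]
        G R[OF w] D chart_pairing_def by (rule alg)
  qed
  have r: "- top_coeff (An_chart1 n) (wedge 1 \<psi> (residue_wedge n g \<alpha>)) w = chart_pairing w
      (complex_of_real (\<kappa> (An_chart1 n w) - \<kappa>' (An_chart1 n w)) * on_e1 n \<alpha> w)
      (complex_of_real (\<kappa> (An_chart1 n w) - \<kappa>' (An_chart1 n w)) * on_e2 n \<alpha> w)
      (on_e1 n \<psi> w) (on_e2 n \<psi> w)"
    if w: "w \<in> An_dom1 n U" for w
  proof -
    have zU: "An_chart1 n w \<in> U" using w by (simp add: An_dom1_def)
    have ai: "\<alpha> (An_chart1 n w) [\<i> *s v] = - \<i> * \<alpha> (An_chart1 n w) [v]" for v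
      using \<alpha>(1) zU covector_1_scale[of UNIV "\<alpha> (An_chart1 n w)" v \<i>] by (auto simp: smooth_form_def)
    have alg: "- (4 * g * r * (a1 * b2 - a2 * b1)) = 4 * r * (g * b1 * a2 - g * b2 * a1)" for r g a1 a2 b1 b2 :: complex
      by (simp add: algebra_simps)
    show ?thesis
      unfolding top_coeff_An_chart1[OF fst_nonzero_An_dom1[OF w]] 
        wedge_residue_wedge[where n = n and g = g and \<psi> = \<psi> and \<alpha> = \<alpha> and z = "An_chart1 n w"
          and u = "An_e1 n w" and v = "An_e2 n w", OF \<psi>[OF w] ai ai]
        R[OF w] gf[OF X[OF w]] f_def chart_pairing_def of_real_diff by (rule alg)
  qed
  have sp: "w \<in> An_dom1 n U" if "w \<in> space (chart_space n U)" for w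
    using that by simp
  show ?thesis
    by (rule trans[OF Bochner_Integration.integral_cong[OF refl l[OF sp, symmetric]]
          trans[OF eq Bochner_Integration.integral_cong[OF refl r[OF sp]]]])
qed

text \<open>The gradients of the given cut-off functions may be arbitrarily large.  The integral is therefore
  compared with the one for a radial cut-off function at a scale where the latter is small; the
  difference is an integral of \<open>\<psi> \<and> \<alpha> \<and> \<omega>\<close> over a small ball, in which no gradient appears.\<close>

lemma condition_star_0:
  assumes "n \<ge> 1" "p \<ge> 2" "open U" "0 \<in> U" "is_structure_form n U \<omega>"
    and "Lp_form n U p 0 \<phi>" "Lp_form n U p 1 \<psi>" "weak_dbar n U 0 \<phi> \<psi>"
    and \<alpha>: "smooth_form U 0 1 \<alpha>" "dbar_closed_on_An n U \<alpha>" and \<kappa>: "cutoff_sequence n U \<kappa>"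
  shows "(\<lambda>k. An_integral n U (wedge 2 \<omega> (wedge 1 (dbar (function_form (\<kappa> k))) (wedge 0 \<phi> \<alpha>)))) \<longlonglongrightarrow> 0"
proof -
  let ?M = "chart_space n U"
  \<comment> \<open>keeps the degree of the forms in the shape \<open>1\<close> in which the lemmas on (0,1)-forms state it\<close>
  note [simp] = One_nat_def[symmetric] and [simp del] = One_nat_def
  obtain d0 where "d0 > 0" "cball 0 d0 \<subseteq> U"
    using assms(3,4) open_contains_cball by blast
  then obtain d where d: "0 < d" "d \<le> 1" "cball 0 d \<subseteq> U"
    using that[of "min d0 1"] by (auto simp: subset_iff)
  define F where "F z v = \<alpha> z [v]" for z v
  have cov: "is_covector UNIV 0 1 (\<alpha> z)" if "z \<in> U" for z
    using \<alpha>(1) that by (simp add: smooth_form_def)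
  have al: "antilinear (F z)" if "z \<in> U" for z
    unfolding antilinear_def F_def using covector_1_antilinear[OF cov[OF that]] by simp
  have ct: "continuous_on U (\<lambda>z. F z v)" for v
    unfolding F_def using \<alpha>(1) by (intro smooth_on_continuous) (simp add: smooth_form_def)
  obtain Ca where Ca: "Ca \<ge> 0" "\<And>z v. z \<in> cball 0 d \<Longrightarrow> cmod (F z v) \<le> Ca * norm v"
  proof (rule antilinear_field_bounded[of "cball 0 d" F])
    show "antilinear (F z)" if "z \<in> cball 0 d" for z using al that d(3) by blast
    show "continuous_on (cball 0 d) (\<lambda>z. F z v)" for v by (rule continuous_on_subset[OF ct d(3)])
  qed auto
  have Fm: "(\<lambda>w. F (An_chart1 n w) (An_e1 n w)) \<in> borel_measurable ?M"
    "(\<lambda>w. F (An_chart1 n w) (An_e2 n w)) \<in> borel_measurable ?M"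
    by (rule antilinear_field_measurable[OF assms(3) al ct]; assumption)+
  have Fn: "chart_norm n w (F (An_chart1 n w) (An_e1 n w)) (F (An_chart1 n w) (An_e2 n w)) \<le> Ca"
    if "w \<in> small_part n U d" for w
    using that d(3) by (intro frame_norm_antilinear_le al Ca) (auto simp: small_part_def)
  note P = Lp_0_form_chart[OF assms(3,2,6)]
  note Q = Lp_1_form_chart[OF assms(3,2,7)]
  define b1 b2 where "b1 w = \<phi> (An_chart1 n w) [] * F (An_chart1 n w) (An_e1 n w)"
    and "b2 w = \<phi> (An_chart1 n w) [] * F (An_chart1 n w) (An_e2 n w)" for w
  have bm: "b1 \<in> borel_measurable ?M" "b2 \<in> borel_measurable ?M"
    unfolding b1_def[abs_def] b2_def[abs_def] by (intro borel_measurable_times P(1) Fm)+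
  have bfin: "pair_mass n U (small_part n U d) b1 b2 < \<infinity>"
  proof -
    let ?f = "\<lambda>w. indicator (small_part n U 1) w
      * ennreal ((cmod (\<phi> (An_chart1 n w) []))\<^sup>2 * vol_density (An_chart1 n) w)"
    note [measurable] = P(1) small_part_sets[OF assms(3), of n 1] vol_density_measurable[OF assms(3), of n]
    have "pair_mass n U (small_part n U d) b1 b2
        \<le> (\<integral>\<^sup>+ w. ennreal (Ca\<^sup>2) * ?f w \<partial>?M)"
      unfolding l2_mass_def
    proof (rule nn_integral_mono)
      fix w assume "w \<in> space ?M"
      then have V: "vol_density (An_chart1 n) w \<ge> 0"
        using vol_density_ge_1[of w n] fst_nonzero_An_dom1[of w n U] by simp
      show "indicator (small_part n U d) w * ennreal ((chart_norm n w (b1 w) (b2 w))\<^sup>2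
          * vol_density (An_chart1 n) w) \<le> ennreal (Ca\<^sup>2) * ?f w"
      proof (cases "w \<in> small_part n U d")
        case True
        then have T1: "w \<in> small_part n U 1" using d(2) by (auto simp: small_part_def)
        have "chart_norm n w (b1 w) (b2 w) \<le> cmod (\<phi> (An_chart1 n w) []) * Ca"
          unfolding b1_def b2_def frame_norm_scale by (rule mult_left_mono[OF Fn[OF True]]) simp
        then have "(chart_norm n w (b1 w) (b2 w))\<^sup>2 \<le> (cmod (\<phi> (An_chart1 n w) []) * Ca)\<^sup>2"
          by (intro power_mono frame_norm_nonneg)
        then have "(chart_norm n w (b1 w) (b2 w))\<^sup>2 * vol_density (An_chart1 n) w
            \<le> (cmod (\<phi> (An_chart1 n w) []) * Ca)\<^sup>2 * vol_density (An_chart1 n) w"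
          by (rule mult_right_mono[OF _ V])
        also have "\<dots> = Ca\<^sup>2 * ((cmod (\<phi> (An_chart1 n w) []))\<^sup>2 * vol_density (An_chart1 n) w)"
          by (simp add: power_mult_distrib)
        finally show ?thesis
          using True T1 V by (simp add: ennreal_mult[symmetric] ennreal_leI)
      qed simp
    qed
    also have "\<dots> = ennreal (Ca\<^sup>2) * (\<integral>\<^sup>+ w. ?f w \<partial>?M)" by (rule nn_integral_cmult) measurable
    also have "\<dots> < \<infinity>" using P(2) by (simp add: l2_mass_def ennreal_mult_less_top)
    finally show ?thesis .
  qed
  define I where "I k = (LINT w|?M. chart_pairing w
     (dbar_e1 n (\<kappa> k) w)
     (dbar_e2 n (\<kappa> k) w) (b1 w) (b2 w))" for k
  have \<kappa>s: "smooth_on (\<kappa> k) U" and \<kappa>b: "z \<in> An n U \<Longrightarrow> 0 \<le> \<kappa> k z \<and> \<kappa> k z \<le> 1" for k z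
    using \<kappa> unfolding cutoff_sequence_def by blast+
  have AI: "An_integral n U (wedge 2 \<omega> (wedge 1 (dbar (function_form (\<kappa> k))) (wedge 0 \<phi> \<alpha>))) = I k" for k
    unfolding An_integral_chart_space[OF assms(3)] I_def
  proof (rule Bochner_Integration.integral_cong[OF refl])
    fix w assume "w \<in> space ?M"
    then have w: "w \<in> An_dom1 n U" by simp
    have zU: "An_chart1 n w \<in> U" using w by (simp add: An_dom1_def)
    have ai: "wedge 0 \<phi> \<alpha> (An_chart1 n w) [\<i> *s v] = - \<i> * wedge 0 \<phi> \<alpha> (An_chart1 n w) [v]" for v
      using covector_1_scale[OF cov[OF zU] UNIV_I, of \<i> v] by (simp add: wedge_0_1)
    show "top_coeff (An_chart1 n) (wedge 2 \<omega> (wedge 1 (dbar (function_form (\<kappa> k))) (wedge 0 \<phi> \<alpha>))) w =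
      chart_pairing w (dbar_e1 n (\<kappa> k) w)
        (dbar_e2 n (\<kappa> k) w) (b1 w) (b2 w)"
      using top_coeff_structure_form[OF assms(1,5) \<kappa>s assms(3) w, of "wedge 0 \<phi> \<alpha>", OF ai ai]
      by (simp add: wedge_0_1 b1_def b2_def F_def)
  qed
  let ?p1 = "\<lambda>w. on_e1 n \<psi> w"
  let ?p2 = "\<lambda>w. on_e2 n \<psi> w"
  define L where "L = enn2real (pair_mass n U (small_part n U 1) ?p1 ?p2)"
  have L: "pair_mass n U (small_part n U 1) ?p1 ?p2 = ennreal L"
    "L \<ge> 0"
    using Q(3) by (simp_all add: L_def less_top)
  obtain C where C: "C > 0"
    "\<And>j. residue_mass n U (small_part n U (1 / 2 ^ j)) \<le> ennreal (C * (real j + 1) / 4 ^ j)"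
    using residue_mass_small_part[OF assms(3)] by blast
  define B where "B = (16 * pi * Ca)\<^sup>2 * C * L"
  have B: "B \<ge> 0" using C(1) L(2) by (simp add: B_def)
  have "I \<longlonglongrightarrow> 0"
  proof (rule LIMSEQ_I)
    fix \<epsilon> :: real assume e: "\<epsilon> > 0"
    \<comment> \<open>\<open>\<delta> \<le> d / 2\<close> leaves room for the support of the test form, and \<open>B * \<delta>\<close> bounds the square of the
      difference of the two integrals\<close>
    have "min (d / 2) ((\<epsilon> / 2)\<^sup>2 / (B + 1)) > 0" using d(1) e B by simp
    then obtain j0 where j0: "1 / 2 ^ j0 < min (d / 2) ((\<epsilon> / 2)\<^sup>2 / (B + 1))"
      using real_arch_pow_inv[of "min (d / 2) ((\<epsilon> / 2)\<^sup>2 / (B + 1))" "1/2"] by (auto simp: power_one_over)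
    define \<delta> where "\<delta> = (1 :: real) / 2 ^ j0"
    have \<delta>: "0 < \<delta>" "2 * \<delta> \<le> d" "\<delta> \<le> d" "\<delta> \<le> 1" "B * \<delta> < (\<epsilon> / 2)\<^sup>2"
    proof -
      show "0 < \<delta>" "2 * \<delta> \<le> d" using j0 by (simp_all add: \<delta>_def)
      then show "\<delta> \<le> d" "\<delta> \<le> 1" using d by auto
      have "(B + 1) * \<delta> < (\<epsilon> / 2)\<^sup>2" using j0 B by (simp add: \<delta>_def field_simps)
      then show "B * \<delta> < (\<epsilon> / 2)\<^sup>2" using \<open>0 < \<delta>\<close> by (simp add: algebra_simps)
    qed
    have rm: "residue_mass n U (small_part n U \<delta>) \<le> ennreal (C * \<delta>)"
    proof -
      have "j0 < 2 ^ j0" by (rule less_exp)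
      then have "real j0 + 1 \<le> 2 ^ j0" by (metis Suc_leI of_nat_Suc of_nat_le_iff of_nat_numeral of_nat_power add.commute)
      moreover have "(4 :: real) ^ j0 = 2 ^ j0 * 2 ^ j0" by (simp flip: power_mult_distrib)
      ultimately have "(real j0 + 1) / 4 ^ j0 \<le> \<delta>"
        using divide_right_mono[of "real j0 + 1" "2 ^ j0" "4 ^ j0"] by (simp add: \<delta>_def)
      then have "C * (real j0 + 1) / 4 ^ j0 \<le> C * \<delta>"
        using mult_left_mono[of "(real j0 + 1) / 4 ^ j0" \<delta> C] C(1) by simp
      then show ?thesis using C(2)[of j0] by (metis \<delta>_def ennreal_leI order_trans)
    qed
    obtain k0 where k0: "\<And>k z. k \<ge> k0 \<Longrightarrow> z \<in> An n U \<Longrightarrow> \<kappa> k z \<noteq> 0 \<Longrightarrow> norm z < \<delta>"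
      using \<kappa> \<delta>(1) unfolding cutoff_sequence_def eventually_sequentially by meson
    obtain m where m: "m \<ge> j0" "cmod (cutoff_integral n U b1 b2 (2 ^ m)) < \<epsilon> / 2"
      by (rule cutoff_integral_small[OF assms(3) d(1) _ bm bfin, of "\<epsilon> / 2" j0]) (use e in auto)
    define H :: "complex ^ 3 \<Rightarrow> real" where "H = radial_cutoff (2 ^ m)"
    have Hs: "smooth_on H U" unfolding H_def by (rule smooth_radial_cutoff)
    have Hz: "norm z < \<delta>" if "H z \<noteq> 0" for z
    proof -
      have "norm z < 1 / 2 ^ m" using radial_cutoff_far[of "2 ^ m" z] that unfolding H_def by fastforce
      also have "(1 :: real) / 2 ^ m \<le> \<delta>"
        unfolding \<delta>_def using m(1) by (intro divide_left_mono power_increasing) auto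
      finally show ?thesis .
    qed
    have "norm (I k - 0) < \<epsilon>" if k: "k \<ge> k0" for k
    proof -
      obtain V where V: "open V" "0 \<in> V" "\<And>z. z \<in> V \<inter> An n U \<Longrightarrow> \<kappa> k z = 1"
        using \<kappa> unfolding cutoff_sequence_def by blast
      then obtain r where r: "r > 0" "ball 0 r \<subseteq> V" using open_contains_ball by blast
      define s where "s = min r (1 / (2 * 2 ^ m))"
      have s: "s > 0" using r(1) by (simp add: s_def)
      have near: "\<kappa> k z = H z" if "z \<in> An n U" "norm z < s" for z
      proof -
        have "\<kappa> k z = 1" using that r(2) by (intro V(3)) (auto simp: s_def)
        moreover have "H z = 1" unfolding H_def using that(2) by (intro radial_cutoff_near) (auto simp: s_def)
        ultimately show ?thesis by simp
      qed
      have far: "\<kappa> k z = H z" if "z \<in> An n U" "norm z > \<delta>" for z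
        using k0[OF k that(1)] Hz[of z] that(2) by fastforce
      have int1: "integrable ?M (\<lambda>w. chart_pairing w
          (dbar_e1 n (\<kappa> k) w)
          (dbar_e2 n (\<kappa> k) w) (b1 w) (b2 w))"
        by (rule chart_pairing_cutoff_integrable[OF assms(3) d \<kappa>s _ bm bfin]) (use k0[OF k] \<delta>(3) in fastforce)
      have int2: "integrable ?M (\<lambda>w. chart_pairing w
          (dbar_e1 n H w)
          (dbar_e2 n H w) (b1 w) (b2 w))"
        by (rule chart_pairing_cutoff_integrable[OF assms(3) d Hs _ bm bfin]) (use Hz \<delta>(3) in fastforce)
      define g where "g w = complex_of_real (\<kappa> k (An_chart1 n w) - H (An_chart1 n w))" for w
      have diff: "I k - cutoff_integral n U b1 b2 (2 ^ m) = (LINT w|?M. chart_pairing w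
          (g w * F (An_chart1 n w) (An_e1 n w)) (g w * F (An_chart1 n w) (An_e2 n w)) (?p1 w) (?p2 w))"
      proof -
        have "cball 0 (2 * \<delta>) \<subseteq> U" using \<delta>(2) d(3) by (meson order_trans subset_cball)
        note f = cutoff_difference_formula[OF assms(1,3,8) Q(4,5) \<alpha> \<kappa>s Hs \<delta>(1) this far s near]
        show ?thesis
          unfolding I_def cutoff_integral_def H_def[symmetric]
          unfolding Bochner_Integration.integral_diff[OF int1 int2, symmetric] chart_pairing_diff[symmetric]
          unfolding g_def F_def b1_def b2_def
          by (rule f)
      qed
      have "(ennreal (cmod (I k - cutoff_integral n U b1 b2 (2 ^ m))))\<^sup>2 \<le>
          (\<integral>\<^sup>+ w. ennreal (cmod (chart_pairing w (g w * F (An_chart1 n w) (An_e1 n w))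
            (g w * F (An_chart1 n w) (An_e2 n w)) (?p1 w) (?p2 w))) \<partial>?M)\<^sup>2"
        unfolding diff by (intro power_mono norm_integral_le_nn_integral) simp
      also have "\<dots> \<le> ennreal ((16 * pi * Ca)\<^sup>2) * residue_mass n U (small_part n U \<delta>)
        * pair_mass n U (small_part n U \<delta>) ?p1 ?p2"
      proof (rule chart_pairing_mass_bound[OF assms(3) small_part_sets[OF assms(3)] Ca(1) Q(1,2)])
        fix w assume w: "w \<in> An_dom1 n U"
        have zX: "An_chart1 n w \<in> An n U" using An_chart1_reg[OF w] by (simp add: An_reg_def)
        {
          assume sw: "w \<in> small_part n U \<delta>"
          have "cmod (g w) \<le> 1"
            unfolding g_def norm_of_real using \<kappa>b[OF zX, of k] radial_cutoff_bounds[of "2 ^ m" "An_chart1 n w"]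
            by (simp add: H_def abs_le_iff)
          moreover have "w \<in> small_part n U d" using sw \<delta>(3) by (auto simp: small_part_def)
          ultimately have "cmod (g w) * chart_norm n w (F (An_chart1 n w) (An_e1 n w)) (F (An_chart1 n w) (An_e2 n w))
              \<le> 1 * Ca"
            using Fn[of w] by (intro mult_mono frame_norm_nonneg) auto
          then show "chart_norm n w (g w * F (An_chart1 n w) (An_e1 n w)) (g w * F (An_chart1 n w) (An_e2 n w)) \<le> Ca"
            by (simp add: frame_norm_scale)
        next
          assume "w \<notin> small_part n U \<delta>"
          then have "norm (An_chart1 n w) > \<delta>" using w by (simp add: small_part_def)
          then show "g w * F (An_chart1 n w) (An_e1 n w) = 0 \<and> g w * F (An_chart1 n w) (An_e2 n w) = 0"
            using far[OF zX] by (simp add: g_def)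
        }
      qed
      also have "\<dots> \<le> ennreal ((16 * pi * Ca)\<^sup>2) * ennreal (C * \<delta>) * ennreal L"
      proof -
        have "small_part n U \<delta> \<subseteq> small_part n U 1" using \<delta>(4) by (auto simp: small_part_def)
        from l2_mass_mono[OF this] show ?thesis
          unfolding L(1)[symmetric] by (intro mult_mono rm) auto
      qed
      also have "\<dots> = ennreal (B * \<delta>)"
        using C(1) L(2) \<delta>(1) by (simp add: B_def ennreal_mult[symmetric] mult_ac)
      finally have "(cmod (I k - cutoff_integral n U b1 b2 (2 ^ m)))\<^sup>2 \<le> B * \<delta>"
        using B \<delta>(1) by (simp add: ennreal_power)
      then have "(cmod (I k - cutoff_integral n U b1 b2 (2 ^ m)))\<^sup>2 < (\<epsilon> / 2)\<^sup>2" using \<delta>(5) by linarith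
      then have "cmod (I k - cutoff_integral n U b1 b2 (2 ^ m)) < \<epsilon> / 2"
        by (rule power_less_imp_less_base) (use e in simp)
      then show ?thesis
        using m(2) norm_triangle_ineq[of "I k - cutoff_integral n U b1 b2 (2 ^ m)" "cutoff_integral n U b1 b2 (2 ^ m)"]
        by simp
    qed
    then show "\<exists>k0. \<forall>k\<ge>k0. norm (I k - 0) < \<epsilon>" by blast
  qed
  then show ?thesis unfolding AI .
qed

theorem theorem5p1:
  fixes n r :: nat and p :: ennreal and U :: "(complex ^ 3) set" and \<omega> \<phi> :: "3 form"
  assumes "n \<ge> 1" and "p \<ge> 2"
    and "open U" and "0 \<in> U"
    and "is_structure_form n U \<omega>"
    and "in_Dom_dbar_w n U p r \<phi>"
  shows "condition_star n U \<omega> r \<phi>"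
proof -
  obtain \<psi> where L: "Lp_form n U p r \<phi>" "Lp_form n U p (r + 1) \<psi>" "weak_dbar n U r \<phi> \<psi>"
    using assms(6) unfolding in_Dom_dbar_w_def by blast
  show ?thesis
    unfolding condition_star_def
  proof (intro conjI impI allI)
    fix \<alpha> \<kappa>
    assume r: "r = 0" and "smooth_form U 0 1 \<alpha> \<and> dbar_closed_on_An n U \<alpha> \<and> cutoff_sequence n U \<kappa>"
    then show "(\<lambda>k. An_integral n U (wedge 2 \<omega> (wedge 1 (dbar (function_form (\<kappa> k))) (wedge 0 \<phi> \<alpha>)))) \<longlonglongrightarrow> 0"
      using condition_star_0[OF assms(1-5)] L unfolding r add_0 by blast
  next
    assume "r = 1"
    then show "\<exists>\<kappa>. cutoff_sequence n U \<kappa> \<and>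
        (\<lambda>k. An_integral n U (wedge 2 \<omega> (wedge 1 (dbar (function_form (\<kappa> k))) \<phi>))) \<longlonglongrightarrow> 0"
      using condition_star_1[OF assms(1-3,5)] L(1) by blast
  qed
qed

end
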